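(* For real $x>1/2$ let $$f_{10}(x)=\frac{(364x^2-227x+36)\,\Gamma(x)^6}{9(2x-1)\,\Gamma(3x)^2}.$$ Then the following series converge and $$\sum_{k=1}^\infty f_{10}'(k)=-36\zeta(4),\qquad \sum_{k=1}^\infty f_{10}''(k)=24\big(17\zeta(5)-2\zeta(2)\zeta(3)\big),$$ $$\sum_{k=1}^\infty f_{10}^{(3)}(k)=12\big(16\zeta(3)^2-261\zeta(6)\big),\qquad \sum_{k=1}^\infty f_{10}^{(4)}(k)=288\big(265\zeta(7)+2\zeta(3)\zeta(4)-102\zeta(2)\zeta(5)\big),$$ $$\frac1{2880}\sum_{k=1}^\infty f_{10}^{(5)}(k)=16\zeta(3)\zeta(5)-99\zeta(8)-24\zeta(5,3)-8\zeta(2)\zeta(3)^2,$$ $$\frac1{960}\sum_{k=1}^\infty f_{10}^{(6)}(k)=25849\zeta(9)+128\zeta(3)^3+30\zeta(3)\zeta(6)+918\zeta(4)\zeta(5)-14310\zeta(2)\zeta(7).$$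
   Context: $\Gamma$ is Euler's gamma function and $f^{(m)}$ (also $f',f''$) is the $m$-th derivative with respect to $x$. $\zeta(s)=\sum_{n\ge1}n^{-s}$ is the Riemann zeta function and $\zeta(5,3)=\sum_{k_1>k_2>0}\frac{1}{k_1^5k_2^3}$. *)

theory Defs
  imports "HOL-Analysis.Analysis"
begin

(* The Dirichlet series; meaningful for s > 1. *)
definition zeta :: "real \<Rightarrow> real" where
  "zeta s = (\<Sum>n. real (Suc n) powr (- s))"

(* Convention k1 > k2 > 0, with the exponent a on the larger index. *)
definition double_zeta :: "nat \<Rightarrow> nat \<Rightarrow> real" where
  "double_zeta a b =
    (\<Sum>\<^sub>\<infinity>(k1, k2) \<in> {(k1 :: nat, k2 :: nat). k1 > k2 \<and> k2 > 0}. 1 / (real k1 ^ a * real k2 ^ b))"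

(* Intended for x > 1/2, an open set, so the values of the total function elsewhere do not
   affect the derivatives at the positive integers. *)
definition f10 :: "real \<Rightarrow> real" where
  "f10 x = (364 * x\<^sup>2 - 227 * x + 36) * Gamma x ^ 6 / (9 * (2 * x - 1) * Gamma (3 * x) ^ 2)"

end

(*
  For S(a) = sum_{k >= 1} f10(k + a) the claim is about the Taylor coefficients of S at 0.
  A Wilf-Zeilberger pair shows that S differs by a 1-periodic function from 2 * pi^2 * (3 / sin^2(pi a) - 4)
  times a convergent series in j whose terms involve
    Gam(j+1+a)^3 Gam(j+1-3a) / (Gam(j+1-a)^3 Gam(j+1+3a)).
  The periodic function is holomorphic up to a removable singularity at 0 and grows at most polynomially in the
  imaginary direction, so it is constant by Liouville's theorem.  Expanding both sides in powers of a gives the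
  coefficients of S as sums over n of products of tails of zeta values divided by powers of n.  Some of these sums
  telescope; the others come from an analogous formula with 2 in place of 3, a Dixon-type summation proved by
  the same argument.
*)
theory Submission
  imports Defs "HOL-Complex_Analysis.Complex_Analysis"
begin

section \<open>Periodic functions on a vertical strip\<close>

text \<open>The first obstacle is convergence. Both series in j diverge like the harmonic series,
  and their certificates do not tend to 0 for large j. A 1-periodic factor times the harmonic terms
  is subtracted, which the shift of \<open>a\<close> does not see. The limit of each certificate is
  a 1-periodic factor times a sum of reciprocals of linear functions of \<open>a\<close>, hence a
  shift difference of Digamma values, and these are added as corrections. The reflection formula
  then dictates the periodic trigonometric term that removes the remaining poles at 0.

  The second obstacle is growth. The Gamma quotient is an infinite product with factors 1 + O(|a|^3
  / i^3), which alone would allow growth like the exponential of |a|^3. For 0 <= Re a <= 1 and |Im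
  a| >= 1 the factors are moreover at most exp (96 / i^2) in modulus, uniformly in \<open>a\<close>.
  This bounds the product, and its distance from 1 is then at most cubic in |a|. The same bound
  controls S, because Gamma(1 + a)^6 / Gamma(1 + 3 a)^2 is an elementary multiple of the Gamma
  quotient at j = 0.\<close>

lemma strip_periodic_const:
  fixes f :: "complex \<Rightarrow> complex"
  assumes d: "0 < d" "d < 1"
    and hol: "f holomorphic_on {z. - d < Re z \<and> Re z < 1 + d} - {0, 1}"
    and per: "\<And>z. - d < Re z \<Longrightarrow> Re z < d \<Longrightarrow> z \<noteq> 0 \<Longrightarrow> f (z + 1) = f z"
    and lim: "f \<midarrow>0\<rightarrow> L"
    and bd: "\<And>z. 0 \<le> Re z \<Longrightarrow> Re z \<le> 1 \<Longrightarrow> 1 \<le> \<bar>Im z\<bar> \<Longrightarrow> norm (f z) \<le> C * \<bar>Im z\<bar> ^ n"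
    and z: "- d < Re z" "Re z < 1 + d" "z \<noteq> 0" "z \<noteq> 1"
  shows "f z = L"
proof -
  define S where "S = {z. - d < Re z \<and> Re z < 1 + d}"
  have oS: "open S"
    unfolding S_def by (intro open_Collect_conj open_halfspace_Re_lt open_halfspace_Re_gt)
  \<comment> \<open>Both punctures get the same value, since periodicity carries the limit from 0 to
    1. The nested form is what two applications of \<open>removable_singularity\<close>, first at 0
    and then at 1, produce.\<close>
  define F where "F = (\<lambda>w. if w = 1 then L else if w = 0 then L else f w)"
  have lim1: "f \<midarrow>1\<rightarrow> L"
  proof -
    have ev: "\<forall>\<^sub>F w in at 0. f w = f (w + 1)"
    proof -
      have "\<forall>\<^sub>F w in at (0::complex). w \<in> ball 0 d - {0}"
        by (rule eventually_at_in_open) (use d in auto)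
      then show ?thesis
      proof eventually_elim
        case (elim w)
        then have "\<bar>Re w\<bar> < d" using abs_Re_le_cmod[of w] by auto
        then show ?case using per[of w] elim by auto
      qed
    qed
    have "(\<lambda>w. f (w + 1)) \<midarrow>0\<rightarrow> L"
      using lim tendsto_cong[OF ev] by blast
    then show ?thesis
      using LIM_offset_zero_iff[of 1 f L] by (simp add: add.commute)
  qed
  have F_hol: "F holomorphic_on S"
  proof -
    define F0 where "F0 = (\<lambda>w. if w = 0 then L else f w)"
    have "F0 holomorphic_on S - {1}"
      unfolding F0_def
      by (rule removable_singularity) (use hol oS lim in \<open>auto simp: S_def Diff_insert2 [symmetric] intro!: open_delete
            elim!: holomorphic_on_subset\<close>)
    moreover have "F0 \<midarrow>1\<rightarrow> L"
    proof -
      have "\<forall>\<^sub>F w in at (1::complex). w \<in> - {0} - {1}"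
        by (rule eventually_at_in_open) auto
      then have "\<forall>\<^sub>F w in at 1. F0 w = f w"
        by eventually_elim (auto simp: F0_def)
      from tendsto_cong[OF this] lim1 show ?thesis by blast
    qed
    ultimately have "(\<lambda>w. if w = 1 then L else F0 w) holomorphic_on S"
      using oS by (intro removable_singularity)
    then show ?thesis unfolding F_def F0_def .
  qed
  have F_per: "F (w + 1) = F w" if "- d < Re w" "Re w < d" for w
  proof -
    have "w + 1 \<noteq> 0"
    proof
      assume "w + 1 = 0"
      then have "Re (w + 1) = 0" by (simp only: zero_complex.sel)
      then show False using that d by simp
    qed
    moreover have "w \<noteq> 1" using that d by auto
    ultimately show ?thesis using per[OF that] unfolding F_def by auto
  qed
  \<comment> \<open>The translates of the strip are glued into an entire function of period 1.
    Neighbouring translates overlap in width 2 d and agree there, so near every point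
    \<open>g\<close> is a single translate of \<open>F\<close>, also where the floor jumps.\<close>
  define g where "g = (\<lambda>z. F (z - of_int \<lfloor>Re z\<rfloor>))"
  have g_eq: "g z = F (z - of_int n)" if "- d < Re z - of_int n" "Re z - of_int n < 1 + d" for z n
  proof -
    have "\<lfloor>Re z\<rfloor> = n - 1 \<or> \<lfloor>Re z\<rfloor> = n \<or> \<lfloor>Re z\<rfloor> = n + 1"
      using that d by linarith
    then show ?thesis
    proof (elim disjE)
      assume *: "\<lfloor>Re z\<rfloor> = n - 1"
      then have "Re z < of_int n" by linarith
      then show ?thesis
        unfolding g_def * using F_per[of "z - of_int n"] that d by (simp add: algebra_simps)
    next
      assume *: "\<lfloor>Re z\<rfloor> = n + 1"
      then have "Re z \<ge> of_int n + 1" by linarith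
      then show ?thesis
        unfolding g_def * using F_per[of "z - of_int n - 1"] that d by (simp add: algebra_simps)
    qed (simp add: g_def)
  qed
  have g_hol: "g holomorphic_on UNIV"
  proof -
    have "\<exists>A. open A \<and> z0 \<in> A \<and> g holomorphic_on A" for z0
    proof -
      define n where "n = \<lfloor>Re z0\<rfloor>"
      define A where "A = (\<lambda>z. z - of_int n) -` S"
      have "open A" unfolding A_def
        by (intro open_vimage oS continuous_intros)
      moreover have "z0 \<in> A"
        unfolding A_def S_def n_def using d by (auto; linarith)
      moreover have "(\<lambda>z. F (z - of_int n)) holomorphic_on A"
        by (intro holomorphic_on_compose_gen[OF _ F_hol, unfolded o_def] holomorphic_intros)
           (auto simp: A_def)
      then have "g holomorphic_on A"
        by (rule holomorphic_transform) (use g_eq in \<open>auto simp: A_def S_def\<close>)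
      ultimately show ?thesis by blast
    qed
    then show ?thesis
      by (meson UNIV_I analytic_on_open analytic_on_analytic_at holomorphic_on_open open_UNIV
          holomorphic_on_imp_differentiable_at field_differentiable_def)
  qed
  obtain M where M: "\<And>w. 0 \<le> Re w \<Longrightarrow> Re w \<le> 1 \<Longrightarrow> \<bar>Im w\<bar> \<le> 1 \<Longrightarrow> norm (F w) \<le> M"
  proof -
    define K where "K = cbox (Complex 0 (-1)) (Complex 1 1)"
    have "K \<subseteq> S" unfolding K_def S_def using d by (auto simp: in_cbox_complex_iff)
    then have "continuous_on K F"
      using F_hol holomorphic_on_imp_continuous_on holomorphic_on_subset by blast
    then have "compact (F ` K)"
      unfolding K_def using compact_cbox compact_continuous_image by blast
    then obtain M where "\<forall>w\<in>F ` K. norm w \<le> M"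
      using compact_imp_bounded bounded_iff by blast
    then show ?thesis
      by (intro that[of M]) (auto simp: K_def in_cbox_complex_iff abs_le_iff)
  qed
  have M0: "0 \<le> M" using M[of 0] norm_ge_zero order_trans by (metis abs_zero le_numeral_extra(3) zero_complex.sel(1,2) zero_le_one)
  have bound: "norm (g z) \<le> (\<bar>C\<bar> + M) * norm z ^ n" if "1 \<le> norm z" for z
  proof -
    define w where "w = z - of_int \<lfloor>Re z\<rfloor>"
    have w: "0 \<le> Re w" "Re w \<le> 1" "Im w = Im z"
      unfolding w_def by (auto; linarith)+
    have gz: "g z = F w" by (simp add: g_def w_def)
    have n1: "1 \<le> norm z ^ n" using that by simp
    show ?thesis
    proof (cases "1 \<le> \<bar>Im z\<bar>")
      case True
      then have "w \<noteq> 0" "w \<noteq> 1" using w by auto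
      then have "norm (g z) \<le> C * \<bar>Im z\<bar> ^ n"
        using bd[of w] w True gz by (simp add: F_def)
      also have "\<dots> \<le> \<bar>C\<bar> * norm z ^ n"
        by (intro mult_mono power_mono) (auto simp: abs_Im_le_cmod)
      also have "\<dots> \<le> (\<bar>C\<bar> + M) * norm z ^ n"
        using M0 by (intro mult_right_mono) auto
      finally show ?thesis .
    next
      case False
      then have "norm (g z) \<le> M * 1" using M[of w] w gz by simp
      also have "\<dots> \<le> (\<bar>C\<bar> + M) * norm z ^ n"
        using M0 n1 by (intro mult_mono) auto
      finally show ?thesis .
    qed
  qed
  \<comment> \<open>An entire function of polynomial growth is a polynomial; this one takes the
    value \<open>L\<close> at every natural number, so it is constant.\<close>
  define c where "c = (\<lambda>k. (deriv ^^ k) g 0 / fact k)"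
  have poly: "g w = (\<Sum>k\<le>n. c k * w ^ k)" for w
    unfolding c_def by (rule Liouville_polynomial[OF g_hol bound])
  define p where "p = (\<Sum>k\<le>n. monom (c k) k) - [:L:]"
  have pg: "Polynomial.poly p w = g w - L" for w
    by (simp add: p_def poly poly_sum poly_monom)
  have "g (of_nat m) = L" for m
    by (simp add: g_def F_def)
  then have "range of_nat \<subseteq> {w. Polynomial.poly p w = 0}"
    by (auto simp: pg)
  then have "\<not> finite {w. Polynomial.poly p w = 0}"
    using finite_subset infinite_UNIV_char_0[where ?'a = nat] finite_imageD[of "of_nat :: nat \<Rightarrow> complex" UNIV]
    by (metis inj_of_nat)
  then have "p = 0" using poly_roots_finite by blast
  then have "g z = L" using pg[of z] by simp
  moreover have "g z = F z" using g_eq[of z 0] z by simp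
  ultimately show ?thesis using z by (simp add: F_def)
qed

section \<open>Infinite products and the asymptotic behaviour of Gamma\<close>

text \<open>In effect \<open>x j\<close> is the infinite product of the \<open>q i\<close> with i >
  j. The two bounds on the factors have different tasks: \<open>d\<close> ends up in an exponent and
  should be uniform in a parameter, whereas \<open>c\<close> enters the result linearly and may grow
  polynomially with it.\<close>

lemma tail_product_bound:
  fixes x q :: "nat \<Rightarrow> complex" and c d :: real
  assumes st: "\<And>i. J < i \<Longrightarrow> x (i - 1) = x i * q i"
    and lim: "x \<longlonglongrightarrow> 1"
    and q1: "\<And>i. J < i \<Longrightarrow> norm (q i) \<le> exp (d / real i ^ 2)"
    and q2: "\<And>i. J < i \<Longrightarrow> norm (q i - 1) \<le> c / real i ^ 3"
    and d: "0 \<le> d" and c: "0 \<le> c" and j: "J \<le> j"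
  shows "norm (x j) \<le> exp (2 * d)"
    and "norm (x j - 1) \<le> 2 * exp (2 * d) * c / real (Suc j) ^ 2"
proof -
  have A: "norm (x j) \<le> norm (x N) * exp (2 * d)" if "J \<le> j" "j \<le> N" for j N
  proof -
    have "norm (x j) \<le> norm (x N) * exp (2 * d * (1 / real (Suc j) - 1 / real (Suc N)))"
      using that(2)
    proof (induction N rule: dec_induct)
      case (step N)
      \<comment> \<open>The sum of the 1 / i^2 is majorised by a telescoping one, as 1 / r^2 <= 2 (1
        / r - 1 / (r + 1)) for r >= 1; hence the factor 2 in the exponent.\<close>
      have e: "d / real (Suc N) ^ 2 \<le> 2 * d * (1 / real (Suc N) - 1 / real (Suc (Suc N)))"
      proof -
        have "1 / real (Suc N) ^ 2 \<le> 2 * (1 / real (Suc N) - 1 / real (Suc (Suc N)))"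
        proof -
          define r where "r = real (Suc N)"
          have r: "1 \<le> r" by (simp add: r_def)
          have "2 * (1 / r - 1 / (r + 1)) - 1 / r ^ 2 = (r - 1) / (r ^ 2 * (r + 1))"
            using r by (simp add: divide_simps) (simp add: algebra_simps power2_eq_square)
          moreover have "0 \<le> (r - 1) / (r ^ 2 * (r + 1))"
            using r by (intro divide_nonneg_nonneg mult_nonneg_nonneg) auto
          ultimately have "1 / r ^ 2 \<le> 2 * (1 / r - 1 / (r + 1))"
            by linarith
          then show ?thesis by (simp add: r_def add.commute)
        qed
        from mult_left_mono[OF this d] show ?thesis by (simp add: mult_ac)
      qed
      have "norm (x N) = norm (x (Suc N)) * norm (q (Suc N))"
        using st[of "Suc N"] step that(1) by (simp add: norm_mult)
      also have "\<dots> \<le> norm (x (Suc N)) * exp (2 * d * (1 / real (Suc N) - 1 / real (Suc (Suc N))))"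
        using q1[of "Suc N"] step that(1) e
        by (intro mult_left_mono) (auto intro: order_trans)
      finally have "norm (x N) * exp (2 * d * (1 / real (Suc j) - 1 / real (Suc N))) \<le>
        norm (x (Suc N)) * (exp (2 * d * (1 / real (Suc N) - 1 / real (Suc (Suc N)))) *
          exp (2 * d * (1 / real (Suc j) - 1 / real (Suc N))))"
        by (metis exp_ge_zero mult.assoc mult_right_mono)
      also have "\<dots> = norm (x (Suc N)) * exp (2 * d * (1 / real (Suc j) - 1 / real (Suc (Suc N))))"
        by (simp flip: exp_add add: algebra_simps)
      finally show ?case using step.IH by linarith
    qed simp
    also have "\<dots> \<le> norm (x N) * exp (2 * d)"
    proof -
      have "1 / real (Suc j) \<le> 1" "0 \<le> 1 / real (Suc N)" by simp_all
      then have "2 * d * (1 / real (Suc j) - 1 / real (Suc N)) \<le> 2 * d * 1"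
        using d by (intro mult_left_mono) linarith+
      then show ?thesis by (intro mult_left_mono) auto
    qed
    finally show ?thesis .
  qed
  have B: "norm (x j) \<le> exp (2 * d)" if "J \<le> j" for j
  proof (rule tendsto_lowerbound)
    show "(\<lambda>N. norm (x N) * exp (2 * d)) \<longlonglongrightarrow> exp (2 * d)"
      using tendsto_mult[OF tendsto_norm[OF lim] tendsto_const[of "exp (2 * d)"]] by simp
    show "\<forall>\<^sub>F N in sequentially. norm (x j) \<le> norm (x N) * exp (2 * d)"
      using eventually_ge_at_top[of j] by eventually_elim (use A that in auto)
  qed simp
  from B[OF j] show "norm (x j) \<le> exp (2 * d)" .
  define K where "K = exp (2 * d) * c"
  have K0: "0 \<le> K" using c by (simp add: K_def)
  \<comment> \<open>Consecutive differences are x (N + 1) (q (N + 1) - 1); the cubes in the bound on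
    \<open>q - 1\<close> are again majorised by a telescoping sum, of differences of 1 /
    r^2.\<close>
  have C: "norm (x j - x N) \<le> 2 * K / real (Suc j) ^ 2" if "j \<le> N" for N
  proof -
    have "norm (x j - x N) \<le> 2 * K * (1 / real (Suc j) ^ 2 - 1 / real (Suc N) ^ 2)"
      using that
    proof (induction N rule: dec_induct)
      case (step N)
      have "x N - x (Suc N) = x (Suc N) * (q (Suc N) - 1)"
        using st[of "Suc N"] step j by (simp add: algebra_simps)
      then have "norm (x N - x (Suc N)) = norm (x (Suc N)) * norm (q (Suc N) - 1)"
        by (simp add: norm_mult)
      also have "\<dots> \<le> exp (2 * d) * (c / real (Suc N) ^ 3)"
        using B[of "Suc N"] q2[of "Suc N"] step j by (intro mult_mono) auto
      also have "\<dots> = K * (1 / real (Suc N) ^ 3)" by (simp add: K_def)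
      also have "\<dots> \<le> K * (2 * (1 / real (Suc N) ^ 2 - 1 / real (Suc (Suc N)) ^ 2))"
      proof (rule mult_left_mono[OF _ K0])
        define r where "r = real (Suc N)"
        have r: "1 \<le> r" by (simp add: r_def)
        have eq: "2 * (1 / r ^ 2 - 1 / (r + 1) ^ 2) - 1 / r ^ 3 =
            (3 * r ^ 2 - 1) / (r ^ 3 * (r + 1) ^ 2)"
          using r by (simp add: divide_simps) (simp add: algebra_simps power2_eq_square power3_eq_cube)
        have "0 \<le> (3 * r ^ 2 - 1) / (r ^ 3 * (r + 1) ^ 2)"
          using r one_le_power[of r 2] by (intro divide_nonneg_nonneg mult_nonneg_nonneg zero_le_power) linarith+
        then have "1 / r ^ 3 \<le> 2 * (1 / r ^ 2 - 1 / (r + 1) ^ 2)"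
          using eq by linarith
        then show "1 / real (Suc N) ^ 3 \<le> 2 * (1 / real (Suc N) ^ 2 - 1 / real (Suc (Suc N)) ^ 2)"
          by (simp add: r_def add.commute)
      qed
      finally have s: "norm (x N - x (Suc N)) \<le> 2 * K * (1 / real (Suc N) ^ 2 - 1 / real (Suc (Suc N)) ^ 2)"
        by (simp add: mult_ac)
      have "norm (x j - x (Suc N)) \<le> norm (x j - x N) + norm (x N - x (Suc N))"
        using norm_triangle_ineq[of "x j - x N" "x N - x (Suc N)"] by simp
      also have "\<dots> \<le> 2 * K * (1 / real (Suc j) ^ 2 - 1 / real (Suc N) ^ 2) +
          2 * K * (1 / real (Suc N) ^ 2 - 1 / real (Suc (Suc N)) ^ 2)"
        using step.IH s by (rule add_mono)
      also have "\<dots> = 2 * K * (1 / real (Suc j) ^ 2 - 1 / real (Suc (Suc N)) ^ 2)"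
        by (simp only: flip: distrib_left) simp
      finally show ?case .
    qed simp
    also have "\<dots> \<le> 2 * K * (1 / real (Suc j) ^ 2)"
      using K0 by (intro mult_left_mono) auto
    finally show ?thesis by simp
  qed
  have "norm (x j - 1) \<le> 2 * K / real (Suc j) ^ 2"
  proof (rule tendsto_upperbound)
    show "(\<lambda>N. norm (x j - x N)) \<longlonglongrightarrow> norm (x j - 1)"
      by (intro tendsto_intros lim)
    show "\<forall>\<^sub>F N in sequentially. norm (x j - x N) \<le> 2 * K / real (Suc j) ^ 2"
      using eventually_ge_at_top[of j] by eventually_elim (use C in auto)
  qed simp
  then show "norm (x j - 1) \<le> 2 * exp (2 * d) * c / real (Suc j) ^ 2"
    by (simp add: K_def mult_ac)
qed

text \<open>This is Gamma(n + 1 + z) ~ n! n^z. For Re z > 0 it is Euler's limit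
  \<open>rGamma_series\<close>, where the Pochhammer symbol has no zero; the recurrence extends it
  to the left one unit at a time, the extra factor 1 + (1 + z) / n tending to 1.\<close>

lemma rGamma_asymptotic:
  fixes z :: complex
  shows "(\<lambda>n. rGamma (of_nat (Suc n) + z) * fact n * exp (z * of_real (ln (real n)))) \<longlonglongrightarrow> 1"
proof -
  have pos: "(\<lambda>n. rGamma (of_nat (Suc n) + z) * fact n * exp (z * of_real (ln (real n)))) \<longlonglongrightarrow> 1"
    if "0 < Re z" for z :: complex
  proof -
    have z: "z \<notin> \<int>\<^sub>\<le>\<^sub>0" using that by (auto elim!: nonpos_Ints_cases)
    then have nz: "rGamma z \<noteq> 0" by (simp add: rGamma_eq_zero_iff)
    have "(\<lambda>n. rGamma z / rGamma_series z n) \<longlonglongrightarrow> rGamma z / rGamma z"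
      by (intro tendsto_intros nz)
    also have "(\<lambda>n. rGamma z / rGamma_series z n) =
      (\<lambda>n. rGamma (of_nat (Suc n) + z) * fact n * exp (z * of_real (ln (real n))))"
    proof
      fix n
      have "pochhammer z (Suc n) \<noteq> 0" using z pochhammer_eq_0_imp_nonpos_Int by blast
      moreover have "rGamma z = pochhammer z (Suc n) * rGamma (z + of_nat (Suc n))"
        by (rule pochhammer_rGamma)
      ultimately show "rGamma z / rGamma_series z n =
          rGamma (of_nat (Suc n) + z) * fact n * exp (z * of_real (ln (real n)))"
        by (simp add: rGamma_series_def add.commute field_simps)
    qed
    finally show ?thesis using nz by simp
  qed
  have shift: "(\<lambda>n. rGamma (of_nat (Suc n) + z) * fact n * exp (z * of_real (ln (real n)))) \<longlonglongrightarrow> 1"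
    if "0 < Re z + real k" for z :: complex and k
    using that
  proof (induction k arbitrary: z)
    case 0
    then show ?case using pos by simp
  next
    case (Suc k)
    have IH: "(\<lambda>n. rGamma (of_nat (Suc n) + (z + 1)) * fact n * exp ((z + 1) * of_real (ln (real n)))) \<longlonglongrightarrow> 1"
      by (rule Suc.IH) (use Suc.prems in \<open>simp add: add.commute add.left_commute\<close>)
    have "(\<lambda>n. 1 + (1 + z) * inverse (of_nat n)) \<longlonglongrightarrow> 1 + (1 + z) * 0"
      by (intro tendsto_intros lim_inverse_n)
    from tendsto_mult[OF this IH]
    have "(\<lambda>n. (1 + (1 + z) * inverse (of_nat n)) *
        (rGamma (of_nat (Suc n) + (z + 1)) * fact n * exp ((z + 1) * of_real (ln (real n))))) \<longlonglongrightarrow> 1"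
      by simp
    moreover have "\<forall>\<^sub>F n in sequentially. (1 + (1 + z) * inverse (of_nat n)) *
        (rGamma (of_nat (Suc n) + (z + 1)) * fact n * exp ((z + 1) * of_real (ln (real n)))) =
        rGamma (of_nat (Suc n) + z) * fact n * exp (z * of_real (ln (real n)))"
      using eventually_gt_at_top[of 0]
    proof eventually_elim
      case (elim n)
      have "rGamma (of_nat (Suc n) + z) = (of_nat (Suc n) + z) * rGamma (of_nat (Suc n) + (z + 1))"
        using rGamma_plus1[of "of_nat (Suc n) + z"] by (simp add: add_ac)
      moreover have "exp ((z + 1) * of_real (ln (real n))) = exp (z * of_real (ln (real n))) * of_nat n"
        using elim by (simp add: distrib_right exp_add exp_of_real)
      ultimately show ?case using elim by (simp add: field_simps)
    qed
    ultimately show ?case by (rule Lim_transform_eventually)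
  qed
  obtain k :: nat where "- Re z < real k" using reals_Archimedean2 by blast
  then have "0 < Re z + real k" by simp
  then show ?thesis by (rule shift)
qed

section \<open>Quotients of Gamma functions\<close>

text \<open>Formally, \<open>ln (ph p a j)\<close> is the sum of \<open>2 / s * (p^s - p) * a^s * zeta_tail s j\<close> over the odd
  \<open>s \<ge> 3\<close>; this is how tails of zeta values enter the Taylor coefficients. The factor \<open>qf\<close> relates
  consecutive values of \<open>ph\<close>.\<close>

definition ph :: "nat \<Rightarrow> complex \<Rightarrow> nat \<Rightarrow> complex" where
  "ph p a j = Gamma (of_nat (Suc j) + a) ^ p * Gamma (of_nat (Suc j) - of_nat p * a) *
     rGamma (of_nat (Suc j) - a) ^ p * rGamma (of_nat (Suc j) + of_nat p * a)"

definition qf :: "nat \<Rightarrow> complex \<Rightarrow> nat \<Rightarrow> complex" where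
  "qf p a i = (of_nat i - a) ^ p * (of_nat i + of_nat p * a) /
     ((of_nat i + a) ^ p * (of_nat i - of_nat p * a))"

lemma ph_step:
  assumes "0 < i" "of_nat i + a \<notin> \<int>\<^sub>\<le>\<^sub>0" "of_nat i - of_nat p * a \<notin> \<int>\<^sub>\<le>\<^sub>0"
  shows "ph p a (i - 1) = ph p a i * qf p a i"
proof -
  have 1: "Gamma (of_nat (Suc i) + a) = (of_nat i + a) * Gamma (of_nat i + a)"
    using Gamma_plus1[OF assms(2)] by (simp add: add_ac)
  have 2: "Gamma (of_nat (Suc i) - of_nat p * a) = (of_nat i - of_nat p * a) * Gamma (of_nat i - of_nat p * a)"
    using Gamma_plus1[OF assms(3)] by (simp add: algebra_simps)
  have 3: "rGamma (of_nat i - a) = (of_nat i - a) * rGamma (of_nat (Suc i) - a)"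
    using rGamma_plus1[of "of_nat i - a"] by (simp add: algebra_simps)
  have 4: "rGamma (of_nat i + of_nat p * a) = (of_nat i + of_nat p * a) * rGamma (of_nat (Suc i) + of_nat p * a)"
    using rGamma_plus1[of "of_nat i + of_nat p * a"] by (simp add: algebra_simps)
  have nz: "of_nat i + a \<noteq> 0" "of_nat i - of_nat p * a \<noteq> 0"
    using assms(2,3) by auto
  have "Suc (i - 1) = i" using assms(1) by simp
  moreover have "G1 ^ p * G2 * (u * R1) ^ p * (v * R2) =
      (w * G1) ^ p * (z * G2) * R1 ^ p * R2 * ((u ^ p * v) / (w ^ p * z))"
    if "w \<noteq> 0" "z \<noteq> 0" for G1 G2 u R1 v R2 w z :: complex
    using that by (simp add: power_mult_distrib)
  note this[OF nz]
  ultimately show ?thesis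
    unfolding ph_def qf_def 1 2 by (simp only: 3 4)
qed

text \<open>The exponents of n in the four Gamma factors are p a, - p a, p a and - p a, and they add
  up to 0.\<close>

lemma ph_lim: "ph p a \<longlonglongrightarrow> 1"
proof -
  define L where "L = (\<lambda>z n. rGamma (of_nat (Suc n) + z :: complex) * fact n * exp (z * of_real (ln (real n))))"
  have L: "L z \<longlonglongrightarrow> 1" for z
    unfolding L_def by (rule rGamma_asymptotic)
  have "(\<lambda>n. L (- a) n ^ p * L (of_nat p * a) n / (L a n ^ p * L (- (of_nat p * a)) n)) \<longlonglongrightarrow>
      1 ^ p * 1 / (1 ^ p * 1)"
    by (intro tendsto_intros L) auto
  moreover have "L (- a) n ^ p * L (of_nat p * a) n / (L a n ^ p * L (- (of_nat p * a)) n) = ph p a n" for n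
  proof -
    define e where "e = exp (a * of_real (ln (real n)))"
    have e0: "e \<noteq> 0" by (simp add: e_def)
    have e1: "exp (- a * of_real (ln (real n))) = inverse e" by (simp add: e_def exp_minus)
    have e2: "exp (of_nat p * a * of_real (ln (real n))) = e ^ p"
      by (simp add: e_def exp_of_nat_mult [symmetric] mult_ac)
    have e3: "exp (- (of_nat p * a) * of_real (ln (real n))) = inverse (e ^ p)"
      by (simp add: e2 [symmetric] exp_minus)
    show ?thesis
      unfolding L_def e1 e2 e3 e_def [symmetric] ph_def Gamma_def
      using e0 by (simp add: field_simps power_mult_distrib power_inverse)
  qed
  ultimately show ?thesis by simp
qed

text \<open>Numerator and denominator of \<open>qf\<close> arise from each other by changing the
  sign of \<open>a\<close>, and neither has a linear term in \<open>a\<close>, so their difference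
  starts with the cube. Hence the product over i converges, and the expansion of \<open>ph\<close>
  begins with 1 + O(a^3).\<close>

lemma qf_minus_1:
  assumes "of_nat i + a \<noteq> 0" "of_nat i - of_nat p * a \<noteq> 0"
  shows "p = 2 \<Longrightarrow> qf p a i - 1 = 4 * a ^ 3 / ((of_nat i + a) ^ 2 * (of_nat i - 2 * a))"
    and "p = 3 \<Longrightarrow> qf p a i - 1 = 16 * of_nat i * a ^ 3 / ((of_nat i + a) ^ 3 * (of_nat i - 3 * a))"
proof -
  assume p: "p = 2"
  have "(of_nat i - a) ^ 2 * (of_nat i + 2 * a) - (of_nat i + a) ^ 2 * (of_nat i - 2 * a) = 4 * a ^ 3"
    by (simp add: power2_eq_square power3_eq_cube algebra_simps)
  then show "qf p a i - 1 = 4 * a ^ 3 / ((of_nat i + a) ^ 2 * (of_nat i - 2 * a))"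
    using assms p
    by (simp only: qf_def of_nat_numeral) (simp add: diff_divide_eq_iff diff_divide_distrib [symmetric] divide_diff_eq_iff)
next
  assume p: "p = 3"
  have "(of_nat i - a) ^ 3 * (of_nat i + 3 * a) - (of_nat i + a) ^ 3 * (of_nat i - 3 * a) = 16 * of_nat i * a ^ 3"
    by (simp add: power2_eq_square power3_eq_cube algebra_simps)
  then show "qf p a i - 1 = 16 * of_nat i * a ^ 3 / ((of_nat i + a) ^ 3 * (of_nat i - 3 * a))"
    using assms p
    by (simp only: qf_def of_nat_numeral) (simp add: diff_divide_eq_iff diff_divide_distrib [symmetric] divide_diff_eq_iff)
qed

text \<open>The first bound is uniform in \<open>a\<close>, which the second alone could not give.
  The squared moduli of (i - a) / (i + a) and (i + p a) / (i - p a) are 1 - u and 1 + v. Bernoulli's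
  inequality yields (1 - u)^p (1 + p u) <= 1, so it is enough that v - p u is O(1 / i^2).\<close>

lemma qf_bounds_strip:
  assumes a: "0 \<le> Re a" "Re a \<le> 1" "1 \<le> \<bar>Im a\<bar>" and i: "0 < i" and p: "p = 2 \<or> p = 3"
  shows "norm (qf p a i) \<le> exp (96 / real i ^ 2)"
    and "norm (qf p a i - 1) \<le> 32 * norm a ^ 3 / real i ^ 3"
proof -
  define b y x where "b = Re a" and "y = Im a" and "x = real i"
  define P where "P = real p"
  have b: "0 \<le> b" "b \<le> 1" and y: "1 \<le> y\<^sup>2" and x: "1 \<le> x" and P: "2 \<le> P" "P \<le> 3"
    using a i p power_mono[of 1 "\<bar>Im a\<bar>" 2] by (auto simp: b_def y_def x_def P_def)
  define A where "A = (x - b)\<^sup>2 + y\<^sup>2"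
  define B where "B = (x + b)\<^sup>2 + y\<^sup>2"
  define C where "C = (x + P * b)\<^sup>2 + (P * y)\<^sup>2"
  define D where "D = (x - P * b)\<^sup>2 + (P * y)\<^sup>2"
  have nA: "norm (of_nat i - a) ^ 2 = A" and nB: "norm (of_nat i + a) ^ 2 = B"
    and nC: "norm (of_nat i + of_nat p * a) ^ 2 = C" and nD: "norm (of_nat i - of_nat p * a) ^ 2 = D"
    by (simp_all add: cmod_power2 A_def B_def C_def D_def b_def y_def x_def P_def)
  have Bx: "x\<^sup>2 \<le> B"
  proof -
    have "B = x\<^sup>2 + 2 * x * b + b\<^sup>2 + y\<^sup>2" by (simp add: B_def power2_eq_square algebra_simps)
    then show ?thesis using b x by simp
  qed
  \<comment> \<open>The real part of i - p a may vanish inside the strip; then the imaginary part of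
    p a, of modulus at least p, keeps the denominator large.\<close>
  have Dx: "x\<^sup>2 / 2 \<le> D"
  proof -
    have "P\<^sup>2 * 1 \<le> P\<^sup>2 * y\<^sup>2" using y by (intro mult_left_mono) auto
    then have 1: "P\<^sup>2 \<le> (P * y)\<^sup>2" by (simp add: power_mult_distrib)
    show ?thesis
    proof (cases "P \<le> x")
      case True
      have "(x - P) ^ 2 \<le> (x - P * b) ^ 2"
        using True b P by (intro power_mono) (auto simp: mult_left_le)
      moreover have "(x - P)\<^sup>2 + P\<^sup>2 - x\<^sup>2 / 2 = (x - 2 * P)\<^sup>2 / 2"
        by (simp add: power2_eq_square field_simps)
      ultimately show ?thesis using 1 unfolding D_def
        by (smt (verit) zero_le_power2 divide_nonneg_nonneg)
    next
      case False
      then have "x\<^sup>2 \<le> P\<^sup>2" using x by (intro power_mono) auto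
      then show ?thesis using 1 unfolding D_def
        by (smt (verit) zero_le_power2 field_sum_of_halves)
    qed
  qed
  have B0: "0 < B" and D0: "0 < D" using Bx Dx x by (smt (verit) zero_less_power half_gt_zero)+
  have nz: "of_nat i + a \<noteq> 0" "of_nat i - of_nat p * a \<noteq> 0"
    using nB nD B0 D0 by auto
  define u where "u = 4 * x * b / B"
  define v where "v = 4 * P * x * b / D"
  have AB: "A = B - 4 * x * b" by (simp add: A_def B_def power2_eq_square algebra_simps)
  have CD: "C = D + 4 * P * x * b" by (simp add: C_def D_def power2_eq_square algebra_simps)
  have u0: "0 \<le> u" using b x B0 by (simp add: u_def)
  have u1: "u \<le> 1"
  proof -
    have "0 \<le> A" by (simp add: A_def)
    then show ?thesis using AB B0 by (simp add: u_def)
  qed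
  have v0: "0 \<le> v" using b x D0 P by (simp add: v_def)
  \<comment> \<open>The difference is a positive multiple of 1 / D - 1 / B, and B - D contains the
    square of Im a with a negative coefficient; the upper bound is therefore independent of Im
    a.\<close>
  have vu: "v - P * u \<le> 192 / x\<^sup>2"
  proof -
    have BD: "B - D = 2 * x * b * (1 + P) - (P\<^sup>2 - 1) * (b\<^sup>2 + y\<^sup>2)"
      by (simp add: B_def D_def power2_eq_square algebra_simps)
    have "1 \<le> P\<^sup>2" using P by (simp add: one_le_power)
    then have "0 \<le> (P\<^sup>2 - 1) * (b\<^sup>2 + y\<^sup>2)" by simp
    moreover have "2 * x * b * (1 + P) \<le> 2 * x * 1 * (1 + 3)"
      using b P x by (intro mult_mono) auto
    moreover have "t1 - t2 \<le> 8 * x" if "0 \<le> t2" "t1 \<le> 2 * x * 1 * (1 + 3)" for t1 t2 :: real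
      using that by simp
    ultimately have BD': "B - D \<le> 8 * x" unfolding BD by blast
    have e: "v - P * u = 4 * P * x * b * (B - D) / (B * D)"
      using B0 D0 by (simp add: u_def v_def field_simps)
    have "4 * P * x * b * (B - D) \<le> 96 * x\<^sup>2"
    proof -
      have "4 * P * x * b * (B - D) \<le> 4 * P * x * b * (8 * x)"
        using BD' P x b by (intro mult_left_mono) auto
      also have "\<dots> = 32 * x\<^sup>2 * (P * b)" by (simp add: power2_eq_square)
      also have "\<dots> \<le> 32 * x\<^sup>2 * (3 * 1)" using P b by (intro mult_left_mono mult_mono) auto
      finally show ?thesis by simp
    qed
    then have "v - P * u \<le> 96 * x\<^sup>2 / (B * D)"
      unfolding e using B0 D0 by (intro divide_right_mono) auto
    also have "\<dots> \<le> 96 * x\<^sup>2 / (x\<^sup>2 * (x\<^sup>2 / 2))"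
      using Bx Dx x B0 D0 by (intro divide_left_mono mult_mono mult_pos_pos) auto
    also have "\<dots> = 192 / x\<^sup>2" using x by (simp add: field_simps)
    finally show ?thesis .
  qed
  have main: "(1 - u) ^ p * (1 + v) \<le> exp (192 / x\<^sup>2)"
  proof -
    have bern: "1 + P * u \<le> (1 + u) ^ p"
      unfolding P_def using u0 by (intro Bernoulli_inequality) auto
    have "(1 - u) ^ p * (1 + P * u) \<le> (1 - u) ^ p * (1 + u) ^ p"
      using bern u1 by (intro mult_left_mono) auto
    also have "\<dots> = (1 - u\<^sup>2) ^ p"
      by (simp add: power_mult_distrib [symmetric] power2_eq_square algebra_simps)
    also have "\<dots> \<le> 1" using u0 u1 by (intro power_le_one) (auto simp: abs_square_le_1)
    finally have le1: "(1 - u) ^ p * (1 + P * u) \<le> 1" .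
    have Pu: "0 \<le> P * u" using P u0 by simp
    have "1 + v \<le> 1 + P * u + 192 / x\<^sup>2" using vu by simp
    also have "\<dots> \<le> (1 + P * u) * (1 + 192 / x\<^sup>2)"
    proof -
      have "1 + s + k \<le> (1 + s) * (1 + k)" if "0 \<le> s" "0 \<le> k" for s k :: real
        using that by (simp add: algebra_simps)
      then show ?thesis using Pu by simp
    qed
    finally have "(1 - u) ^ p * (1 + v) \<le> (1 - u) ^ p * ((1 + P * u) * (1 + 192 / x\<^sup>2))"
      using u1 by (intro mult_left_mono) auto
    also have "\<dots> \<le> 1 * (1 + 192 / x\<^sup>2)"
      unfolding mult.assoc [symmetric] using le1 by (intro mult_right_mono) auto
    also have "\<dots> \<le> exp (192 / x\<^sup>2)" by simp
    finally show ?thesis .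
  qed
  have "norm (qf p a i) ^ 2 = A ^ p * C / (B ^ p * D)"
    unfolding qf_def norm_divide norm_mult norm_power power_divide power_mult_distrib nA [symmetric]
      nB [symmetric] nC [symmetric] nD [symmetric] by (simp add: power_mult [symmetric] mult.commute)
  also have "\<dots> = (A / B) ^ p * (C / D)" by (simp add: power_divide)
  also have "A / B = 1 - u" using B0 by (simp add: AB u_def field_simps)
  also have "C / D = 1 + v" using D0 by (simp add: CD v_def field_simps)
  also note main
  also have "exp (192 / x\<^sup>2) = exp (96 / x\<^sup>2) ^ 2"
    by (simp add: exp_of_nat_mult [symmetric] power2_eq_square exp_add [symmetric])
  finally show "norm (qf p a i) \<le> exp (96 / real i ^ 2)"
    unfolding x_def by (rule power2_le_imp_le) simp
  have nb: "x \<le> norm (of_nat i + a)"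
    using Bx x nB by (metis norm_ge_zero power2_le_imp_le)
  have nd: "x / 2 \<le> norm (of_nat i - of_nat p * a)"
  proof (rule power2_le_imp_le)
    have "0 \<le> x\<^sup>2" by simp
    then have "(x / 2)\<^sup>2 \<le> x\<^sup>2 / 2" by (simp add: power_divide)
    then show "(x / 2)\<^sup>2 \<le> (norm (of_nat i - of_nat p * a))\<^sup>2" using Dx nD by simp
  qed simp
  from p show "norm (qf p a i - 1) \<le> 32 * norm a ^ 3 / real i ^ 3"
  proof
    assume p2: "p = 2"
    have "norm (qf p a i - 1) = 4 * norm a ^ 3 / (norm (of_nat i + a) ^ 2 * norm (of_nat i - of_nat p * a))"
      using qf_minus_1(1)[OF nz p2] by (simp add: norm_divide norm_mult norm_power p2)
    also have "\<dots> \<le> 4 * norm a ^ 3 / (x ^ 2 * (x / 2))"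
      using nb nd x nz by (intro divide_left_mono mult_mono power_mono mult_pos_pos zero_less_power) auto
    also have "\<dots> = 8 * norm a ^ 3 / x ^ 3" by (simp add: power2_eq_square power3_eq_cube)
    also have "\<dots> \<le> 32 * norm a ^ 3 / x ^ 3" using x by (intro divide_right_mono mult_right_mono) auto
    finally show ?thesis by (simp add: x_def)
  next
    assume p3: "p = 3"
    have "norm (qf p a i - 1) = 16 * x * norm a ^ 3 / (norm (of_nat i + a) ^ 3 * norm (of_nat i - of_nat p * a))"
      using qf_minus_1(2)[OF nz p3] by (simp add: norm_divide norm_mult norm_power p3 x_def)
    also have "\<dots> \<le> 16 * x * norm a ^ 3 / (x ^ 3 * (x / 2))"
      using nb nd x nz by (intro divide_left_mono mult_mono power_mono mult_pos_pos zero_less_power) auto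
    also have "\<dots> = 32 * norm a ^ 3 / x ^ 3" using x by (simp add: field_simps power3_eq_cube)
    finally show ?thesis by (simp add: x_def)
  qed
qed

lemma nonpos_Ints_ImD: "z \<in> \<int>\<^sub>\<le>\<^sub>0 \<Longrightarrow> Im z = 0 \<and> Re z \<le> 0"
  by (auto elim!: nonpos_Ints_cases)

lemma ph_bounds_strip:
  assumes a: "0 \<le> Re a" "Re a \<le> 1" "1 \<le> \<bar>Im a\<bar>" and p: "p = 2 \<or> p = 3"
  shows "norm (ph p a j) \<le> exp 192"
    and "norm (ph p a j - 1) \<le> 64 * exp 192 * norm a ^ 3 / real (Suc j) ^ 2"
proof -
  have st: "ph p a (i - 1) = ph p a i * qf p a i" if "0 < i" for i
  proof (rule ph_step[OF that])
    show "of_nat i + a \<notin> \<int>\<^sub>\<le>\<^sub>0" using nonpos_Ints_ImD[of "of_nat i + a"] a by auto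
    show "of_nat i - of_nat p * a \<notin> \<int>\<^sub>\<le>\<^sub>0" using nonpos_Ints_ImD[of "of_nat i - of_nat p * a"] a p by auto
  qed
  note T = tail_product_bound[where J = 0, OF st ph_lim qf_bounds_strip(1)[OF a _ p]
      qf_bounds_strip(2)[OF a _ p], of j, simplified]
  show "norm (ph p a j) \<le> exp 192" using T(1) by simp
  show "norm (ph p a j - 1) \<le> 64 * exp 192 * norm a ^ 3 / real (Suc j) ^ 2"
    using T(2) by (simp add: mult_ac)
qed

text \<open>Beyond \<open>J\<close> each index i is at least 6 R, so \<open>of_nat p * a\<close> has
  modulus at most i / 2 and the poles stay away. A bound exponential in R^3 is harmless on compact
  sets; with R = 1/6 it holds from \<open>J = 0\<close> on and serves the expansion at 0.\<close>

lemma ph_bounds_local: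
  assumes a: "norm a \<le> R" and R: "0 \<le> R" and J: "6 * R \<le> real (Suc J)" and p: "p = 2 \<or> p = 3" and j: "J \<le> j"
  shows "norm (ph p a j) \<le> exp (512 * R ^ 3)"
    and "norm (ph p a j - 1) \<le> 512 * exp (512 * R ^ 3) * R ^ 3 / real (Suc j) ^ 2"
proof -
  have lower: "real i / 2 \<le> norm (of_nat i + a)" "real i / 2 \<le> norm (of_nat i - of_nat p * a)"
    "0 < Re (of_nat i + a)" "0 < Re (of_nat i - of_nat p * a)" if "J < i" for i
  proof -
    have i: "6 * R \<le> real i" using that J by linarith
    have pa: "norm (of_nat p * a) \<le> 3 * R"
      unfolding norm_mult using p a by (intro mult_mono) auto
    show "real i / 2 \<le> norm (of_nat i + a)"
      using norm_diff_ineq[of "of_nat i" a] i a R by simp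
    show "real i / 2 \<le> norm (of_nat i - of_nat p * a)"
      using norm_triangle_ineq2[of "of_nat i" "of_nat p * a"] i pa by simp
    have "\<bar>Re a\<bar> \<le> R" "\<bar>Re (of_nat p * a)\<bar> \<le> 3 * R"
      using a pa abs_Re_le_cmod order_trans by blast+
    moreover have "0 < i" using that by simp
    ultimately show "0 < Re (of_nat i + a)" "0 < Re (of_nat i - of_nat p * a)"
      using i by (auto simp: abs_le_iff) 
  qed
  have st: "ph p a (i - 1) = ph p a i * qf p a i" if "J < i" for i
  proof (rule ph_step)
    show "of_nat i + a \<notin> \<int>\<^sub>\<le>\<^sub>0" using nonpos_Ints_ImD[of "of_nat i + a"] lower(3)[OF that] by linarith
    show "of_nat i - of_nat p * a \<notin> \<int>\<^sub>\<le>\<^sub>0"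
      using nonpos_Ints_ImD[of "of_nat i - of_nat p * a"] lower(4)[OF that] by linarith
  qed (use that in simp)
  have q2: "norm (qf p a i - 1) \<le> 256 * R ^ 3 / real i ^ 3" if "J < i" for i
  proof -
    define x where "x = real i"
    have x: "1 \<le> x" using that by (simp add: x_def)
    note l = lower(1,2)[OF that, folded x_def]
    have nz: "of_nat i + a \<noteq> 0" "of_nat i - of_nat p * a \<noteq> 0" using l x by auto
    have a3: "norm a ^ 3 \<le> R ^ 3" using a by (intro power_mono) auto
    from p show ?thesis
    proof
      assume p2: "p = 2"
      have "norm (qf p a i - 1) = 4 * norm a ^ 3 / (norm (of_nat i + a) ^ 2 * norm (of_nat i - of_nat p * a))"
        using qf_minus_1(1)[OF nz p2] by (simp add: norm_divide norm_mult norm_power p2)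
      also have "\<dots> \<le> 4 * R ^ 3 / ((x / 2) ^ 2 * (x / 2))"
        using l x nz a3 R by (intro frac_le mult_mono power_mono mult_pos_pos zero_less_power) auto
      also have "\<dots> = 32 * R ^ 3 / x ^ 3" by (simp add: power2_eq_square power3_eq_cube)
      also have "\<dots> \<le> 256 * R ^ 3 / x ^ 3" using x R by (intro divide_right_mono mult_right_mono) auto
      finally show ?thesis by (simp add: x_def)
    next
      assume p3: "p = 3"
      have "norm (qf p a i - 1) = 16 * x * norm a ^ 3 / (norm (of_nat i + a) ^ 3 * norm (of_nat i - of_nat p * a))"
        using qf_minus_1(2)[OF nz p3] by (simp add: norm_divide norm_mult norm_power p3 x_def)
      also have "\<dots> \<le> 16 * x * R ^ 3 / ((x / 2) ^ 3 * (x / 2))"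
        using l x nz a3 R by (intro frac_le mult_mono power_mono mult_pos_pos zero_less_power) auto
      also have "\<dots> = 256 * R ^ 3 / x ^ 3" using x by (simp add: field_simps power3_eq_cube)
      finally show ?thesis by (simp add: x_def)
    qed
  qed
  have q1: "norm (qf p a i) \<le> exp (256 * R ^ 3 / real i ^ 2)" if "J < i" for i
  proof -
    have "norm (qf p a i) \<le> 1 + norm (qf p a i - 1)"
      using norm_triangle_ineq[of 1 "qf p a i - 1"] by simp
    also have "\<dots> \<le> 1 + 256 * R ^ 3 / real i ^ 3" using q2[OF that] by simp
    also have "\<dots> \<le> 1 + 256 * R ^ 3 / real i ^ 2"
      using that R by (intro add_left_mono divide_left_mono mult_pos_pos zero_less_power power_increasing) auto
    also have "\<dots> \<le> exp (256 * R ^ 3 / real i ^ 2)" by simp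
    finally show ?thesis .
  qed
  note T = tail_product_bound[where J = J, OF st ph_lim q1 q2 _ _ j, simplified]
  have R3: "0 \<le> 256 * R ^ 3" using R by simp
  show "norm (ph p a j) \<le> exp (512 * R ^ 3)" using T(1)[OF R] by simp
  show "norm (ph p a j - 1) \<le> 512 * exp (512 * R ^ 3) * R ^ 3 / real (Suc j) ^ 2"
    using T(2)[OF R] by (simp add: mult_ac)
qed

section \<open>Series of holomorphic functions and their Taylor coefficients\<close>

lemma summable_inverse_Suc_square: "summable (\<lambda>n. K / real (Suc n) ^ 2)"
  using summable_mult[OF sums_summable[OF inverse_squares_sums], of K] by (simp add: add.commute)

text \<open>The majorant starts at an index \<open>J\<close> depending on the point, since the
  estimates for the summands hold only once n is large against |z|; the earlier terms form a finite
  holomorphic sum.\<close>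

lemma holomorphic_suminf:
  fixes f :: "nat \<Rightarrow> complex \<Rightarrow> complex"
  assumes A: "open A" and hol: "\<And>n. f n holomorphic_on A"
    and bd: "\<And>z. z \<in> A \<Longrightarrow> \<exists>d>0. \<exists>K J. \<forall>n\<ge>J. \<forall>y\<in>ball z d \<inter> A. norm (f n y) \<le> K / real (Suc n) ^ 2"
  shows "(\<lambda>z. \<Sum>n. f n z) holomorphic_on A" and "\<And>z. z \<in> A \<Longrightarrow> summable (\<lambda>n. f n z)"
proof -
  have "\<exists>g g'. \<forall>x \<in> A. ((\<lambda>n. f n x) sums g x) \<and> ((\<lambda>n. deriv (f n) x) sums g' x) \<and>
      (g has_field_derivative g' x) (at x)"
  proof (rule series_and_derivative_comparison_complex[OF A])
    show "(f n has_field_derivative deriv (f n) x) (at x)" if "x \<in> A" for n x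
      using hol A that by (rule holomorphic_derivI)
    fix x assume "x \<in> A"
    from bd[OF this] obtain d K J where d: "d > 0"
      and K: "\<And>n y. J \<le> n \<Longrightarrow> y \<in> ball x d \<inter> A \<Longrightarrow> norm (f n y) \<le> K / real (Suc n) ^ 2"
      by blast
    define h where "h = (\<lambda>n. complex_of_real (\<bar>K\<bar> / real (Suc n) ^ 2))"
    have "summable h" unfolding h_def
      by (rule summable_of_real) (rule summable_inverse_Suc_square)
    moreover have "range h \<subseteq> \<real>\<^sub>\<ge>\<^sub>0"
      by (simp only: h_def image_subset_iff nonneg_Reals_of_real_iff) simp
    moreover have "\<forall>\<^sub>F n in sequentially. \<forall>y\<in>ball x d \<inter> A. cmod (f n y) \<le> cmod (h n)"
      using eventually_ge_at_top[of J]
    proof eventually_elim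
      case (elim n)
      show ?case
      proof
        fix y assume "y \<in> ball x d \<inter> A"
        from K[OF elim this] have "cmod (f n y) \<le> K / real (Suc n) ^ 2" .
        also have "\<dots> \<le> \<bar>K\<bar> / real (Suc n) ^ 2" by (intro divide_right_mono) auto
        also have "\<dots> = cmod (h n)" unfolding h_def norm_of_real by (simp del: of_nat_Suc)
        finally show "cmod (f n y) \<le> cmod (h n)" .
      qed
    qed
    ultimately show "\<exists>d h. 0 < d \<and> summable h \<and> range h \<subseteq> \<real>\<^sub>\<ge>\<^sub>0 \<and>
        (\<forall>\<^sub>F n in sequentially. \<forall>y\<in>ball x d \<inter> A. cmod (f n y) \<le> cmod (h n))"
      using d by blast
  qed
  then obtain g g' where g: "\<And>x. x \<in> A \<Longrightarrow> (\<lambda>n. f n x) sums g x"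
    and g': "\<And>x. x \<in> A \<Longrightarrow> (g has_field_derivative g' x) (at x)" by blast
  show "summable (\<lambda>n. f n z)" if "z \<in> A" for z using g[OF that] sums_summable by blast
  have "g holomorphic_on A" using g' A holomorphic_on_open by blast
  then show "(\<lambda>z. \<Sum>n. f n z) holomorphic_on A"
    by (rule holomorphic_transform) (use g sums_unique in blast)
qed

text \<open>By uniform convergence on a disc, the derivatives of the partial sums at 0 converge to
  those of the limit, so Taylor coefficients may be summed termwise. It serves the series in j as
  well as the shifted series of \<open>f10c\<close>.\<close>

lemma has_fps_expansion_suminf:
  fixes f :: "nat \<Rightarrow> complex \<Rightarrow> complex"
  assumes r: "0 < r" and hol: "\<And>n. f n holomorphic_on ball 0 r"
    and bd: "\<And>n z. z \<in> ball 0 r \<Longrightarrow> norm (f n z) \<le> M n" and M: "summable M"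
    and F: "\<And>n. f n has_fps_expansion F n"
  shows "(\<lambda>z. \<Sum>n. f n z) has_fps_expansion Abs_fps (\<lambda>m. \<Sum>n. fps_nth (F n) m)"
    and "summable (\<lambda>n. fps_nth (F n) m)"
proof -
  define g where "g = (\<lambda>z. \<Sum>n. f n z)"
  have ul: "uniform_limit (ball 0 r) (\<lambda>n z. \<Sum>i<n. f i z) g sequentially"
    unfolding g_def by (rule Weierstrass_m_test[OF bd M])
  have "g holomorphic_on ball 0 r"
  proof (rule holomorphic_uniform_sequence[OF open_ball])
    show "(\<lambda>z. \<Sum>i<n. f i z) holomorphic_on ball 0 r" for n
      by (intro holomorphic_intros hol)
    fix x :: complex assume "x \<in> ball 0 r"
    then obtain d where "d > 0" "cball x d \<subseteq> ball 0 r" using open_contains_cball open_ball by blast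
    then show "\<exists>d>0. cball x d \<subseteq> ball 0 r \<and> uniform_limit (cball x d) (\<lambda>n z. \<Sum>i<n. f i z) g sequentially"
      using uniform_limit_on_subset[OF ul] by blast
  qed
  then have G: "g has_fps_expansion fps_expansion g 0"
    using r by (intro has_fps_expansion_fps_expansion[of "ball 0 r"]) auto
  have S: "(\<lambda>n. fps_nth (F n) m) sums fps_nth (fps_expansion g 0) m" for m
  proof -
    have "(\<lambda>n. (deriv ^^ m) (\<lambda>z. \<Sum>i<n. f i z) 0) \<longlonglongrightarrow> (deriv ^^ m) g 0"
      by (rule higher_deriv_complex_uniform_limit[OF ul])
         (use r in \<open>auto intro!: always_eventually holomorphic_on_sum hol\<close>)
    then have "(\<lambda>n. (deriv ^^ m) (\<lambda>z. \<Sum>i<n. f i z) 0 / fact m) \<longlonglongrightarrow> (deriv ^^ m) g 0 / fact m"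
      by (intro tendsto_intros) auto
    moreover have "(deriv ^^ m) (\<lambda>z. \<Sum>i<n. f i z) 0 / fact m = (\<Sum>i<n. fps_nth (F i) m)" for n
    proof -
      have "(\<lambda>z. \<Sum>i<n. f i z) has_fps_expansion (\<Sum>i<n. F i)"
        by (intro fps_expansion_intros F)
      from fps_nth_fps_expansion[OF this, of m] show ?thesis by (simp add: fps_sum_nth)
    qed
    ultimately show ?thesis
      unfolding sums_def fps_expansion_def by simp
  qed
  show "summable (\<lambda>n. fps_nth (F n) m)" using S sums_summable by blast
  have "fps_expansion g 0 = Abs_fps (\<lambda>m. \<Sum>n. fps_nth (F n) m)"
    by (rule fps_ext) (use S sums_unique in auto)
  with G show "(\<lambda>z. \<Sum>n. f n z) has_fps_expansion Abs_fps (\<lambda>m. \<Sum>n. fps_nth (F n) m)"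
    by (simp add: g_def)
qed

section \<open>Reflection formulas and bounds on the strip\<close>

lemma Re_minus_of_nat_notin_Ints: "a \<notin> \<int> \<Longrightarrow> a - of_nat j \<notin> \<int>" "a \<notin> \<int> \<Longrightarrow> a + of_nat j \<notin> \<int>"
  using Ints_add[of "a - of_nat j" "of_nat j"] Ints_diff[of "a + of_nat j" "of_nat j"] by auto

lemma sin_pi_nonzero: "a \<notin> \<int> \<Longrightarrow> sin (of_real pi * a) \<noteq> (0 :: complex)"
  by (auto simp: sin_eq_0 mult.commute)

lemma norm_sin_pi_ge:
  assumes "1 \<le> \<bar>Im a\<bar>"
  shows "1 \<le> norm (sin (of_real pi * a))"
proof -
  define z where "z = of_real pi * a"
  have y: "3 \<le> \<bar>Im z\<bar>"
    using mult_mono[of 3 pi 1 "\<bar>Im a\<bar>"] assms pi_gt3 by (simp add: z_def abs_mult)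
  have e: "4 \<le> exp \<bar>Im z\<bar>"
    using exp_ge_add_one_self[of "\<bar>Im z\<bar>"] y by linarith
  have n: "norm (exp (\<i> * z)) = exp (- Im z)" "norm (exp (- (\<i> * z))) = exp (Im z)"
    by (simp_all add: norm_exp_eq_Re)
  have "norm (sin z) = norm (exp (\<i> * z) - exp (- (\<i> * z))) / 2"
    by (simp add: sin_exp_eq norm_divide norm_mult)
  moreover have "\<bar>exp (- Im z) - exp (Im z)\<bar> \<le> norm (exp (\<i> * z) - exp (- (\<i> * z)))"
    using norm_triangle_ineq3[of "exp (\<i> * z)" "exp (- (\<i> * z))"] unfolding n .
  moreover have "3 \<le> \<bar>exp (- Im z) - exp (Im z)\<bar>"
  proof (cases "0 \<le> Im z")
    case True
    then have "exp (- Im z) \<le> 1" "4 \<le> exp (Im z)" using e by (simp, simp only: abs_of_nonneg)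
    then show ?thesis by linarith
  next
    case False
    then have "exp (Im z) \<le> 1" "4 \<le> exp (- Im z)" using e by (simp, simp only: abs_of_neg not_le)
    then show ?thesis by linarith
  qed
  ultimately show ?thesis by (simp add: z_def)
qed

lemma norm_cot_pi_le:
  assumes "1 \<le> \<bar>Im a\<bar>"
  shows "norm (cot (of_real pi * a)) \<le> 2"
proof -
  define s c where "s = sin (of_real pi * a)" and "c = cos (of_real pi * a)"
  have s: "1 \<le> norm s" using norm_sin_pi_ge[OF assms] by (simp add: s_def)
  have "norm (c\<^sup>2) = norm (1 - s\<^sup>2)" by (simp add: s_def c_def cos_squared_eq)
  also have "\<dots> \<le> 1 + norm s ^ 2" using norm_triangle_ineq4[of 1 "s\<^sup>2"] by (simp add: norm_power)
  also have "\<dots> \<le> (2 * norm s) ^ 2" using one_le_power[OF s, of 2] unfolding power_mult_distrib by simp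
  finally have "norm c ^ 2 \<le> (2 * norm s) ^ 2" unfolding norm_power .
  then have "norm c \<le> 2 * norm s" by (rule power2_le_imp_le) simp
  then show ?thesis using s
    by (simp add: cot_def s_def [symmetric] c_def [symmetric] norm_divide divide_le_eq)
qed

text \<open>Together with \<open>rGamma_minus_of_nat_reflection\<close> this moves Gamma values far
  on the left to the arguments occurring in \<open>ph\<close>. The price is a trigonometric factor
  that depends on j only through the sign (-1)^j.\<close>

lemma Gamma_minus_of_nat_reflection:
  fixes a :: complex
  assumes "a \<notin> \<int>"
  shows "Gamma (a - of_nat j) = (- 1) ^ j * of_real pi / sin (of_real pi * a) * rGamma (of_nat (Suc j) - a)"
proof -
  have "Gamma (a - of_nat j) * Gamma (1 - (a - of_nat j)) = of_real pi / sin (of_real pi * (a - of_nat j))"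
    by (rule Gamma_reflection_complex)
  also have "sin (of_real pi * (a - of_nat j)) = (- 1) ^ j * sin (of_real pi * a)"
  proof (induction j)
    case (Suc j)
    have "sin (of_real pi * (a - of_nat (Suc j))) = sin (of_real pi * (a - of_nat j) - of_real pi)"
      by (simp add: algebra_simps)
    also have "\<dots> = - sin (of_real pi * (a - of_nat j))"
      by (simp add: sin_diff flip: sin_of_real cos_of_real)
    finally show ?case using Suc by simp
  qed simp
  finally have *: "Gamma (a - of_nat j) * Gamma (of_nat (Suc j) - a) = of_real pi / ((- 1) ^ j * sin (of_real pi * a))"
    by (simp add: algebra_simps)
  have "of_nat (Suc j) - a \<notin> \<int>"
    using assms Ints_diff[of "of_nat (Suc j)" "of_nat (Suc j) - a"] by auto
  then have g: "Gamma (of_nat (Suc j) - a) \<noteq> 0"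
    using nonpos_Ints_Int by (auto simp: Gamma_eq_zero_iff)
  have "Gamma (a - of_nat j) = of_real pi / ((- 1) ^ j * sin (of_real pi * a)) * rGamma (of_nat (Suc j) - a)"
  proof -
    have "x = k * inverse g" if "x * g = k" "g \<noteq> 0" for x g k :: complex
      using that by (auto simp: field_simps)
    from this[OF * g] show ?thesis unfolding rGamma_inverse_Gamma .
  qed
  also have "of_real pi / ((- 1) ^ j * sin (of_real pi * a)) = (- 1) ^ j * of_real pi / sin (of_real pi * a)"
    by (cases "even j") auto
  finally show ?thesis .
qed

lemma rGamma_minus_of_nat_reflection:
  fixes z :: complex
  assumes "of_nat j - z \<notin> \<int>\<^sub>\<le>\<^sub>0"
  shows "rGamma (z + 1 - of_nat j) = - ((- 1) ^ j * sin (of_real pi * z) / of_real pi) * Gamma (of_nat j - z)"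
proof -
  have "rGamma (of_nat j - z) * rGamma (1 - (of_nat j - z)) = sin (of_real pi * (of_nat j - z)) / of_real pi"
    by (rule rGamma_reflection_complex)
  also have "sin (of_real pi * (of_nat j - z)) = - ((- 1) ^ j * sin (of_real pi * z))"
  proof (induction j)
    case (Suc j)
    have "sin (of_real pi * (of_nat (Suc j) - z)) = sin (of_real pi * (of_nat j - z) + of_real pi)"
      by (simp add: algebra_simps)
    also have "\<dots> = - sin (of_real pi * (of_nat j - z))"
      by (simp add: sin_add flip: sin_of_real cos_of_real)
    finally show ?case using Suc by simp
  qed simp
  finally have *: "rGamma (of_nat j - z) * rGamma (z + 1 - of_nat j) = - ((- 1) ^ j * sin (of_real pi * z)) / of_real pi"
    by (simp add: algebra_simps)
  have nz: "rGamma (of_nat j - z) \<noteq> 0" using assms by (simp add: rGamma_eq_zero_iff)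
  have "w = - (k / p) * inverse x" if "x * w = - k / p" "x \<noteq> 0" for x w k p :: complex
    using that nonzero_eq_divide_eq[of x w "- k / p"] by (simp add: divide_inverse mult_ac)
  from this[OF * nz] show ?thesis unfolding Gamma_def .
qed

text \<open>The derivative of rGamma(z) rGamma(1 - z) = sin(pi z) / pi is computed in two ways and
  divided by this product, which has no zero off the integers.\<close>

lemma Digamma_reflection:
  fixes z :: complex
  assumes "z \<notin> \<int>"
  shows "Digamma (1 - z) - Digamma z = of_real pi * cot (of_real pi * z)"
proof -
  have z: "z \<notin> \<int>\<^sub>\<le>\<^sub>0" "1 - z \<notin> \<int>\<^sub>\<le>\<^sub>0"
    using assms nonpos_Ints_Int Ints_diff[of 1 "1 - z"] by auto
  have "((\<lambda>z. rGamma z * rGamma (1 - z)) has_field_derivative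
      (- rGamma z * Digamma z) * rGamma (1 - z) + (- rGamma (1 - z) * Digamma (1 - z) * (- 1)) * rGamma z) (at z)"
    by (rule derivative_eq_intros refl | use z in \<open>simp add: has_field_derivative_rGamma\<close>)+
  moreover have "((\<lambda>z. rGamma z * rGamma (1 - z)) has_field_derivative cos (of_real pi * z)) (at z)"
    unfolding rGamma_reflection_complex by (auto intro!: derivative_eq_intros)
  ultimately have "(- rGamma z * Digamma z) * rGamma (1 - z) + (- rGamma (1 - z) * Digamma (1 - z) * (- 1)) * rGamma z
      = cos (of_real pi * z)"
    by (rule DERIV_unique)
  then have "rGamma z * rGamma (1 - z) * (Digamma (1 - z) - Digamma z) = cos (of_real pi * z)"
    by (simp add: algebra_simps)
  then show ?thesis
    unfolding rGamma_reflection_complex using sin_pi_nonzero[OF assms]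
    by (simp add: cot_def field_simps)
qed

text \<open>Linear growth is enough for the Liouville argument and follows termwise from the
  defining series; the constant 3 covers pi^2 / 6, as pi < 4.\<close>

lemma norm_Digamma_Suc_le:
  fixes z :: complex
  assumes "0 \<le> Re z"
  shows "norm (Digamma (1 + z) + euler_mascheroni) \<le> 3 * norm z"
proof -
  have eq: "Digamma (1 + z) + euler_mascheroni = (\<Sum>k. inverse (of_nat (Suc k)) - inverse (1 + z + of_nat k))"
    by (simp add: Digamma_def)
  have bd: "norm (inverse (of_nat (Suc k)) - inverse (1 + z + of_nat k)) \<le> norm z * (1 / real (Suc k) ^ 2)" for k
  proof -
    define w where "w = complex_of_nat (Suc k)"
    have "Re (w + z) \<ge> real (Suc k)" using assms by (simp add: w_def)
    then have ge: "real (Suc k) \<le> norm (w + z)" using complex_Re_le_cmod[of "w + z"] by linarith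
    then have "w + z \<noteq> 0" by auto
    moreover have "w \<noteq> 0" unfolding w_def by (simp del: of_nat_Suc)
    ultimately have "inverse w - inverse (w + z) = z / (w * (w + z))" by (simp add: field_simps)
    then have "norm (inverse w - inverse (w + z)) = norm z / (real (Suc k) * norm (w + z))"
      by (simp add: norm_divide norm_mult w_def del: of_nat_Suc)
    also have "\<dots> \<le> norm z / (real (Suc k) * real (Suc k))"
      using ge by (intro divide_left_mono mult_left_mono mult_pos_pos) auto
    finally show ?thesis by (simp add: w_def power2_eq_square add_ac)
  qed
  have s: "(\<lambda>k. norm z * (1 / real (Suc k) ^ 2)) sums (norm z * (pi\<^sup>2 / 6))"
    using sums_mult[OF inverse_squares_sums, of "norm z"] by (simp add: add.commute)
  have "norm (Digamma (1 + z) + euler_mascheroni) \<le> norm z * (pi\<^sup>2 / 6)"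
    unfolding eq using norm_suminf_le[OF bd sums_summable[OF s]] sums_unique[OF s] by simp
  also have "pi\<^sup>2 \<le> 4\<^sup>2" using pi_less_4 pi_ge_zero by (intro power_mono) auto
  then have "norm z * (pi\<^sup>2 / 6) \<le> norm z * 3" by (intro mult_left_mono) auto
  finally show ?thesis by simp
qed

section \<open>The auxiliary summation of Dixon type\<close>

text \<open>The case \<open>p = 2\<close>. The rational factor of \<open>dixon_cert\<close> is a Zeilberger certificate for
  \<open>j^2 * dixon_term a j\<close>: shifting \<open>a\<close> by 1 changes it by a telescoping difference in \<open>j\<close>.\<close>

definition dixon_term :: "complex \<Rightarrow> nat \<Rightarrow> complex" where
  "dixon_term a j = (- 1) ^ j * Gamma (a + of_nat j) ^ 2 * Gamma (a - of_nat j) ^ 2 *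
     rGamma (2 * a + 1 + of_nat j) * rGamma (2 * a + 1 - of_nat j)"

definition dixon_cert :: "complex \<Rightarrow> nat \<Rightarrow> complex" where
  "dixon_cert a j = of_nat j * (of_nat j - 1) *
     ((15 * a ^ 3 + 18 * a ^ 2 + 7 * a + 1) / (2 * a * (2 * a + 1)) -
      (12 * a ^ 2 + 9 * a + 1) / (4 * a * (a + 1) * (2 * a + 1)) * (of_nat j * (of_nat j - 1))) *
     (- 1) ^ j * Gamma (a + of_nat j) ^ 2 * Gamma (a + 1 - of_nat j) ^ 2 *
     rGamma (2 * a + 2 + of_nat j) * rGamma (2 * a + 3 - of_nat j)"

text \<open>This is what remains of \<open>dixon_telescope\<close> once the common Gamma factors are
  removed. \<open>g1\<close> and \<open>g2\<close> are the coefficients of the certificate;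
  multiplied by their common denominator \<open>D\<close> everything is polynomial in
  \<open>a\<close> and \<open>j\<close>.\<close>

lemma dixon_poly:
  fixes a j :: complex
  assumes "a \<noteq> 0" "a + 1 \<noteq> 0" "2 * a + 1 \<noteq> 0"
  defines "g1 \<equiv> (15 * a ^ 3 + 18 * a ^ 2 + 7 * a + 1) / (2 * a * (2 * a + 1))"
    and "g2 \<equiv> (12 * a ^ 2 + 9 * a + 1) / (4 * a * (a + 1) * (2 * a + 1))"
  shows "j ^ 2 * ((a + j) ^ 2 * (a - j) ^ 2) -
     j ^ 2 * ((2 * a + 1 + j) * (2 * a + 2 + j) * (2 * a + 1 - j) * (2 * a + 2 - j)) =
     - ((j + 1) * j * (g1 - g2 * ((j + 1) * j)) * ((a + j) ^ 2 * (2 * a + 2 - j))) -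
     j * (j - 1) * (g1 - g2 * (j * (j - 1))) * ((a - j) ^ 2 * (2 * a + 2 + j))"
proof -
  define D where "D = 4 * a * (a + 1) * (2 * a + 1)"
  have D: "D \<noteq> 0" using assms by (simp add: D_def)
  have g1: "D * g1 = 2 * (a + 1) * (15 * a ^ 3 + 18 * a ^ 2 + 7 * a + 1)"
  proof -
    have "4 * u * v * w * (N / (2 * u * w)) = 2 * v * N" if "u \<noteq> 0" "w \<noteq> 0" for u v w N :: complex
      using that by (simp add: field_simps)
    from this[OF assms(1,3)] show ?thesis unfolding D_def g1_def .
  qed
  have g2: "D * g2 = 12 * a ^ 2 + 9 * a + 1"
  proof -
    have "w * (N / w) = N" if "w \<noteq> 0" for w N :: complex
      using that by simp
    from this[OF D] show ?thesis unfolding D_def g2_def .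
  qed
  let ?L = "j ^ 2 * ((a + j) ^ 2 * (a - j) ^ 2) -
     j ^ 2 * ((2 * a + 1 + j) * (2 * a + 2 + j) * (2 * a + 1 - j) * (2 * a + 2 - j))"
  let ?R = "- ((j + 1) * j * (g1 - g2 * ((j + 1) * j)) * ((a + j) ^ 2 * (2 * a + 2 - j))) -
     j * (j - 1) * (g1 - g2 * (j * (j - 1))) * ((a - j) ^ 2 * (2 * a + 2 + j))"
  have "D * ?R = - ((j + 1) * j * (D * g1 - D * g2 * ((j + 1) * j)) * ((a + j) ^ 2 * (2 * a + 2 - j))) -
     j * (j - 1) * (D * g1 - D * g2 * (j * (j - 1))) * ((a - j) ^ 2 * (2 * a + 2 + j))"
    by (simp add: algebra_simps)
  also have "\<dots> = D * ?L"
    unfolding g1 g2 unfolding D_def by algebra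
  finally show ?thesis using D by (metis mult_left_cancel)
qed

lemma dixon_telescope:
  fixes a :: complex
  assumes a: "a \<notin> \<int>" "2 * a + 1 \<noteq> 0"
  shows "of_nat j ^ 2 * dixon_term (a + 1) j - of_nat j ^ 2 * dixon_term a j =
    dixon_cert a (Suc j) - dixon_cert a j"
proof -
  have na: "a + of_nat j \<notin> \<int>\<^sub>\<le>\<^sub>0" "a - of_nat j \<notin> \<int>\<^sub>\<le>\<^sub>0"
    using Re_minus_of_nat_notin_Ints[OF a(1), of j] nonpos_Ints_Int by auto
  have nz: "a \<noteq> 0" "a + 1 \<noteq> 0"
    using a(1) Ints_0 Ints_1 Ints_minus[of 1] by (auto simp: eq_neg_iff_add_eq_0 [symmetric])
  \<comment> \<open>Every Gamma value in the four terms of the relation is a polynomial multiple of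
    one of these.\<close>
  define X Y U V s where "X = Gamma (a + of_nat j)" and "Y = Gamma (a - of_nat j)"
    and "U = rGamma (2 * a + 3 + of_nat j)" and "V = rGamma (2 * a + 3 - of_nat j)" and "s = (- 1 :: complex) ^ j"
  define J :: complex where "J = of_nat j"
  define g1 where "g1 = (15 * a ^ 3 + 18 * a ^ 2 + 7 * a + 1) / (2 * a * (2 * a + 1))"
  define g2 where "g2 = (12 * a ^ 2 + 9 * a + 1) / (4 * a * (a + 1) * (2 * a + 1))"
  have G1: "Gamma (a + 1 + of_nat j) = (a + J) * X" "Gamma (a + of_nat (Suc j)) = (a + J) * X"
    using Gamma_plus1[OF na(1)] by (simp_all add: X_def J_def add_ac)
  have G2: "Gamma (a + 1 - of_nat j) = (a - J) * Y"
    using Gamma_plus1[OF na(2)] by (simp add: Y_def J_def algebra_simps)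
  have G3: "Gamma (a + 1 - of_nat (Suc j)) = Y" by (simp add: Y_def)
  have R1: "rGamma (2 * a + 2 + of_nat j) = (2 * a + 2 + J) * U"
    using rGamma_plus1[of "2 * a + 2 + of_nat j"] by (simp add: U_def J_def algebra_simps)
  have R2: "rGamma (2 * a + 1 + of_nat j) = (2 * a + 1 + J) * ((2 * a + 2 + J) * U)"
    using rGamma_plus1[of "2 * a + 1 + of_nat j"] R1 by (simp add: J_def algebra_simps)
  have R3: "rGamma (2 * a + 2 - of_nat j) = (2 * a + 2 - J) * V"
    using rGamma_plus1[of "2 * a + 2 - of_nat j"] by (simp add: V_def J_def algebra_simps)
  have R4: "rGamma (2 * a + 1 - of_nat j) = (2 * a + 1 - J) * ((2 * a + 2 - J) * V)"
  proof -
    have e: "2 * a + 1 - of_nat j + 1 = 2 * a + 2 - of_nat j" by simp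
    show ?thesis using rGamma_plus1[of "2 * a + 1 - of_nat j"] unfolding e R3 J_def by (rule sym)
  qed
  have R5: "rGamma (2 * (a + 1) + 1 + of_nat j) = U" "rGamma (2 * (a + 1) + 1 - of_nat j) = V"
    "rGamma (2 * a + 2 + of_nat (Suc j)) = U" "rGamma (2 * a + 3 - of_nat (Suc j)) = (2 * a + 2 - J) * V"
    using R3 by (simp_all add: U_def V_def algebra_simps)
  have 1: "dixon_term (a + 1) j = s * ((a + J) * X) ^ 2 * ((a - J) * Y) ^ 2 * U * V"
    unfolding dixon_term_def G1 G2 R5 s_def ..
  have 2: "dixon_term a j = s * X ^ 2 * Y ^ 2 * ((2 * a + 1 + J) * ((2 * a + 2 + J) * U)) *
      ((2 * a + 1 - J) * ((2 * a + 2 - J) * V))"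
    unfolding dixon_term_def R2 R4 s_def X_def Y_def ..
  have 3: "dixon_cert a (Suc j) = (J + 1) * J * (g1 - g2 * ((J + 1) * J)) * (- s) * ((a + J) * X) ^ 2 * Y ^ 2 * U * ((2 * a + 2 - J) * V)"
    unfolding dixon_cert_def G1 G3 R5 g1_def g2_def s_def J_def by (simp add: add_ac)
  have 4: "dixon_cert a j = J * (J - 1) * (g1 - g2 * (J * (J - 1))) * s * X ^ 2 * ((a - J) * Y) ^ 2 * ((2 * a + 2 + J) * U) * V"
    unfolding dixon_cert_def G2 R1 g1_def g2_def s_def J_def X_def V_def ..
  note poly = dixon_poly[OF nz a(2), of J, folded g1_def g2_def]
  have "J ^ 2 * dixon_term (a + 1) j - J ^ 2 * dixon_term a j =
     s * X ^ 2 * Y ^ 2 * U * V * (J ^ 2 * ((a + J) ^ 2 * (a - J) ^ 2) -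
     J ^ 2 * ((2 * a + 1 + J) * (2 * a + 2 + J) * (2 * a + 1 - J) * (2 * a + 2 - J)))"
    unfolding 1 2 by algebra
  also have "\<dots> = dixon_cert a (Suc j) - dixon_cert a j"
    unfolding poly 3 4 by algebra
  finally show ?thesis by (simp add: J_def)
qed

text \<open>Reflection turns Gamma(a - j)^2 into a multiple of pi^2 / sin(pi a)^2, and the second
  reciprocal Gamma value into one of sin(2 pi a) / pi. The signs (-1)^j cancel, and the
  trigonometric quotient 2 pi cot(pi a) has period 1.\<close>

lemma dixon_term_conv_ph:
  fixes a :: complex
  assumes a: "a \<notin> \<int>" and j: "of_nat j - 2 * a \<notin> \<int>\<^sub>\<le>\<^sub>0"
  shows "dixon_term a j = - (2 * of_real pi * cot (of_real pi * a)) *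
     (ph 2 a j / ((of_nat j + a) ^ 2 * (of_nat j - 2 * a)))"
proof -
  have na: "of_nat j + a \<notin> \<int>\<^sub>\<le>\<^sub>0"
    using Re_minus_of_nat_notin_Ints[OF a, of j] nonpos_Ints_Int by (auto simp: add.commute)
  define X Y U V where "X = Gamma (of_nat j + a)" and "Y = Gamma (of_nat j - 2 * a)"
    and "U = rGamma (of_nat (Suc j) - a)" and "V = rGamma (of_nat (Suc j) + 2 * a)"
  have 1: "Gamma (of_nat (Suc j) + a) = (of_nat j + a) * X"
    using Gamma_plus1[OF na] by (simp add: X_def add_ac)
  have 2: "Gamma (of_nat (Suc j) - 2 * a) = (of_nat j - 2 * a) * Y"
    using Gamma_plus1[OF j] by (simp add: Y_def algebra_simps)
  have nz: "of_nat j + a \<noteq> 0" "of_nat j - 2 * a \<noteq> 0" using na j by auto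
  have p: "ph 2 a j / ((of_nat j + a) ^ 2 * (of_nat j - 2 * a)) = X ^ 2 * Y * U ^ 2 * V"
    unfolding ph_def of_nat_numeral 1 2 U_def [symmetric] V_def [symmetric]
    using nz by (simp add: power_mult_distrib)
  have s: "sin (of_real pi * a) \<noteq> 0" by (rule sin_pi_nonzero[OF a])
  have 3: "Gamma (a - of_nat j) ^ 2 = of_real pi ^ 2 / sin (of_real pi * a) ^ 2 * U ^ 2"
    unfolding Gamma_minus_of_nat_reflection[OF a] U_def
    by (simp add: power_mult_distrib power_divide power_mult [symmetric])
  have 4: "rGamma (2 * a + 1 - of_nat j) = - ((- 1) ^ j * (2 * sin (of_real pi * a) * cos (of_real pi * a)) / of_real pi) * Y"
    unfolding rGamma_minus_of_nat_reflection[OF j] Y_def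
    using sin_double[of "of_real pi * a"] by (simp add: mult.left_commute mult.assoc)
  have 5: "Gamma (a + of_nat j) = X" "rGamma (2 * a + 1 + of_nat j) = V"
    by (simp_all add: X_def V_def add_ac)
  have 6: "(- 1) ^ j * (- 1) ^ j = (1 :: complex)" by (simp flip: power_add power_mult_distrib)
  have "dixon_term a j = - ((- 1) ^ j * (- 1) ^ j) * (2 * of_real pi * (cos (of_real pi * a) / sin (of_real pi * a))) *
     (X ^ 2 * Y * U ^ 2 * V)"
    unfolding dixon_term_def 3 4 5 using s by (simp add: field_simps power2_eq_square)
  then show ?thesis unfolding p 6 cot_def by simp
qed

text \<open>The denominator (J + a)^2 (J - 2 a) has no term in J^2, so its rational contribution
  differs from 2 / J only in order J^(-3); the other contribution is 2 J^2 / d times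
  \<open>ph - 1\<close>, of order h / J.\<close>

lemma dixon_summand_bound:
  fixes a :: complex and h :: real
  assumes j: "0 < j" and l: "real j / 2 \<le> norm (of_nat j + a)" "real j / 2 \<le> norm (of_nat j - 2 * a)"
    and h: "norm (ph 2 a j - 1) \<le> h"
  shows "norm (2 * of_nat j ^ 2 * (ph 2 a j / ((of_nat j + a) ^ 2 * (of_nat j - 2 * a))) - 2 / of_nat j) \<le>
    16 * h / real j + 16 * (3 * norm a ^ 2 + 2 * norm a ^ 3) / real j ^ 2"
proof -
  define x where "x = real j"
  define J :: complex where "J = of_nat j"
  have x: "1 \<le> x" using j by (simp add: x_def)
  have nJ: "norm J = x" by (simp add: J_def x_def)
  define d where "d = (J + a) ^ 2 * (J - 2 * a)"
  have dl: "(x / 2) ^ 2 * (x / 2) \<le> norm d"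
    unfolding d_def norm_mult norm_power using l x
    by (intro mult_mono power_mono) (auto simp: x_def J_def)
  then have dl: "x ^ 3 / 8 \<le> norm d" by (simp add: power2_eq_square power3_eq_cube)
  have x3: "0 < x ^ 3 / 8" using x by simp
  have nz: "d \<noteq> 0" "J \<noteq> 0" using dl x3 x nJ by auto
  have dexp: "d = J ^ 3 - 3 * J * a ^ 2 - 2 * a ^ 3"
    unfolding d_def by (simp add: power2_eq_square power3_eq_cube algebra_simps)
  have "2 * J ^ 2 * (ph 2 a j / d) - 2 / J = 2 * J ^ 2 * (ph 2 a j - 1) / d + 2 * (3 * J * a ^ 2 + 2 * a ^ 3) / (J * d)"
  proof -
    have "2 * J ^ 2 / d - 2 / J = 2 * (J ^ 3 - d) / (J * d)"
      using nz by (simp add: field_simps power2_eq_square power3_eq_cube)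
    also have "J ^ 3 - d = 3 * J * a ^ 2 + 2 * a ^ 3" by (simp add: dexp)
    finally show ?thesis by (simp add: right_diff_distrib diff_divide_distrib algebra_simps)
  qed
  also have "norm \<dots> \<le> norm (2 * J ^ 2 * (ph 2 a j - 1) / d) + norm (2 * (3 * J * a ^ 2 + 2 * a ^ 3) / (J * d))"
    by (rule norm_triangle_ineq)
  also have "\<dots> \<le> 16 * h / x + 16 * (3 * norm a ^ 2 + 2 * norm a ^ 3) / x ^ 2"
  proof (rule add_mono)
    have h0: "0 \<le> h" using h norm_ge_zero order_trans by blast
    have "norm (2 * J ^ 2 * (ph 2 a j - 1) / d) = 2 * x ^ 2 * norm (ph 2 a j - 1) / norm d"
      by (simp add: norm_divide norm_mult norm_power nJ)
    also have "\<dots> \<le> 2 * x ^ 2 * h / (x ^ 3 / 8)"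
      using dl x3 h h0 by (intro frac_le mult_left_mono) auto
    also have "\<dots> = 16 * h / x" using x by (simp add: field_simps power2_eq_square power3_eq_cube)
    finally show "norm (2 * J ^ 2 * (ph 2 a j - 1) / d) \<le> 16 * h / x" .
    have n0: "0 \<le> norm a ^ 2" "0 \<le> norm a ^ 3" by simp_all
    have "norm (3 * J * a ^ 2 + 2 * a ^ 3) \<le> 3 * x * norm a ^ 2 + 2 * norm a ^ 3"
      using norm_triangle_ineq[of "3 * J * a ^ 2" "2 * a ^ 3"] by (simp add: norm_mult norm_power nJ)
    also have "\<dots> \<le> x * (3 * norm a ^ 2 + 2 * norm a ^ 3)"
      using mult_right_mono[OF x, of "2 * norm a ^ 3"] by (simp add: algebra_simps)
    finally have n: "norm (3 * J * a ^ 2 + 2 * a ^ 3) \<le> x * (3 * norm a ^ 2 + 2 * norm a ^ 3)" .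
    have "norm (2 * (3 * J * a ^ 2 + 2 * a ^ 3) / (J * d)) = 2 * norm (3 * J * a ^ 2 + 2 * a ^ 3) / (x * norm d)"
      unfolding norm_divide norm_mult nJ by simp
    also have "\<dots> \<le> 2 * (x * (3 * norm a ^ 2 + 2 * norm a ^ 3)) / (x * (x ^ 3 / 8))"
      using dl x3 n x by (intro frac_le mult_left_mono) auto
    also have "\<dots> = 16 * (3 * norm a ^ 2 + 2 * norm a ^ 3) / x ^ 3" using x by (simp add: field_simps)
    also have "\<dots> \<le> 16 * (3 * norm a ^ 2 + 2 * norm a ^ 3) / x ^ 2"
      using x by (intro divide_left_mono power_increasing mult_pos_pos) auto
    finally show "norm (2 * (3 * J * a ^ 2 + 2 * a ^ 3) / (J * d)) \<le> 16 * (3 * norm a ^ 2 + 2 * norm a ^ 3) / x ^ 2" .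
  qed
  finally show ?thesis by (simp add: d_def J_def x_def)
qed

lemma shift_lower_bounds:
  fixes a :: complex
  assumes a: "norm a \<le> R" and j: "6 * R \<le> real j" "0 < j" and p: "p \<le> 3"
  shows "real j / 2 \<le> norm (of_nat j + of_nat p * a)" "real j / 2 \<le> norm (of_nat j - of_nat p * a)"
    "of_nat j + of_nat p * a \<notin> \<int>\<^sub>\<le>\<^sub>0" "of_nat j - of_nat p * a \<notin> \<int>\<^sub>\<le>\<^sub>0"
proof -
  have pa: "norm (of_nat p * a) \<le> 3 * R"
    unfolding norm_mult using p a by (intro mult_mono) auto
  then have pa: "norm (of_nat p * a) \<le> real j / 2" using j by linarith
  show "real j / 2 \<le> norm (of_nat j + of_nat p * a)"
    using norm_diff_ineq[of "of_nat j" "of_nat p * a"] pa by simp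
  show "real j / 2 \<le> norm (of_nat j - of_nat p * a)"
    using norm_triangle_ineq2[of "of_nat j" "of_nat p * a"] pa by simp
  have "\<bar>Re (of_nat p * a)\<bar> \<le> real j / 2" using pa abs_Re_le_cmod order_trans by blast
  then have "0 < Re (of_nat j + of_nat p * a)" "0 < Re (of_nat j - of_nat p * a)"
    using j(2) by (auto simp: abs_le_iff)
  then show "of_nat j + of_nat p * a \<notin> \<int>\<^sub>\<le>\<^sub>0" "of_nat j - of_nat p * a \<notin> \<int>\<^sub>\<le>\<^sub>0"
    using nonpos_Ints_ImD[of "of_nat j + of_nat p * a"] nonpos_Ints_ImD[of "of_nat j - of_nat p * a"] by linarith+
qed

lemma notin_Ints_strip:
  fixes z :: complex
  assumes "- (1/4) < Re z" "Re z < 1 + 1/4" "z \<noteq> 0" "z \<noteq> 1"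
  shows "z \<notin> \<int>"
proof
  assume "z \<in> \<int>"
  then obtain k where k: "z = of_int k" by (auto elim: Ints_cases)
  then have "- (1/4) < real_of_int k" "real_of_int k < 5/4" using assms(1,2) by simp_all
  then have "- 1 < k" "k < 2" by linarith+
  then have "k = 0 \<or> k = 1" by linarith
  then show False using assms(3,4) k by auto
qed

lemma holomorphic_cot_pi: "(\<And>z. z \<in> A \<Longrightarrow> z \<notin> \<int>) \<Longrightarrow> (\<lambda>z. cot (of_real pi * z)) holomorphic_on A"
  unfolding cot_def by (intro holomorphic_intros) (use sin_pi_nonzero in auto)

lemma locally_bounded_at:
  fixes f :: "complex \<Rightarrow> complex"
  assumes "open A" "f holomorphic_on A" "z \<in> A"
  obtains d B where "0 < d" "d \<le> 1" "0 \<le> B" "\<And>y. y \<in> ball z d \<Longrightarrow> norm (f y) \<le> B"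
proof -
  have "isCont f z"
    using assms by (metis continuous_on_eq_continuous_at holomorphic_on_imp_continuous_on)
  then obtain d where d: "d > 0" "\<And>y. dist y z < d \<Longrightarrow> dist (f y) (f z) < 1"
    unfolding continuous_at_eps_delta by (metis zero_less_one)
  have "norm (f y) \<le> norm (f z) + 1" if "y \<in> ball z (min d 1)" for y
  proof -
    have "norm (f y - f z) < 1" using d(2)[of y] that by (simp add: dist_norm norm_minus_commute)
    then show ?thesis using norm_triangle_ineq[of "f z" "f y - f z"] by simp
  qed
  then show ?thesis using d(1) by (intro that[of "min d 1" "norm (f z) + 1"]) auto
qed

section \<open>The 1-periodic defect of the Dixon-type summation\<close>

text \<open>The summand at j = n + 1 without its factor cot(pi a); subtracting 2 / j makes the
  series absolutely convergent.\<close>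

definition dixon_rest :: "nat \<Rightarrow> complex \<Rightarrow> complex" where
  "dixon_rest n a = 2 * of_nat (Suc n) ^ 2 *
     (ph 2 a (Suc n) / ((of_nat (Suc n) + a) ^ 2 * (of_nat (Suc n) - 2 * a))) - 2 / of_nat (Suc n)"

text \<open>This form in Gamma values is holomorphic on the whole strip, whereas
  \<open>dixon_rest\<close> has poles such as a = 1/2 for n = 0, cancelled by zeros of the
  cotangent. The subtracted term has period 1 and leaves the telescoping in \<open>a\<close>
  intact.\<close>

definition dixon_periodic_term :: "nat \<Rightarrow> complex \<Rightarrow> complex" where
  "dixon_periodic_term n a = - (of_nat (Suc n) ^ 2 / of_real pi) * dixon_term a (Suc n)
     - 2 * cot (of_real pi * a) / of_nat (Suc n)"

lemma dixon_periodic_term_eq: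
  assumes "a \<notin> \<int>" "of_nat (Suc n) - 2 * a \<notin> \<int>\<^sub>\<le>\<^sub>0"
  shows "dixon_periodic_term n a = cot (of_real pi * a) * dixon_rest n a"
proof -
  have alg: "- (J ^ 2 / P) * (- (2 * P * c) * X) - 2 * c / J = c * (2 * J ^ 2 * X - 2 / J)"
    if "P \<noteq> 0" for J P c X :: complex
    using that by (simp add: field_simps)
  show ?thesis
    unfolding dixon_periodic_term_def dixon_rest_def dixon_term_conv_ph[OF assms] by (rule alg) simp
qed

lemma dixon_rest_bound:
  assumes l: "real (Suc n) / 2 \<le> norm (of_nat (Suc n) + a)" "real (Suc n) / 2 \<le> norm (of_nat (Suc n) - 2 * a)"
    and h: "norm (ph 2 a (Suc n) - 1) \<le> h / real (Suc (Suc n)) ^ 2" and h0: "0 \<le> h"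
  shows "norm (dixon_rest n a) \<le> 16 * (h + 3 * norm a ^ 2 + 2 * norm a ^ 3) / real (Suc n) ^ 2"
proof -
  define x where "x = real (Suc n)"
  have x: "1 \<le> x" by (simp add: x_def)
  have "norm (dixon_rest n a) \<le> 16 * (h / (x + 1) ^ 2) / x + 16 * (3 * norm a ^ 2 + 2 * norm a ^ 3) / x ^ 2"
    using dixon_summand_bound[OF _ l h] by (simp add: dixon_rest_def x_def add.commute)
  also have "16 * (h / (x + 1) ^ 2) / x \<le> 16 * h / x ^ 2"
  proof -
    have "x ^ 2 \<le> (x + 1) ^ 2 * x"
      using mult_mono[of "x ^ 2" "(x + 1) ^ 2" 1 x] x power_mono[of x "x + 1" 2] by simp
    then have "16 * h / ((x + 1) ^ 2 * x) \<le> 16 * h / x ^ 2"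
      using h0 x by (intro divide_left_mono mult_pos_pos) auto
    then show ?thesis by simp
  qed
  finally show ?thesis by (simp add: x_def add_divide_distrib distrib_left add.assoc)
qed

lemma dixon_rest_bound_local:
  assumes a: "norm a \<le> R" and n: "6 * R \<le> real (Suc n)"
  shows "norm (dixon_rest n a) \<le> 16 * (512 * exp (512 * R ^ 3) * R ^ 3 + 3 * norm a ^ 2 + 2 * norm a ^ 3) / real (Suc n) ^ 2"
proof -
  have R: "0 \<le> R" using a norm_ge_zero order_trans by blast
  show ?thesis
  proof (rule dixon_rest_bound)
    show "real (Suc n) / 2 \<le> norm (of_nat (Suc n) + a)" "real (Suc n) / 2 \<le> norm (of_nat (Suc n) - 2 * a)"
      using shift_lower_bounds(1)[OF a n, of 1] shift_lower_bounds(2)[OF a n, of 2] by simp_all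
    show "norm (ph 2 a (Suc n) - 1) \<le> 512 * exp (512 * R ^ 3) * R ^ 3 / real (Suc (Suc n)) ^ 2"
      using n by (intro ph_bounds_local(2)[OF a R, of n]) auto
  qed (use R in simp)
qed

text \<open>The difference of the two sides of the summation formula, multiplied by \<open>cot (pi * a)\<close>. It is 1-periodic, so
  boundedness at 0 and polynomial growth in the imaginary direction force it to be constant.\<close>

definition dixon_defect :: "complex \<Rightarrow> complex" where
  "dixon_defect a = (\<Sum>n. dixon_periodic_term n a) +
     cot (of_real pi * a) * (2 * Digamma (1 + a) + Digamma (1 + 2 * a) + 3 * euler_mascheroni - 1 / (2 * a)) +
     of_real pi / 2 * (cot (of_real pi * a) ^ 2 - 1)"

text \<open>The margin 1/4 keeps \<open>1 + 2 * z\<close> away from the Digamma pole at z = - 1/2; 0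
  and 1 are removed because the cotangent and \<open>sine_factor\<close> are singular there.\<close>

definition strip :: "complex set" where
  "strip = {z. - (1/4) < Re z \<and> Re z < 1 + 1/4} - {0, 1}"

lemma open_strip: "open strip"
  unfolding strip_def
  by (intro open_Diff open_Collect_conj open_halfspace_Re_lt open_halfspace_Re_gt finite_imp_closed) auto

lemma strip_notin_Ints: "z \<in> strip \<Longrightarrow> z \<notin> \<int>"
  unfolding strip_def using notin_Ints_strip[of z] by auto

lemma strip_Gamma_args:
  assumes "z \<in> strip"
  shows "z + of_nat (Suc n) \<notin> \<int>\<^sub>\<le>\<^sub>0" "z - of_nat n \<notin> \<int>\<^sub>\<le>\<^sub>0" "1 + 2 * z \<notin> \<int>\<^sub>\<le>\<^sub>0" "1 + z \<notin> \<int>\<^sub>\<le>\<^sub>0"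
  using assms nonpos_Ints_ImD[of "z + of_nat (Suc n)"] nonpos_Ints_ImD[of "1 + 2 * z"] nonpos_Ints_ImD[of "1 + z"]
    Re_minus_of_nat_notin_Ints(1)[OF strip_notin_Ints[OF assms]] nonpos_Ints_Int
  by (auto simp: strip_def)

lemma dixon_periodic_sum:
  shows "(\<lambda>a. \<Sum>n. dixon_periodic_term n a) holomorphic_on strip"
    and "\<And>z. z \<in> strip \<Longrightarrow> summable (\<lambda>n. dixon_periodic_term n z)"
proof -
  have cot: "(\<lambda>z. cot (of_real pi * z)) holomorphic_on strip"
    by (intro holomorphic_cot_pi strip_notin_Ints)
  have hol: "dixon_periodic_term n holomorphic_on strip" for n
    unfolding dixon_periodic_term_def dixon_term_def
    by (intro holomorphic_intros cot) (use strip_Gamma_args strip_Gamma_args(2)[of _ "Suc n"] in auto)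
  have bd: "\<exists>d>0. \<exists>K J. \<forall>n\<ge>J. \<forall>y\<in>ball z d \<inter> strip. norm (dixon_periodic_term n y) \<le> K / real (Suc n) ^ 2"
    if z: "z \<in> strip" for z
  proof -
    from locally_bounded_at[OF open_strip cot z] obtain d B
      where d: "0 < d" "d \<le> 1" and B: "0 \<le> B" "\<And>y. y \<in> ball z d \<Longrightarrow> norm (cot (of_real pi * y)) \<le> B" by blast
    define R where "R = norm z + 1"
    \<comment> \<open>From \<open>J\<close> on, the factorisation through \<open>dixon_rest\<close>
      is free of poles on the whole ball.\<close>
    obtain J where J: "6 * R \<le> real J" using real_arch_simple by blast
    define K where "K = B * (16 * (512 * exp (512 * R ^ 3) * R ^ 3 + 3 * R ^ 2 + 2 * R ^ 3))"
    have "norm (dixon_periodic_term n y) \<le> K / real (Suc n) ^ 2" if n: "J \<le> n" and y: "y \<in> ball z d \<inter> strip" for n y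
    proof -
      have yR: "norm y \<le> R"
        using y d norm_triangle_ineq[of z "y - z"] by (simp add: R_def dist_norm norm_minus_commute)
      have n6: "6 * R \<le> real (Suc n)" using J n by linarith
      have "of_nat (Suc n) - 2 * y \<notin> \<int>\<^sub>\<le>\<^sub>0" using shift_lower_bounds(4)[OF yR n6, of 2] by simp
      then have "norm (dixon_periodic_term n y) = norm (cot (of_real pi * y)) * norm (dixon_rest n y)"
        using dixon_periodic_term_eq strip_notin_Ints y by (simp add: norm_mult)
      also have "\<dots> \<le> B * (16 * (512 * exp (512 * R ^ 3) * R ^ 3 + 3 * norm y ^ 2 + 2 * norm y ^ 3) / real (Suc n) ^ 2)"
        using B y dixon_rest_bound_local[OF yR n6] by (intro mult_mono) auto
      also have "\<dots> \<le> B * (16 * (512 * exp (512 * R ^ 3) * R ^ 3 + 3 * R ^ 2 + 2 * R ^ 3) / real (Suc n) ^ 2)"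
        using yR B(1) norm_ge_zero[of z] by (intro mult_left_mono divide_right_mono add_mono power_mono) (auto simp: R_def)
      finally show ?thesis by (simp add: K_def)
    qed
    then show ?thesis using d(1) by blast
  qed
  show "(\<lambda>a. \<Sum>n. dixon_periodic_term n a) holomorphic_on strip"
    using holomorphic_suminf(1)[OF open_strip hol bd] .
  show "\<And>z. z \<in> strip \<Longrightarrow> summable (\<lambda>n. dixon_periodic_term n z)"
    using holomorphic_suminf(2)[OF open_strip hol bd] .
qed

lemma dixon_defect_holomorphic: "dixon_defect holomorphic_on strip"
proof -
  have cot: "(\<lambda>z. cot (of_real pi * z)) holomorphic_on strip"
    by (intro holomorphic_cot_pi strip_notin_Ints)
  have dg: "(\<lambda>z. Digamma (1 + z)) holomorphic_on strip" "(\<lambda>z. Digamma (1 + 2 * z)) holomorphic_on strip"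
    by (intro holomorphic_on_compose_gen[OF _ holomorphic_on_Polygamma[of "- \<int>\<^sub>\<le>\<^sub>0"], unfolded o_def] holomorphic_intros;
        use strip_Gamma_args in auto)+
  show ?thesis
    unfolding dixon_defect_def
    by (intro holomorphic_intros dixon_periodic_sum(1) cot dg) (auto simp: strip_def)
qed

lemma cot_pi_plus_1: "cot (of_real pi * (a + 1)) = cot (of_real pi * a :: complex)"
proof -
  have "sin (of_real pi * (a + 1)) = - sin (of_real pi * a)" "cos (of_real pi * (a + 1)) = - cos (of_real pi * a)"
    by (simp_all add: distrib_left sin_add cos_add flip: sin_of_real cos_of_real)
  then show ?thesis by (simp add: cot_def)
qed

lemma LIMSEQ_shift_ratio: "(\<lambda>n. (of_nat n + b) / of_nat n :: complex) \<longlonglongrightarrow> 1"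
proof -
  have "(\<lambda>n. 1 + b * inverse (of_nat n)) \<longlonglongrightarrow> 1 + b * 0"
    by (intro tendsto_intros lim_inverse_n)
  moreover have "\<forall>\<^sub>F n in sequentially. 1 + b * inverse (of_nat n) = (of_nat n + b) / of_nat n"
    using eventually_gt_at_top[of 0] by eventually_elim (simp add: field_simps)
  ultimately show ?thesis by (simp add: Lim_transform_eventually)
qed

text \<open>Expressed through \<open>ph\<close>, the certificate becomes \<open>ph\<close> times a
  rational function of j with numerator and denominator of degree 6, so only \<open>g2\<close>
  survives in the limit. This boundary term at infinity is what the Digamma values in
  \<open>dixon_defect\<close> compensate.\<close>

lemma dixon_cert_limit:
  fixes a :: complex
  assumes a: "a \<notin> \<int>"
  shows "dixon_cert a \<longlonglongrightarrow> - (2 * of_real pi * cot (of_real pi * a)) * (- ((12 * a ^ 2 + 9 * a + 1) / (4 * a * (a + 1) * (2 * a + 1))))"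
proof -
  define g1 where "g1 = (15 * a ^ 3 + 18 * a ^ 2 + 7 * a + 1) / (2 * a * (2 * a + 1))"
  define g2 where "g2 = (12 * a ^ 2 + 9 * a + 1) / (4 * a * (a + 1) * (2 * a + 1))"
  define c where "c = - (2 * of_real pi * cot (of_real pi * a))"
  define r where "r = (\<lambda>b n. (of_nat n + b) / of_nat n :: complex)"
  have r: "r b \<longlonglongrightarrow> 1" for b unfolding r_def by (rule LIMSEQ_shift_ratio)
  have inv: "(\<lambda>n. inverse (of_nat n) :: complex) \<longlonglongrightarrow> 0" by (rule lim_inverse_n)
  \<comment> \<open>The certificate with numerator and denominator divided by n^6; each factor
    \<open>r b n\<close> tends to 1.\<close>
  define E where "E = (\<lambda>n. c * ph 2 a n * (r (-1) n * (g1 * inverse (of_nat n) * inverse (of_nat n) - g2 * r (-1) n)) * r (- a) n ^ 2 /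
      (r a n ^ 2 * r (- 2 * a) n * (r (2 * a + 1) n * r (- (2 * a + 1)) n * r (- (2 * a + 2)) n)))"
  have "E \<longlonglongrightarrow> c * 1 * (1 * (g1 * 0 * 0 - g2 * 1)) * 1 ^ 2 / (1 ^ 2 * 1 * (1 * 1 * 1))"
    unfolding E_def by (intro tendsto_intros r inv ph_lim) auto
  moreover have "\<forall>\<^sub>F n in sequentially. E n = dixon_cert a n"
  proof -
    obtain N where N: "6 * (norm a + 1) \<le> real N" using real_arch_simple by blast
    show ?thesis
      using eventually_ge_at_top[of N]
    proof eventually_elim
      case (elim n)
      define J :: complex where "J = of_nat n"
      have n: "6 * (norm a + 1) \<le> real n" using elim N by linarith
      from n have n6: "6 * norm a + 6 \<le> real n" by (simp add: distrib_left)
      then have "6 \<le> real n" by (rule order_trans[rotated]) simp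
      then have n0: "0 < n" by (cases n) auto
      have J0: "J \<noteq> 0" using n0 by (simp add: J_def)
      have ne: "of_nat n - 2 * a \<notin> \<int>\<^sub>\<le>\<^sub>0" using shift_lower_bounds(4)[OF _ n n0, of a 2] by simp
      have big: "J + b \<noteq> 0" if "norm b \<le> 2 * norm a + 2" for b
      proof
        assume "J + b = 0"
        then have "J = - b" by (simp add: eq_neg_iff_add_eq_0)
        then have "norm J = norm b" by simp
        then have "real n \<le> 2 * norm a + 2" using that by (simp add: J_def)
        then have "6 * norm a + 6 \<le> 2 * norm a + 2" using n6 by (rule order_trans[rotated])
        then show False using norm_ge_zero[of a] by simp
      qed
      have nb: "norm (2 * a + 1) \<le> 2 * norm a + 2" "norm (2 * a + 2) \<le> 2 * norm a + 2"
        using norm_triangle_ineq[of "2 * a" 1] norm_triangle_ineq[of "2 * a" 2] by (simp_all add: norm_mult)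
      have nz: "J + a \<noteq> 0" "J - 2 * a \<noteq> 0" "J + (2 * a + 1) \<noteq> 0" "J - (2 * a + 1) \<noteq> 0" "J - (2 * a + 2) \<noteq> 0"
      proof -
        have b2: "J - b \<noteq> 0" if "norm b \<le> 2 * norm a + 2" for b using big[of "- b"] that by simp
        show "J + a \<noteq> 0" by (rule big) simp
        show "J - 2 * a \<noteq> 0" by (rule b2) (simp add: norm_mult)
        show "J + (2 * a + 1) \<noteq> 0" by (rule big[OF nb(1)])
        show "J - (2 * a + 1) \<noteq> 0" by (rule b2[OF nb(1)])
        show "J - (2 * a + 2) \<noteq> 0" by (rule b2[OF nb(2)])
      qed
      have na: "a - of_nat n \<notin> \<int>\<^sub>\<le>\<^sub>0" using Re_minus_of_nat_notin_Ints(1)[OF a] nonpos_Ints_Int by blast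
      have G: "Gamma (a + 1 - of_nat n) = (a - J) * Gamma (a - of_nat n)"
        using Gamma_plus1[OF na] by (simp add: J_def algebra_simps)
      have R1: "rGamma (2 * a + 2 + of_nat n) = rGamma (2 * a + 1 + of_nat n) / (2 * a + 1 + J)"
        using rGamma_plus1[of "2 * a + 1 + of_nat n"] nz(3) by (simp add: J_def field_simps)
      have R2: "rGamma (2 * a + 2 - of_nat n) = rGamma (2 * a + 1 - of_nat n) / (2 * a + 1 - J)"
        using rGamma_plus1[of "2 * a + 1 - of_nat n"] nz(4) by (simp add: J_def field_simps)
      have R3: "rGamma (2 * a + 3 - of_nat n) = rGamma (2 * a + 1 - of_nat n) / ((2 * a + 1 - J) * (2 * a + 2 - J))"
      proof -
        have e: "2 * a + 2 - of_nat n + 1 = 2 * a + 3 - of_nat n" by simp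
        have "y = x / (v * w)" if "w * y = x / v" "w \<noteq> 0" for x y v w :: complex
          using nonzero_eq_divide_eq[of w y "x / v"] that by (simp add: mult.commute)
        from this[OF rGamma_plus1[of "2 * a + 2 - of_nat n", unfolded e R2]] show ?thesis
          using nz(5) by (simp add: J_def)
      qed
      have "dixon_cert a n = J * (J - 1) * (g1 - g2 * (J * (J - 1))) * (a - J) ^ 2 /
          ((2 * a + 1 + J) * ((2 * a + 1 - J) * (2 * a + 2 - J))) * dixon_term a n"
        unfolding dixon_cert_def dixon_term_def G R1 R3 g1_def [symmetric] g2_def [symmetric]
        unfolding J_def [symmetric]
        by (simp add: power_mult_distrib)
      also have "dixon_term a n = c * (ph 2 a n / ((J + a) ^ 2 * (J - 2 * a)))"
        using dixon_term_conv_ph[OF a ne] by (simp add: c_def J_def)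
      finally have 1: "dixon_cert a n = J * (J - 1) * (g1 - g2 * (J * (J - 1))) * (a - J) ^ 2 /
          ((2 * a + 1 + J) * ((2 * a + 1 - J) * (2 * a + 2 - J))) * (c * (ph 2 a n / ((J + a) ^ 2 * (J - 2 * a))))" .
      have alg: "J * (J - 1) * (g1 - g2 * (J * (J - 1))) * (a - J) ^ 2 / (u * (v * w)) * (c * (q / (s ^ 2 * t))) =
          c * q * ((J - 1) / J * (g1 * inverse J * inverse J - g2 * ((J - 1) / J))) * ((J - a) / J) ^ 2 /
          ((s / J) ^ 2 * (t / J) * (u / J * ((- v) / J) * ((- w) / J)))"
        if "u \<noteq> 0" "v \<noteq> 0" "w \<noteq> 0" "s \<noteq> 0" "t \<noteq> 0" for u v w s t q :: complex
      proof -
        have e: "(J - 1) / J * (g1 * inverse J * inverse J - g2 * ((J - 1) / J)) = J * (J - 1) * (g1 - g2 * (J * (J - 1))) / J ^ 4"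
          using J0 by (simp add: field_simps power_numeral_reduce)
        have e2: "(a - J) ^ 2 = (J - a) ^ 2" by (rule power2_commute)
        show ?thesis unfolding e e2 using that J0 by (simp add: field_simps power_numeral_reduce)
      qed
      have "u1 = u2 \<Longrightarrow> E n = u2" if "E n = u1" for u1 u2 using that by simp
      show ?case
        unfolding 1 E_def r_def J_def [symmetric]
        by (subst alg) (use nz in \<open>auto simp: algebra_simps\<close>)
    qed
  qed
  ultimately have "dixon_cert a \<longlonglongrightarrow> c * 1 * (1 * (g1 * 0 * 0 - g2 * 1)) * 1 ^ 2 / (1 ^ 2 * 1 * (1 * 1 * 1))"
    by (rule Lim_transform_eventually)
  then show ?thesis by (simp add: c_def g2_def)
qed

lemma dixon_defect_periodic:
  assumes z: "- (1/4) < Re a" "Re a < 1/4" "a \<noteq> 0"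
  shows "dixon_defect (a + 1) = dixon_defect a"
proof -
  have "Re (- 1) = - 1" "Re 1 = 1" by simp_all
  have as: "a \<in> strip" "a + 1 \<in> strip"
    using z by (auto simp: strip_def complex_eq_iff)
  have a: "a \<notin> \<int>" by (rule strip_notin_Ints[OF as(1)])
  have nz: "a \<noteq> 0" "a + 1 \<noteq> 0" "2 * a + 1 \<noteq> 0"
  proof -
    have "Re (a + 1) \<noteq> 0" "Re (2 * a + 1) \<noteq> 0" using z by auto
    then show "a \<noteq> 0" "a + 1 \<noteq> 0" "2 * a + 1 \<noteq> 0" using z by (auto simp del: plus_complex.sel)
  qed
  define C where "C = cot (of_real pi * a)"
  define g2 where "g2 = (12 * a ^ 2 + 9 * a + 1) / (4 * a * (a + 1) * (2 * a + 1))"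
  have "(\<lambda>n. dixon_cert a (Suc n)) \<longlonglongrightarrow> - (2 * of_real pi * C) * - g2"
    using LIMSEQ_Suc[OF dixon_cert_limit[OF a]] by (simp add: C_def g2_def)
  from telescope_sums[OF this]
  have "(\<lambda>n. dixon_cert a (Suc (Suc n)) - dixon_cert a (Suc n)) sums (- (2 * of_real pi * C) * - g2 - dixon_cert a 1)"
    by simp
  \<comment> \<open>The factor j (j - 1) of the certificate removes the lower boundary term of the
    sum from j = 1.\<close>
  moreover have "dixon_cert a 1 = 0" by (simp add: dixon_cert_def)
  ultimately have "(\<lambda>n. dixon_cert a (Suc (Suc n)) - dixon_cert a (Suc n)) sums (2 * of_real pi * C * g2)" by simp
  from sums_mult[OF this, of "- (1 / of_real pi)"]
  have "(\<lambda>n. - (1 / of_real pi) * (dixon_cert a (Suc (Suc n)) - dixon_cert a (Suc n))) sums (- 2 * C * g2)"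
    by (simp add: mult.assoc)
  moreover have "- (1 / of_real pi) * (dixon_cert a (Suc (Suc n)) - dixon_cert a (Suc n)) =
      dixon_periodic_term n (a + 1) - dixon_periodic_term n a" for n
    unfolding dixon_telescope[OF a nz(3), symmetric] dixon_periodic_term_def cot_pi_plus_1
    by (simp add: field_simps del: of_nat_Suc)
  ultimately have "(\<lambda>n. dixon_periodic_term n (a + 1) - dixon_periodic_term n a) sums (- 2 * C * g2)" by simp
  then have s: "(\<Sum>n. dixon_periodic_term n (a + 1)) = (\<Sum>n. dixon_periodic_term n a) - 2 * C * g2"
    using suminf_diff[OF dixon_periodic_sum(2)[OF as(2)] dixon_periodic_sum(2)[OF as(1)]] by (simp add: sums_iff algebra_simps)
  have d1: "Digamma (1 + (a + 1)) = Digamma (1 + a) + 1 / (a + 1)"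
    using Digamma_plus1[of "1 + a"] nz by (simp add: add_ac)
  have "2 + 2 * a = 2 * (a + 1)" by simp
  then have nz2: "2 + 2 * a \<noteq> 0" using nz(2) by (metis mult_eq_0_iff zero_neq_numeral)
  have d2: "Digamma (1 + 2 * (a + 1)) = Digamma (1 + 2 * a) + 1 / (2 * a + 1) + 1 / (2 * (a + 1))"
    using Digamma_plus1[of "1 + 2 * a"] Digamma_plus1[OF nz2] nz by (simp add: algebra_simps)
  \<comment> \<open>The partial fractions of \<open>2 * g2\<close> dictate the Digamma values in
    \<open>dixon_defect\<close>, where \<open>Digamma (1 + 2 * a) - 1 / (2 * a)\<close> is Digamma
    at 2 a.\<close>
  have alg: "2 * (1 / (a + 1)) + (1 / (2 * a + 1) + 1 / (2 * (a + 1))) - 1 / (2 * (a + 1)) + 1 / (2 * a) = 2 * g2"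
  proof -
    have "4 * a * (a + 1) * (2 * a + 1) * (2 * (1 / (a + 1)) + 1 / (2 * a + 1) + 1 / (2 * a)) =
        8 * a * (2 * a + 1) + 4 * a * (a + 1) + 2 * (a + 1) * (2 * a + 1)"
    proof -
      have "4 * u * v * w * (2 * (1 / v) + 1 / w + 1 / (2 * u)) = 8 * u * w + 4 * u * v + 2 * v * w"
        if "u \<noteq> 0" "v \<noteq> 0" "w \<noteq> 0" for u v w :: complex
        using that by (simp add: field_simps)
      from this[OF nz] show ?thesis .
    qed
    also have "\<dots> = 2 * (12 * a ^ 2 + 9 * a + 1)" by (simp add: algebra_simps power2_eq_square)
    finally have "2 * (1 / (a + 1)) + 1 / (2 * a + 1) + 1 / (2 * a) = 2 * g2"
    proof -
      assume *: "4 * a * (a + 1) * (2 * a + 1) * (2 * (1 / (a + 1)) + 1 / (2 * a + 1) + 1 / (2 * a)) =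
          2 * (12 * a ^ 2 + 9 * a + 1)"
      have "L = 2 * (N / D)" if "D * L = 2 * N" "D \<noteq> 0" for L N D :: complex
        using that by (simp add: field_simps)
      from this[OF *] show ?thesis unfolding g2_def using nz by simp
    qed
    then show ?thesis by simp
  qed
  have "dixon_defect (a + 1) - dixon_defect a = - 2 * C * g2 +
      C * (2 * (1 / (a + 1)) + (1 / (2 * a + 1) + 1 / (2 * (a + 1))) - 1 / (2 * (a + 1)) + 1 / (2 * a))"
    unfolding dixon_defect_def s cot_pi_plus_1 d1 d2 C_def by (simp add: algebra_simps)
  then show ?thesis unfolding alg by simp
qed

text \<open>Quadratic order in \<open>a\<close> is what matters: it beats the simple pole of the
  cotangent at 0. The exponent 3 covers 512 / 6^3.\<close>

lemma dixon_rest_small: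
  assumes a: "6 * norm a \<le> 1"
  shows "norm (dixon_rest n a) \<le> 16 * (512 * exp 3 + 5) * norm a ^ 2 / real (Suc n) ^ 2"
proof -
  define x where "x = norm a"
  have x: "0 \<le> x" "x \<le> 1 / 6" using a by (simp_all add: x_def)
  have x32: "x ^ 3 \<le> x ^ 2" using x by (intro power_decreasing) auto
  have "x ^ 3 \<le> (1 / 6) ^ 3" using x by (intro power_mono) auto
  then have "512 * x ^ 3 \<le> 3" by (simp add: power3_eq_cube)
  then have "exp (512 * x ^ 3) \<le> exp 3" by simp
  then have "512 * exp (512 * x ^ 3) * x ^ 3 \<le> 512 * exp 3 * x ^ 2"
    using x32 x by (intro mult_mono) auto
  then have le: "512 * exp (512 * x ^ 3) * x ^ 3 + 3 * x ^ 2 + 2 * x ^ 3 \<le> (512 * exp 3 + 5) * x ^ 2"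
    using x32 by (simp add: algebra_simps)
  have "norm (dixon_rest n a) \<le> 16 * (512 * exp (512 * x ^ 3) * x ^ 3 + 3 * x ^ 2 + 2 * x ^ 3) / real (Suc n) ^ 2"
    unfolding x_def by (rule dixon_rest_bound_local) (use a in auto)
  also have "\<dots> \<le> 16 * ((512 * exp 3 + 5) * x ^ 2) / real (Suc n) ^ 2"
    using le by (intro divide_right_mono mult_left_mono) auto
  finally show ?thesis by (simp only: x_def mult.assoc)
qed

text \<open>The cotangent factors out of the whole defect: by reflection, Digamma at 2 a is Digamma
  at 1 - 2 a minus pi cot(2 pi a), and cot(pi a) cot(2 pi a) = (cot(pi a)^2 - 1) / 2 is absorbed by
  the last summand. This explains the trigonometric term of \<open>dixon_defect\<close>.\<close>

lemma dixon_defect_near_0: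
  assumes a: "6 * norm a \<le> 1" "a \<noteq> 0"
  shows "cot (of_real pi * a) \<noteq> 0"
    and "dixon_defect a = cot (of_real pi * a) *
      ((\<Sum>n. dixon_rest n a) + 2 * Digamma (1 + a) + Digamma (1 - 2 * a) + 3 * euler_mascheroni)"
proof -
  have re: "\<bar>Re a\<bar> \<le> 1 / 6" using a abs_Re_le_cmod[of a] by linarith
  have as: "a \<in> strip" using a re by (auto simp: strip_def abs_le_iff)
  have nI: "a \<notin> \<int>" by (rule strip_notin_Ints[OF as])
  have "\<bar>Re (2 * a)\<bar> < 1" using re by simp
  have nI2: "2 * a \<notin> \<int>"
  proof
    assume "2 * a \<in> \<int>"
    then obtain k where k: "2 * a = of_int k" by (auto elim: Ints_cases)
    then have "\<bar>real_of_int k\<bar> < 1" using \<open>\<bar>Re (2 * a)\<bar> < 1\<close> by simp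
    then have "k = 0" by linarith
    then show False using k a by simp
  qed
  have s: "sin (of_real pi * a) \<noteq> 0" by (rule sin_pi_nonzero[OF nI])
  have "sin (2 * (of_real pi * a)) \<noteq> 0"
    using sin_pi_nonzero[OF nI2] by (simp add: mult.left_commute)
  then have c: "cos (of_real pi * a) \<noteq> 0" by (auto simp: sin_double)
  show "cot (of_real pi * a) \<noteq> 0" using s c by (simp add: cot_def)
  define C where "C = cot (of_real pi * a)"
  have "Digamma (1 - 2 * a) = Digamma (2 * a) + of_real pi * cot (of_real pi * (2 * a))"
    using Digamma_reflection[OF nI2] by (simp add: algebra_simps)
  moreover have "Digamma (1 + 2 * a) = Digamma (2 * a) + 1 / (2 * a)"
    using Digamma_plus1[of "2 * a"] a by (simp add: add.commute)
  moreover have "C * cot (of_real pi * (2 * a)) = (C ^ 2 - 1) / 2"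
  proof -
    have "cot (of_real pi * (2 * a)) = cos (2 * (of_real pi * a)) / sin (2 * (of_real pi * a))"
      by (simp add: cot_def mult.left_commute)
    then show ?thesis using s c unfolding C_def cot_def sin_double cos_double
      by (simp add: field_simps power2_eq_square)
  qed
  ultimately have dig: "C * (2 * Digamma (1 + a) + Digamma (1 - 2 * a) + 3 * euler_mascheroni) =
      C * (2 * Digamma (1 + a) + Digamma (1 + 2 * a) + 3 * euler_mascheroni - 1 / (2 * a)) +
      of_real pi / 2 * (C ^ 2 - 1)"
  proof -
    assume *: "Digamma (1 - 2 * a) = Digamma (2 * a) + of_real pi * cot (of_real pi * (2 * a))"
      "Digamma (1 + 2 * a) = Digamma (2 * a) + 1 / (2 * a)"
      "C * cot (of_real pi * (2 * a)) = (C ^ 2 - 1) / 2"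
    have "C * (X + (D + P * c) + G) = C * (X + (D + q) + G - q) + P / 2 * (C ^ 2 - 1)"
      if "C * c = (C ^ 2 - 1) / 2" for X D P c G q :: complex
    proof -
      have "C * (X + (D + P * c) + G) = C * (X + (D + q) + G - q) + P * (C * c)"
        by (simp add: algebra_simps)
      then show ?thesis unfolding that by simp
    qed
    from this[OF *(3)] show ?thesis unfolding *(1,2) .
  qed
  have "of_nat (Suc n) - 2 * a \<notin> \<int>\<^sub>\<le>\<^sub>0" for n
    using shift_lower_bounds(4)[of a "1/6" "Suc n" 2] a by simp
  then have t: "dixon_periodic_term n a = C * dixon_rest n a" for n
    using dixon_periodic_term_eq[OF nI] by (simp add: C_def)
  have "summable (\<lambda>n. dixon_rest n a)"
    by (rule summable_comparison_test'[OF summable_inverse_Suc_square dixon_rest_small[OF a(1)]])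
  then have "(\<Sum>n. dixon_periodic_term n a) = C * (\<Sum>n. dixon_rest n a)"
    unfolding t by (rule suminf_mult)
  then show "dixon_defect a = cot (of_real pi * a) *
      ((\<Sum>n. dixon_rest n a) + 2 * Digamma (1 + a) + Digamma (1 - 2 * a) + 3 * euler_mascheroni)"
    using dig unfolding dixon_defect_def C_def [symmetric] by (simp add: algebra_simps)
qed

lemma cot_pi_times_tendsto: "(\<lambda>a. cot (of_real pi * a) * a :: complex) \<midarrow>0\<rightarrow> 1 / of_real pi"
proof -
  have "((\<lambda>a. sin (of_real pi * a)) has_field_derivative cos (of_real pi * 0) * of_real pi) (at (0 :: complex))"
    by (auto intro!: derivative_eq_intros)
  then have "(\<lambda>a. sin (of_real pi * a) / a :: complex) \<midarrow>0\<rightarrow> of_real pi"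
    by (simp add: DERIV_def)
  then have "(\<lambda>a. cos (of_real pi * a) / (sin (of_real pi * a) / a) :: complex) \<midarrow>0\<rightarrow> cos (of_real pi * 0) / of_real pi"
    by (intro tendsto_intros) auto
  then show ?thesis by (simp add: cot_def)
qed

lemma dixon_defect_tendsto_0: "dixon_defect \<midarrow>0\<rightarrow> 0"
proof -
  \<comment> \<open>\<open>H\<close> vanishes to second order at 0: the value is - 3 gamma + 3 gamma
    and the derivative is 2 Digamma'(1) - 2 Digamma'(1). The simple pole of the cotangent is thus
    more than compensated.\<close>
  define H where "H = (\<lambda>a. 2 * Digamma (1 + a) + Digamma (1 - 2 * a) + 3 * euler_mascheroni :: complex)"
  have "(H has_field_derivative 2 * Polygamma 1 1 + Polygamma 1 1 * (- 2)) (at 0)"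
    unfolding H_def by (auto intro!: derivative_eq_intros)
  then have "(\<lambda>a. H a / a) \<midarrow>0\<rightarrow> 0"
    unfolding DERIV_def by (simp add: H_def)
  moreover have "(\<lambda>a. (\<Sum>n. dixon_rest n a) / a) \<midarrow>0\<rightarrow> 0"
  proof (rule Lim_null_comparison)
    define K where "K = 16 * (512 * exp 3 + 5) * (\<Sum>n. 1 / real (Suc n) ^ 2)"
    have "\<forall>\<^sub>F a in at (0 :: complex). a \<in> ball 0 (1 / 6) - {0}"
      by (rule eventually_at_in_open) auto
    then show "\<forall>\<^sub>F a in at (0 :: complex). norm ((\<Sum>n. dixon_rest n a) / a) \<le> K * norm a"
    proof eventually_elim
      case (elim a)
      then have a: "6 * norm a \<le> 1" "a \<noteq> 0" by auto
      have "norm (\<Sum>n. dixon_rest n a) \<le> (\<Sum>n. 16 * (512 * exp 3 + 5) * norm a ^ 2 * (1 / real (Suc n) ^ 2))"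
        by (rule norm_suminf_le) (use dixon_rest_small[OF a(1)] summable_inverse_Suc_square in simp_all)
      also have "\<dots> = K * norm a ^ 2"
        unfolding K_def using suminf_mult[OF summable_inverse_Suc_square[of 1], of "16 * (512 * exp 3 + 5) * norm a ^ 2"]
        by (simp add: mult_ac)
      finally show ?case using a(2) by (simp add: norm_divide divide_le_eq power2_eq_square)
    qed
    show "(\<lambda>a :: complex. K * norm a) \<midarrow>0\<rightarrow> 0" by (auto intro!: tendsto_eq_intros)
  qed
  ultimately have "(\<lambda>a. cot (of_real pi * a) * a * ((\<Sum>n. dixon_rest n a) / a + H a / a)) \<midarrow>0\<rightarrow> 1 / of_real pi * (0 + 0)"
    by (intro tendsto_intros cot_pi_times_tendsto)
  moreover have "\<forall>\<^sub>F a in at (0 :: complex). cot (of_real pi * a) * a * ((\<Sum>n. dixon_rest n a) / a + H a / a) = dixon_defect a"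
  proof -
    have "\<forall>\<^sub>F a in at (0 :: complex). a \<in> ball 0 (1 / 6) - {0}"
      by (rule eventually_at_in_open) auto
    then show ?thesis
    proof eventually_elim
      case (elim a)
      then have a: "6 * norm a \<le> 1" "a \<noteq> 0" by auto
      show ?case unfolding dixon_defect_near_0(2)[OF a] H_def using a(2) by (simp add: field_simps)
    qed
  qed
  ultimately show ?thesis by (simp add: Lim_transform_eventually)
qed

lemma norm_le_2_Im:
  assumes "0 \<le> Re a" "Re a \<le> 1" "1 \<le> \<bar>Im a\<bar>"
  shows "norm a \<le> 2 * \<bar>Im a\<bar>" "1 \<le> norm a"
  using assms cmod_le[of a] abs_Im_le_cmod[of a] by linarith+

lemma strip_lower_bounds:
  assumes a: "0 \<le> Re a" "Re a \<le> 1" "1 \<le> \<bar>Im a\<bar>"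
  shows "real j / 2 \<le> norm (of_nat j + a)"
    and "2 \<le> p \<Longrightarrow> real j / 2 \<le> norm (of_nat j - of_nat p * a)"
proof -
  have "real j \<le> Re (of_nat j + a)" using a by simp
  also have "\<dots> \<le> norm (of_nat j + a)" by (rule complex_Re_le_cmod)
  finally show "real j / 2 \<le> norm (of_nat j + a)" by simp
  assume p: "2 \<le> p"
  show "real j / 2 \<le> norm (of_nat j - of_nat p * a)"
  proof (cases "real j \<le> 2 * real p")
    case True
    have "real p * 1 \<le> real p * \<bar>Im a\<bar>" using a by (intro mult_left_mono) auto
    then have "real p \<le> \<bar>Im (of_nat j - of_nat p * a)\<bar>" by (simp add: abs_mult)
    also have "\<dots> \<le> norm (of_nat j - of_nat p * a)" by (rule abs_Im_le_cmod)
    finally show ?thesis using True by simp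
  next
    case False
    have "real p * Re a \<le> real p * 1" using a by (intro mult_left_mono) auto
    then have "real j / 2 \<le> Re (of_nat j - of_nat p * a)" using False by simp
    also have "\<dots> \<le> norm (of_nat j - of_nat p * a)" by (rule complex_Re_le_cmod)
    finally show ?thesis .
  qed
qed

text \<open>The cubic growth comes from the bounds on the summands of the series; the cotangent is
  at most 2 in modulus and the Digamma values grow at most linearly.\<close>

lemma dixon_defect_growth:
  obtains K where "\<And>a. 0 \<le> Re a \<Longrightarrow> Re a \<le> 1 \<Longrightarrow> 1 \<le> \<bar>Im a\<bar> \<Longrightarrow> norm (dixon_defect a) \<le> K * \<bar>Im a\<bar> ^ 3"
proof -
  define h where "h = 64 * exp (192 :: real)"
  define s where "s = (\<Sum>n. 1 / real (Suc n) ^ 2)"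
  have s0: "0 \<le> s" unfolding s_def by (intro suminf_nonneg summable_inverse_Suc_square) auto
  have h0: "0 \<le> h" by (simp add: h_def)
  define K0 where "K0 = 32 * (h + 5) * s + 40"
  have K0: "0 \<le> K0" using h0 s0 by (simp add: K0_def)
  have "norm (dixon_defect a) \<le> (K0 * 8) * \<bar>Im a\<bar> ^ 3" if a: "0 \<le> Re a" "Re a \<le> 1" "1 \<le> \<bar>Im a\<bar>" for a
  proof -
    define x where "x = norm a"
    have x: "1 \<le> x" "x \<le> 2 * \<bar>Im a\<bar>" using norm_le_2_Im[OF a] by (simp_all add: x_def)
    have x23: "x ^ 2 \<le> x ^ 3" "x \<le> x ^ 3" "1 \<le> x ^ 3"
      using x power_increasing[of 2 3 x] power_increasing[of 1 3 x] one_le_power[of x 3] by auto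
    have nI: "a \<notin> \<int>" using a by (auto elim!: Ints_cases)
    define C where "C = cot (of_real pi * a)"
    have C: "norm C \<le> 2" unfolding C_def by (rule norm_cot_pi_le[OF a(3)])
    have r: "norm (dixon_rest n a) \<le> 16 * (h + 5) * x ^ 3 * (1 / real (Suc n) ^ 2)" for n
    proof -
      have "norm (dixon_rest n a) \<le> 16 * (h * x ^ 3 + 3 * norm a ^ 2 + 2 * norm a ^ 3) / real (Suc n) ^ 2"
      proof (rule dixon_rest_bound)
        show "real (Suc n) / 2 \<le> norm (of_nat (Suc n) + a)" "real (Suc n) / 2 \<le> norm (of_nat (Suc n) - 2 * a)"
          using strip_lower_bounds(1)[OF a, of "Suc n"] strip_lower_bounds(2)[OF a, of 2 "Suc n"] by simp_all
        show "norm (ph 2 a (Suc n) - 1) \<le> h * x ^ 3 / real (Suc (Suc n)) ^ 2"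
          using ph_bounds_strip(2)[OF a, of 2 "Suc n"] by (simp add: h_def x_def)
      qed (use h0 x in simp)
      also have "\<dots> \<le> 16 * ((h + 5) * x ^ 3) / real (Suc n) ^ 2"
        using x23 by (intro divide_right_mono mult_left_mono) (auto simp: x_def algebra_simps)
      finally show ?thesis by (simp only: mult.assoc times_divide_eq_right mult_1_right)
    qed
    have "of_nat (Suc n) - 2 * a \<notin> \<int>\<^sub>\<le>\<^sub>0" for n
      using nonpos_Ints_ImD[of "of_nat (Suc n) - 2 * a"] a by auto
    then have t: "dixon_periodic_term n a = C * dixon_rest n a" for n
      using dixon_periodic_term_eq[OF nI] by (simp add: C_def)
    have sm: "summable (\<lambda>n. 16 * (h + 5) * x ^ 3 * (1 / real (Suc n) ^ 2))"
      by (intro summable_mult summable_inverse_Suc_square)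
    have "norm (\<Sum>n. dixon_rest n a) \<le> (\<Sum>n. 16 * (h + 5) * x ^ 3 * (1 / real (Suc n) ^ 2))"
      by (rule norm_suminf_le[OF r sm])
    also have "\<dots> = 16 * (h + 5) * x ^ 3 * s"
      unfolding s_def by (rule suminf_mult[OF summable_inverse_Suc_square])
    finally have sb: "norm (\<Sum>n. dixon_rest n a) \<le> 16 * (h + 5) * x ^ 3 * s" .
    have "summable (\<lambda>n. dixon_rest n a)"
      by (rule summable_comparison_test'[OF sm r])
    then have "(\<Sum>n. dixon_periodic_term n a) = C * (\<Sum>n. dixon_rest n a)"
      unfolding t by (rule suminf_mult)
    then have "norm (\<Sum>n. dixon_periodic_term n a) \<le> 2 * (16 * (h + 5) * x ^ 3 * s)"
      using C sb unfolding norm_mult by (auto simp: norm_mult intro!: mult_mono)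
    moreover have "norm (C * (2 * Digamma (1 + a) + Digamma (1 + 2 * a) + 3 * euler_mascheroni - 1 / (2 * a))) \<le> 2 * (13 * x)"
    proof -
      have d1: "norm (Digamma (1 + a) + euler_mascheroni) \<le> 3 * x"
        unfolding x_def by (rule norm_Digamma_Suc_le[OF a(1)])
      have d2: "norm (Digamma (1 + 2 * a) + euler_mascheroni) \<le> 6 * x"
        using norm_Digamma_Suc_le[of "2 * a"] a(1) by (simp add: x_def norm_mult)
      have d3: "norm (1 / (2 * a)) \<le> x"
      proof -
        have "1 / (2 * x) \<le> 1" using x by simp
        then show ?thesis using x by (simp add: norm_divide norm_mult x_def)
      qed
      have "norm (2 * Digamma (1 + a) + Digamma (1 + 2 * a) + 3 * euler_mascheroni - 1 / (2 * a)) =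
        norm (2 * (Digamma (1 + a) + euler_mascheroni) + (Digamma (1 + 2 * a) + euler_mascheroni) - 1 / (2 * a))"
        by (simp add: algebra_simps)
      also have "\<dots> \<le> norm (2 * (Digamma (1 + a) + euler_mascheroni)) + norm (Digamma (1 + 2 * a) + euler_mascheroni) + norm (1 / (2 * a))"
        using norm_triangle_ineq4 norm_triangle_ineq order_trans add_right_mono by blast
      also have "\<dots> \<le> 13 * x" using d1 d2 d3 unfolding norm_mult by simp
      finally show ?thesis unfolding norm_mult using C by (intro mult_mono) auto
    qed
    moreover have "norm (of_real pi / 2 * (C ^ 2 - 1)) \<le> 10"
    proof -
      have "norm (C ^ 2 - 1) \<le> norm C ^ 2 + 1" using norm_triangle_ineq4[of "C\<^sup>2" 1] by (simp add: norm_power)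
      also have "\<dots> \<le> 2 ^ 2 + 1" using C by (intro add_right_mono power_mono) auto
      finally have "norm (C ^ 2 - 1) \<le> 5" by simp
      moreover have "norm (of_real pi / 2 :: complex) \<le> 2" using pi_less_4 by (simp add: norm_divide)
      ultimately have "norm (of_real pi / 2 :: complex) * norm (C ^ 2 - 1) \<le> 2 * 5" by (intro mult_mono) auto
      then show ?thesis by (simp add: norm_mult)
    qed
    ultimately have "norm (dixon_defect a) \<le> 2 * (16 * (h + 5) * x ^ 3 * s) + 2 * (13 * x) + 10"
      unfolding dixon_defect_def C_def [symmetric] by (intro norm_triangle_le add_mono) auto
    also have "\<dots> \<le> K0 * x ^ 3"
      using x23 by (simp add: K0_def algebra_simps)
    also have "\<dots> \<le> K0 * (2 * \<bar>Im a\<bar>) ^ 3"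
      using x K0 by (intro mult_left_mono power_mono) auto
    finally show ?thesis by (simp add: power_mult_distrib mult.assoc)
  qed
  then show ?thesis by (rule that)
qed

text \<open>The defect equals its limit 0 by \<open>strip_periodic_const\<close>, and cot(pi a) has
  no zero for 0 < |a| <= 1/6, so the other factor vanishes. Expanding this identity at 0 yields the
  sums that do not telescope.\<close>

theorem dixon_log_sum:
  assumes a: "6 * norm a \<le> 1" "a \<noteq> 0"
  shows "(\<Sum>n. dixon_rest n a) = - (2 * Digamma (1 + a) + Digamma (1 - 2 * a) + 3 * euler_mascheroni)"
proof -
  obtain K where K: "\<And>a. 0 \<le> Re a \<Longrightarrow> Re a \<le> 1 \<Longrightarrow> 1 \<le> \<bar>Im a\<bar> \<Longrightarrow> norm (dixon_defect a) \<le> K * \<bar>Im a\<bar> ^ 3"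
    by (rule dixon_defect_growth) blast
  have "\<bar>Re a\<bar> \<le> 1 / 6" using a abs_Re_le_cmod[of a] by linarith
  then have "dixon_defect a = 0"
    by (intro strip_periodic_const[of "1/4" dixon_defect 0 K 3])
       (use a K dixon_defect_holomorphic dixon_defect_periodic dixon_defect_tendsto_0 in \<open>auto simp: strip_def abs_le_iff\<close>)
  then have "(\<Sum>n. dixon_rest n a) + (2 * Digamma (1 + a) + Digamma (1 - 2 * a) + 3 * euler_mascheroni) = 0"
    unfolding dixon_defect_near_0(2)[OF a] using dixon_defect_near_0(1)[OF a] by (simp add: add.assoc)
  then show ?thesis by (simp only: eq_neg_iff_add_eq_0)
qed

section \<open>The Wilf-Zeilberger pair\<close>

text \<open>Off the integers this is pi^2 sin(3 pi a) / sin(pi a)^3; the form chosen shows the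
  period 1 and the double poles.\<close>

definition sine_factor :: "complex \<Rightarrow> complex" where
  "sine_factor a = of_real pi ^ 2 * (3 / sin (of_real pi * a) ^ 2 - 4)"

lemma sin_triple: "sin (3 * x) = 3 * sin x - 4 * sin x ^ 3" for x :: complex
proof -
  have "sin (3 * x) = sin (2 * x + x)" by (simp add: algebra_simps)
  also have "\<dots> = 2 * sin x * (cos x)\<^sup>2 + ((cos x)\<^sup>2 - (sin x)\<^sup>2) * sin x"
    unfolding sin_add sin_double cos_double by (simp add: power2_eq_square)
  also have "\<dots> = 3 * sin x - 4 * sin x ^ 3"
    unfolding cos_squared_eq by (simp add: algebra_simps power2_eq_square power3_eq_cube)
  finally show ?thesis .
qed

lemma cos_triple: "cos (3 * x) = 4 * cos x ^ 3 - 3 * cos x" for x :: complex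
proof -
  have "cos (3 * x) = cos (2 * x + x)" by (simp add: algebra_simps)
  also have "\<dots> = ((cos x)\<^sup>2 - (sin x)\<^sup>2) * cos x - 2 * (sin x)\<^sup>2 * cos x"
    unfolding cos_add sin_double cos_double by (simp add: power2_eq_square)
  also have "\<dots> = 4 * cos x ^ 3 - 3 * cos x"
    unfolding sin_squared_eq by (simp add: algebra_simps power2_eq_square power3_eq_cube)
  finally show ?thesis .
qed

lemma sine_factor_conv:
  assumes "a \<notin> \<int>"
  shows "sine_factor a = of_real pi ^ 2 * sin (of_real pi * (3 * a)) / sin (of_real pi * a) ^ 3"
proof -
  define s where "s = sin (of_real pi * a)"
  have s: "s \<noteq> 0" using sin_pi_nonzero[OF assms] by (simp add: s_def)
  have e: "sin (of_real pi * (3 * a)) = 3 * s - 4 * s ^ 3"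
    using sin_triple[of "of_real pi * a"] by (simp add: s_def mult.left_commute)
  show ?thesis unfolding sine_factor_def e s_def [symmetric] using s
    by (simp add: field_simps power2_eq_square power3_eq_cube)
qed

text \<open>A Wilf-Zeilberger pair whose boundary column \<open>j = 0\<close> is \<open>f10c (a + 1)\<close>; the polynomial \<open>wz_poly\<close>
  comes from its rational certificate.\<close>

definition wz_row :: "complex \<Rightarrow> nat \<Rightarrow> complex" where
  "wz_row a j = - of_nat (2 * j + 1) * Gamma (a + 1 + of_nat j) ^ 3 * Gamma (a - of_nat j) ^ 3 *
     rGamma (3 * a + 2 + of_nat j) * rGamma (3 * a + 1 - of_nat j)"

definition wz_poly :: "complex \<Rightarrow> complex \<Rightarrow> complex" where
  "wz_poly x j = (173 + 1020 * x + 2386 * x ^ 2 + 2768 * x ^ 3 + 1593 * x ^ 4 + 364 * x ^ 5)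
     - (86 + 288 * x + 322 * x ^ 2 + 120 * x ^ 3) * j ^ 2 + (9 + 12 * x) * j ^ 4"

definition wz_column :: "complex \<Rightarrow> nat \<Rightarrow> complex" where
  "wz_column a j = wz_poly a (of_nat j) / ((a + 1) * (2 * a + 1)) *
     Gamma (a + 1 + of_nat j) ^ 3 * Gamma (a + 1 - of_nat j) ^ 3 *
     rGamma (3 * a + 4 + of_nat j) * rGamma (3 * a + 4 - of_nat j)"

lemma wz_poly_identity:
  fixes x j :: complex
  shows "wz_poly x (j + 1) * ((x + 1 + j) ^ 3 * (3 * x + 3 - j)) - wz_poly x j * ((x - j) ^ 3 * (3 * x + 4 + j)) =
     (x + 1) * (2 * x + 1) * (2 * (- (2 * j + 1) * ((x + 1 + j) ^ 3 * (x - j) ^ 3) +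
       (2 * j + 1) * ((3 * x + 2 + j) * (3 * x + 3 + j) * (3 * x + 4 + j) *
         ((3 * x + 1 - j) * (3 * x + 2 - j) * (3 * x + 3 - j)))))"
  unfolding wz_poly_def by algebra

text \<open>All Gamma values reduce to \<open>X\<close>, \<open>Y\<close>, \<open>U\<close>,
  \<open>V\<close>, which leaves \<open>wz_poly_identity\<close>. Summed over j, the left side is
  the increment of a row sum under the shift of \<open>a\<close>, and the right side consists of
  boundary values at j = 0 and at infinity.\<close>

lemma wz_telescope:
  fixes a :: complex
  assumes a: "a \<notin> \<int>" "a + 1 \<noteq> 0" "2 * a + 1 \<noteq> 0"
  shows "2 * (wz_row (a + 1) j - wz_row a j) = wz_column a (Suc j) - wz_column a j"
proof -
  define J :: complex where "J = of_nat j"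
  have na: "a + of_nat j + 1 \<notin> \<int>\<^sub>\<le>\<^sub>0" "a - of_nat j \<notin> \<int>\<^sub>\<le>\<^sub>0"
    using Re_minus_of_nat_notin_Ints(1)[OF a(1), of j] Re_minus_of_nat_notin_Ints(2)[OF a(1), of "Suc j"] nonpos_Ints_Int
    by (auto simp: add_ac)
  define X Y U V where "X = Gamma (a + 1 + of_nat j)" and "Y = Gamma (a - of_nat j)"
    and "U = rGamma (3 * a + 5 + of_nat j)" and "V = rGamma (3 * a + 4 - of_nat j)"
  have G1: "Gamma (a + 1 + 1 + of_nat j) = (a + 1 + J) * X" "Gamma (a + 1 + of_nat (Suc j)) = (a + 1 + J) * X"
    using Gamma_plus1[OF na(1)] by (simp_all add: X_def J_def add_ac)
  have G2: "Gamma (a + 1 - of_nat j) = (a - J) * Y"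
    using Gamma_plus1[OF na(2)] by (simp add: Y_def J_def algebra_simps)
  have G3: "Gamma (a + 1 - of_nat (Suc j)) = Y" by (simp add: Y_def)
  have rg: "rGamma z = z * rGamma w" if "w = z + 1" for z w :: complex
    using rGamma_plus1[of z] that by simp
  have R1: "rGamma (3 * a + 4 + of_nat j) = (3 * a + 4 + J) * U"
    unfolding U_def J_def by (rule rg) simp
  have R2: "rGamma (3 * a + 2 + of_nat j) = (3 * a + 2 + J) * ((3 * a + 3 + J) * ((3 * a + 4 + J) * U))"
    unfolding R1 [symmetric] unfolding J_def by (subst rg[OF refl], subst rg[OF refl]) (simp add: add_ac)
  have R3: "rGamma (3 * a + 3 - of_nat j) = (3 * a + 3 - J) * V"
    unfolding V_def J_def by (rule rg) simp
  have R4: "rGamma (3 * a + 2 - of_nat j) = (3 * a + 2 - J) * ((3 * a + 3 - J) * V)"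
    unfolding R3 [symmetric] unfolding J_def by (rule rg) simp
  have R5: "rGamma (3 * a + 1 - of_nat j) = (3 * a + 1 - J) * ((3 * a + 2 - J) * ((3 * a + 3 - J) * V))"
    unfolding R4 [symmetric] unfolding J_def by (rule rg) simp
  have R6: "rGamma (3 * (a + 1) + 2 + of_nat j) = U" "rGamma (3 * (a + 1) + 1 - of_nat j) = V"
    "rGamma (3 * a + 4 + of_nat (Suc j)) = U" "rGamma (3 * a + 4 - of_nat (Suc j)) = (3 * a + 3 - J) * V"
    using R3 by (simp_all add: U_def V_def algebra_simps)
  have 1: "wz_row (a + 1) j = - (2 * J + 1) * ((a + 1 + J) * X) ^ 3 * ((a - J) * Y) ^ 3 * U * V"
    unfolding wz_row_def G1 G2 R6 by (simp add: J_def)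
  have 2: "wz_row a j = - (2 * J + 1) * X ^ 3 * Y ^ 3 * ((3 * a + 2 + J) * ((3 * a + 3 + J) * ((3 * a + 4 + J) * U))) *
      ((3 * a + 1 - J) * ((3 * a + 2 - J) * ((3 * a + 3 - J) * V)))"
    unfolding wz_row_def R2 R5 X_def [symmetric] Y_def [symmetric] by (simp add: J_def)
  define d where "d = (a + 1) * (2 * a + 1)"
  have d: "d \<noteq> 0" using a by (simp add: d_def)
  have 3: "wz_column a (Suc j) = wz_poly a (J + 1) / d * ((a + 1 + J) * X) ^ 3 * Y ^ 3 * U * ((3 * a + 3 - J) * V)"
    unfolding wz_column_def G1 G3 R6 d_def J_def by (simp add: add_ac)
  have 4: "wz_column a j = wz_poly a J / d * X ^ 3 * ((a - J) * Y) ^ 3 * ((3 * a + 4 + J) * U) * V"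
    unfolding wz_column_def G2 R1 d_def J_def X_def V_def ..
  have "d * (wz_column a (Suc j) - wz_column a j) = X ^ 3 * Y ^ 3 * U * V *
      (wz_poly a (J + 1) * ((a + 1 + J) ^ 3 * (3 * a + 3 - J)) - wz_poly a J * ((a - J) ^ 3 * (3 * a + 4 + J)))"
  proof -
    define k1 k2 where "k1 = wz_poly a (J + 1) / d" and "k2 = wz_poly a J / d"
    have e: "wz_poly a (J + 1) = d * k1" "wz_poly a J = d * k2"
      using d by (simp_all add: k1_def k2_def)
    show ?thesis unfolding 3 4 unfolding k1_def [symmetric] k2_def [symmetric] unfolding e by algebra
  qed
  also have "\<dots> = d * (2 * (wz_row (a + 1) j - wz_row a j))"
    unfolding wz_poly_identity 1 2 d_def by algebra
  finally show ?thesis using d by simp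
qed

text \<open>As in the case p = 2, reflection splits off a 1-periodic trigonometric factor, here
  built from sin(3 pi a) / sin(pi a)^3; the sign (-1)^j occurs twice and cancels.\<close>

lemma wz_row_conv_ph:
  fixes a :: complex
  assumes a: "a \<notin> \<int>" and j: "of_nat j - 3 * a \<notin> \<int>\<^sub>\<le>\<^sub>0" and nz: "of_nat (Suc j) + 3 * a \<noteq> 0"
  shows "wz_row a j = sine_factor a * (ph 3 a j * of_nat (2 * j + 1) / ((of_nat j - 3 * a) * (of_nat (Suc j) + 3 * a)))"
proof -
  define X Y U V where "X = Gamma (of_nat (Suc j) + a)" and "Y = Gamma (of_nat j - 3 * a)"
    and "U = rGamma (of_nat (Suc j) - a)" and "V = rGamma (of_nat (Suc j) + 3 * a)"
  have nz1: "of_nat j - 3 * a \<noteq> 0" using j by auto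
  have 2: "Gamma (of_nat (Suc j) - 3 * a) = (of_nat j - 3 * a) * Y"
    using Gamma_plus1[OF j] by (simp add: Y_def algebra_simps)
  have p: "ph 3 a j = X ^ 3 * ((of_nat j - 3 * a) * Y) * U ^ 3 * V"
    unfolding ph_def of_nat_numeral 2 U_def V_def X_def ..
  have s: "sin (of_real pi * a) \<noteq> 0" by (rule sin_pi_nonzero[OF a])
  have m1: "((- 1) ^ j) ^ 3 = (- 1 :: complex) ^ j" by (cases "even j") auto
  have 3: "Gamma (a - of_nat j) ^ 3 = (- 1) ^ j * of_real pi ^ 3 / sin (of_real pi * a) ^ 3 * U ^ 3"
    unfolding Gamma_minus_of_nat_reflection[OF a] U_def
    by (simp add: power_mult_distrib power_divide m1)
  have 4: "rGamma (3 * a + 1 - of_nat j) = - ((- 1) ^ j * sin (of_real pi * (3 * a)) / of_real pi) * Y"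
    unfolding rGamma_minus_of_nat_reflection[OF j] Y_def ..
  have 5: "Gamma (a + 1 + of_nat j) = X" by (simp add: X_def add_ac)
  have 6: "rGamma (3 * a + 2 + of_nat j) = V / (of_nat (Suc j) + 3 * a)"
  proof -
    have "w * y = v \<Longrightarrow> w \<noteq> 0 \<Longrightarrow> y = v / w" for w y v :: complex by (simp add: field_simps)
    from this[OF rGamma_plus1[of "of_nat (Suc j) + 3 * a"] nz] show ?thesis by (simp add: V_def add_ac)
  qed
  have 7: "(- 1) ^ j * (- 1) ^ j = (1 :: complex)" by (simp flip: power_add power_mult_distrib)
  have alg: "- k * x ^ 3 * (m * pp ^ 3 / ss * u ^ 3) * (v / w) * (- (m * s3 / pp) * y) =
      pp ^ 2 * s3 / ss * (x ^ 3 * (t * y) * u ^ 3 * v * k / (t * w))"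
    if "m * m = 1" "pp \<noteq> 0" "ss \<noteq> 0" "t \<noteq> 0" "w \<noteq> 0" for k x m pp ss u v w s3 y t :: complex
  proof -
    have "- k * x ^ 3 * (m * pp ^ 3 / ss * u ^ 3) * (v / w) * (- (m * s3 / pp) * y) =
      (m * m) * (k * x ^ 3 * (pp ^ 3 / ss * u ^ 3) * (v / w) * (s3 / pp * y))" by simp
    also have "\<dots> = pp ^ 2 * s3 / ss * (x ^ 3 * (t * y) * u ^ 3 * v * k / (t * w))"
      unfolding that(1) using that(2-) by (simp add: field_simps power2_eq_square power3_eq_cube)
    finally show ?thesis .
  qed
  show ?thesis
    unfolding wz_row_def sine_factor_conv[OF a] p 3 4 5 6
    by (rule alg[OF 7]) (use s nz nz1 in auto)
qed

definition wz_rest :: "nat \<Rightarrow> complex \<Rightarrow> complex" where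
  "wz_rest n a = ph 3 a n * of_nat (2 * n + 1) / ((of_nat n - 3 * a) * (of_nat (Suc n) + 3 * a)) - 2 / of_nat (Suc n)"

text \<open>The counterpart of \<open>dixon_periodic_term\<close>: holomorphic on the strip, while
  \<open>wz_rest\<close> has poles such as a = 1/3 for n = 1, which zeros of
  \<open>sine_factor\<close> cancel.\<close>

definition wz_periodic_term :: "nat \<Rightarrow> complex \<Rightarrow> complex" where
  "wz_periodic_term n a = wz_row a n - 2 * sine_factor a / of_nat (Suc n)"

lemma wz_periodic_term_eq:
  assumes "a \<notin> \<int>" "of_nat n - 3 * a \<notin> \<int>\<^sub>\<le>\<^sub>0" "of_nat (Suc n) + 3 * a \<noteq> 0"
  shows "wz_periodic_term n a = sine_factor a * wz_rest n a"
  unfolding wz_periodic_term_def wz_rest_def wz_row_conv_ph[OF assms] by (simp add: right_diff_distrib)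

lemma wz_rest_bound:
  assumes l: "real (Suc n) / 4 \<le> norm (of_nat n - 3 * a)" "real (Suc n) / 2 \<le> norm (of_nat (Suc n) + 3 * a)"
    and h: "norm (ph 3 a n - 1) \<le> h / real (Suc n) ^ 2" and h0: "0 \<le> h"
  shows "norm (wz_rest n a) \<le> (16 * h + 8 * (1 + 6 * norm a + 18 * norm a ^ 2)) / real (Suc n) ^ 2"
proof -
  define x where "x = real (Suc n)"
  have x: "1 \<le> x" by (simp add: x_def)
  define N :: complex where "N = of_nat (Suc n)"
  have nN: "norm N = x" unfolding N_def x_def by (simp only: norm_of_nat)
  define d where "d = (of_nat n - 3 * a) * (N + 3 * a)"
  have "x / 4 * (x / 2) \<le> norm d"
    unfolding d_def norm_mult using l x by (intro mult_mono) (auto simp: x_def N_def)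
  then have dl: "x ^ 2 / 8 \<le> norm d" by (simp add: power2_eq_square)
  have x2: "0 < x ^ 2 / 8" using x by simp
  have nz: "d \<noteq> 0" "N \<noteq> 0" using dl x2 nN x by auto
  have n: "of_nat n = N - 1" by (simp add: N_def)
  have n2: "of_nat (2 * n + 1) = 2 * N - 1" by (simp add: N_def)
  have "wz_rest n a = (ph 3 a n - 1) * (2 * N - 1) / d + ((2 * N - 1) / d - 2 / N)"
  proof -
    have "u * v / w - 2 / N = (u - 1) * v / w + (v / w - 2 / N)" for u v w :: complex
      by (simp add: left_diff_distrib diff_divide_distrib)
    then show ?thesis unfolding wz_rest_def n2 N_def [symmetric] unfolding d_def [symmetric] .
  qed
  \<comment> \<open>The terms in N^2 cancel in the numerator, so the difference is of order
    N^(-2).\<close>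
  also have "(2 * N - 1) / d - 2 / N = ((2 * N - 1) * N - 2 * d) / (d * N)"
    using nz by (simp add: field_simps)
  also have "(2 * N - 1) * N - 2 * d = N + 6 * a + 18 * a ^ 2"
    unfolding d_def n by (simp add: algebra_simps power2_eq_square)
  finally have eq: "wz_rest n a = (ph 3 a n - 1) * (2 * N - 1) / d + (N + 6 * a + 18 * a ^ 2) / (d * N)" .
  have b1: "norm ((ph 3 a n - 1) * (2 * N - 1) / d) \<le> 16 * h / x ^ 2"
  proof -
    have "norm (2 * N - 1) = 2 * x - 1"
      unfolding n2 [symmetric] norm_of_nat by (simp add: x_def)
    then have m: "norm (2 * N - 1) \<le> 2 * x" using x by simp
    have "norm ((ph 3 a n - 1) * (2 * N - 1) / d) = norm (ph 3 a n - 1) * norm (2 * N - 1) / norm d"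
      by (simp add: norm_mult norm_divide)
    also have "\<dots> \<le> (h / x ^ 2) * (2 * x) / (x ^ 2 / 8)"
      using h m dl x2 h0 x by (intro frac_le mult_mono) (auto simp: x_def)
    also have "\<dots> = 16 * h / x ^ 3" using x by (simp add: field_simps power2_eq_square power3_eq_cube)
    also have "\<dots> \<le> 16 * h / x ^ 2" using x h0 by (intro divide_left_mono power_increasing mult_pos_pos) auto
    finally show ?thesis .
  qed
  have b2: "norm ((N + 6 * a + 18 * a ^ 2) / (d * N)) \<le> 8 * (1 + 6 * norm a + 18 * norm a ^ 2) / x ^ 2"
  proof -
    have "norm (N + 6 * a + 18 * a ^ 2) \<le> x + 6 * norm a + 18 * norm a ^ 2"
      using norm_triangle_ineq[of "N + 6 * a" "18 * a ^ 2"] norm_triangle_ineq[of N "6 * a"]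
      by (simp add: norm_mult norm_power nN)
    also have "\<dots> \<le> x * (1 + 6 * norm a + 18 * norm a ^ 2)"
      using mult_right_mono[OF x, of "6 * norm a + 18 * norm a ^ 2"] by (simp add: algebra_simps)
    finally have m: "norm (N + 6 * a + 18 * a ^ 2) \<le> x * (1 + 6 * norm a + 18 * norm a ^ 2)" .
    have "norm ((N + 6 * a + 18 * a ^ 2) / (d * N)) = norm (N + 6 * a + 18 * a ^ 2) / (norm d * x)"
      unfolding norm_divide norm_mult nN ..
    also have "\<dots> \<le> x * (1 + 6 * norm a + 18 * norm a ^ 2) / ((x ^ 2 / 8) * x)"
      using m dl x2 x by (intro frac_le mult_mono) auto
    also have "\<dots> = 8 * (1 + 6 * norm a + 18 * norm a ^ 2) / x ^ 2"
      using x by (simp add: field_simps)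
    finally show ?thesis .
  qed
  have "norm (wz_rest n a) \<le> 16 * h / x ^ 2 + 8 * (1 + 6 * norm a + 18 * norm a ^ 2) / x ^ 2"
    unfolding eq using norm_triangle_le[OF add_mono[OF b1 b2]] .
  then show ?thesis by (simp add: x_def add_divide_distrib)
qed

lemma wz_rest_bound_local:
  assumes a: "norm a \<le> R" and n: "6 * R \<le> real n" "0 < n"
  shows "norm (wz_rest n a) \<le> (16 * (512 * exp (512 * R ^ 3) * R ^ 3) + 8 * (1 + 6 * norm a + 18 * norm a ^ 2)) / real (Suc n) ^ 2"
proof -
  have R: "0 \<le> R" using a norm_ge_zero order_trans by blast
  show ?thesis
  proof (rule wz_rest_bound)
    \<comment> \<open>A quarter instead of a half, because the factor is n - 3 a rather than n + 1 -
      3 a, and n / 2 >= (n + 1) / 4 for n >= 1.\<close>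
    have "real (Suc n) / 4 \<le> real n / 2" using n(2) by simp
    also have "\<dots> \<le> norm (of_nat n - 3 * a)" using shift_lower_bounds(2)[OF a n, of 3] by simp
    finally show "real (Suc n) / 4 \<le> norm (of_nat n - 3 * a)" .
    show "real (Suc n) / 2 \<le> norm (of_nat (Suc n) + 3 * a)"
      using shift_lower_bounds(1)[OF a, of "Suc n" 3] n by simp
    show "norm (ph 3 a n - 1) \<le> 512 * exp (512 * R ^ 3) * R ^ 3 / real (Suc n) ^ 2"
      using n by (intro ph_bounds_local(2)[OF a R, of n]) auto
  qed (use R in simp)
qed

lemma sine_factor_holomorphic: "sine_factor holomorphic_on strip"
  unfolding sine_factor_def
  by (intro holomorphic_intros) (use sin_pi_nonzero strip_notin_Ints in auto)

lemma wz_periodic_sum: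
  shows "(\<lambda>a. \<Sum>n. wz_periodic_term n a) holomorphic_on strip"
    and "\<And>z. z \<in> strip \<Longrightarrow> summable (\<lambda>n. wz_periodic_term n z)"
proof -
  have G: "z + 1 + of_nat n \<notin> \<int>\<^sub>\<le>\<^sub>0" "z - of_nat n \<notin> \<int>\<^sub>\<le>\<^sub>0" if "z \<in> strip" for z n
    using strip_Gamma_args(1,2)[OF that, of n] by (auto simp: add_ac)
  have hol: "wz_periodic_term n holomorphic_on strip" for n
    unfolding wz_periodic_term_def wz_row_def
    by (intro holomorphic_intros sine_factor_holomorphic G) auto
  have bd: "\<exists>d>0. \<exists>K J. \<forall>n\<ge>J. \<forall>y\<in>ball z d \<inter> strip. norm (wz_periodic_term n y) \<le> K / real (Suc n) ^ 2"
    if z: "z \<in> strip" for z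
  proof -
    from locally_bounded_at[OF open_strip sine_factor_holomorphic z] obtain d B
      where d: "0 < d" "d \<le> 1" and B: "0 \<le> B" "\<And>y. y \<in> ball z d \<Longrightarrow> norm (sine_factor y) \<le> B" by blast
    define R where "R = norm z + 1"
    obtain J where J: "6 * R \<le> real J" using real_arch_simple by blast
    define K where "K = B * (16 * (512 * exp (512 * R ^ 3) * R ^ 3) + 8 * (1 + 6 * R + 18 * R ^ 2))"
    have "norm (wz_periodic_term n y) \<le> K / real (Suc n) ^ 2" if n: "Suc J \<le> n" and y: "y \<in> ball z d \<inter> strip" for n y
    proof -
      have yR: "norm y \<le> R"
        using y d norm_triangle_ineq[of z "y - z"] by (simp add: R_def dist_norm norm_minus_commute)
      have n6: "6 * R \<le> real n" "6 * R \<le> real (Suc n)" "0 < n" "0 < Suc n" using J n by linarith+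
      have a1: "of_nat n - 3 * y \<notin> \<int>\<^sub>\<le>\<^sub>0" using shift_lower_bounds(4)[OF yR n6(1,3), of 3] by simp
      have a2: "of_nat (Suc n) + 3 * y \<noteq> 0" using shift_lower_bounds(3)[OF yR n6(2,4), of 3] by auto
      have "norm (wz_periodic_term n y) = norm (sine_factor y) * norm (wz_rest n y)"
        using wz_periodic_term_eq[OF _ a1 a2] strip_notin_Ints y by (simp add: norm_mult)
      also have "\<dots> \<le> B * ((16 * (512 * exp (512 * R ^ 3) * R ^ 3) + 8 * (1 + 6 * norm y + 18 * norm y ^ 2)) / real (Suc n) ^ 2)"
        using B y wz_rest_bound_local[OF yR n6(1,3)] by (intro mult_mono) auto
      also have "\<dots> \<le> B * ((16 * (512 * exp (512 * R ^ 3) * R ^ 3) + 8 * (1 + 6 * R + 18 * R ^ 2)) / real (Suc n) ^ 2)"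
        using yR B(1) norm_ge_zero[of z] by (intro mult_left_mono divide_right_mono add_mono power_mono) (auto simp: R_def)
      finally show ?thesis by (simp add: K_def)
    qed
    then show ?thesis using d(1) by blast
  qed
  show "(\<lambda>a. \<Sum>n. wz_periodic_term n a) holomorphic_on strip"
    using holomorphic_suminf(1)[OF open_strip hol bd] .
  show "\<And>z. z \<in> strip \<Longrightarrow> summable (\<lambda>n. wz_periodic_term n z)"
    using holomorphic_suminf(2)[OF open_strip hol bd] .
qed

section \<open>The shifted series as a holomorphic function\<close>

text \<open>\<open>f10c z\<close> is this times a rational function of z, see
  \<open>f10c_bound\<close>. The arguments 1 + z and 1 + 3 z avoid the pole of Gamma at 0 and permit
  the comparison with \<open>ph 3 a 0\<close>.\<close>

definition gamma_ratio :: "complex \<Rightarrow> complex" where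
  "gamma_ratio z = Gamma (1 + z) ^ 6 * rGamma (1 + 3 * z) ^ 2"

definition f10c :: "complex \<Rightarrow> complex" where
  "f10c z = (364 * z ^ 2 - 227 * z + 36) * (Gamma z ^ 6 * rGamma (3 * z) ^ 2) / (9 * (2 * z - 1))"

definition f10_sum :: "complex \<Rightarrow> complex" where
  "f10_sum a = (\<Sum>n. f10c (a + of_nat (Suc n)))"

text \<open>The quotient of consecutive values is (a + 1)^4 / (3 (3 a + 1) (3 a + 2))^2, and |3 a +
  1| >= |a + 1| and |3 a + 2| >= 2 |a + 1| hold for Re a >= 0. This gives convergence and transfers
  a bound at \<open>a\<close> to the whole series.\<close>

lemma gamma_ratio_step:
  assumes "0 \<le> Re a"
  shows "norm (gamma_ratio (a + 1)) \<le> norm (gamma_ratio a) / 36"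
proof -
  have n1: "1 + a \<notin> \<int>\<^sub>\<le>\<^sub>0" using nonpos_Ints_ImD[of "1 + a"] assms by auto
  have nz: "3 * a + 1 \<noteq> 0" "3 * a + 2 \<noteq> 0" "a + 1 \<noteq> 0"
  proof -
    have "0 < Re (3 * a + 1)" "0 < Re (3 * a + 2)" "0 < Re (a + 1)" using assms by simp_all
    then show "3 * a + 1 \<noteq> 0" "3 * a + 2 \<noteq> 0" "a + 1 \<noteq> 0" by (metis less_irrefl zero_complex.sel(1))+
  qed
  have G: "Gamma (1 + (a + 1)) = (a + 1) * Gamma (1 + a)" using Gamma_plus1[OF n1] by (simp add: add_ac)
  have rg: "z * rGamma w = rGamma z" if "w = z + 1" for z w :: complex
    using rGamma_plus1[of z] that by simp
  have "(3 * a + 1) * ((3 * a + 2) * ((3 * a + 3) * rGamma (1 + 3 * (a + 1)))) = rGamma (1 + 3 * a)"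
    by (subst rg[of _ "3 * a + 3"], simp, subst rg[of _ "3 * a + 2"], simp, subst rg[of _ "3 * a + 1"], simp_all add: add_ac)
  then have R: "(3 * a + 1) * (3 * a + 2) * 3 * (a + 1) * rGamma (1 + 3 * (a + 1)) = rGamma (1 + 3 * a)"
    by (simp add: algebra_simps)
  define w where "w = rGamma (1 + 3 * (a + 1))"
  define q where "q = 3 * (3 * a + 1) * (3 * a + 2)"
  have R': "rGamma (1 + 3 * a) = q * (a + 1) * w" unfolding R [symmetric] w_def q_def by (simp add: mult_ac)
  have e: "gamma_ratio a * (a + 1) ^ 4 = gamma_ratio (a + 1) * q ^ 2"
    unfolding gamma_ratio_def R' G w_def [symmetric] by algebra
  have "6 * norm (a + 1) ^ 2 \<le> norm q"
  proof -
    define b y where "b = Re a" and "y = Im a"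
    have b: "0 \<le> b" using assms by (simp add: b_def)
    have n: "norm (a + 1) ^ 2 = (b + 1)\<^sup>2 + y\<^sup>2" "norm (3 * a + 1) ^ 2 = (3 * b + 1)\<^sup>2 + (3 * y)\<^sup>2"
      "norm (3 * a + 2) ^ 2 = (3 * b + 2)\<^sup>2 + (3 * y)\<^sup>2"
      by (simp_all add: cmod_power2 b_def y_def)
    have "norm (a + 1) ^ 2 \<le> norm (3 * a + 1) ^ 2"
      unfolding n using b power_mono[of "b + 1" "3 * b + 1" 2] by (intro add_mono) (auto simp: power_mult_distrib)
    then have l1: "norm (a + 1) \<le> norm (3 * a + 1)" by (rule power2_le_imp_le) simp
    have "(2 * norm (a + 1)) ^ 2 = (2 * b + 2)\<^sup>2 + (2 * y)\<^sup>2"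
      unfolding power_mult_distrib n by (simp add: power2_eq_square algebra_simps)
    also have "\<dots> \<le> norm (3 * a + 2) ^ 2"
      unfolding n using b power_mono[of "2 * b + 2" "3 * b + 2" 2] by (intro add_mono) (auto simp: power_mult_distrib)
    finally have l2: "2 * norm (a + 1) \<le> norm (3 * a + 2)" by (rule power2_le_imp_le) simp
    have "6 * norm (a + 1) ^ 2 = 3 * (norm (a + 1) * (2 * norm (a + 1)))" by (simp add: power2_eq_square)
    also have "\<dots> \<le> 3 * (norm (3 * a + 1) * norm (3 * a + 2))"
      using l1 l2 by (intro mult_left_mono mult_mono) auto
    also have "\<dots> = norm q" unfolding q_def norm_mult by simp
    finally show ?thesis .
  qed
  then have "(6 * norm (a + 1) ^ 2) ^ 2 \<le> norm q ^ 2" by (intro power_mono) auto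
  then have q: "36 * norm (a + 1) ^ 4 \<le> norm q ^ 2" by (simp add: power_mult_distrib power_mult [symmetric])
  have "norm (gamma_ratio (a + 1)) * (36 * norm (a + 1) ^ 4) \<le> norm (gamma_ratio (a + 1)) * norm q ^ 2"
    using q by (intro mult_left_mono) auto
  also have "\<dots> = norm (gamma_ratio a) * norm (a + 1) ^ 4"
    using arg_cong[OF e, of norm] by (simp add: norm_mult norm_power)
  finally have "norm (gamma_ratio (a + 1)) * 36 * norm (a + 1) ^ 4 \<le> norm (gamma_ratio a) * norm (a + 1) ^ 4"
    by (simp add: mult.assoc)
  then have "norm (gamma_ratio (a + 1)) * 36 \<le> norm (gamma_ratio a)"
    by (rule mult_right_le_imp_le) (use nz in simp)
  then show ?thesis by simp
qed

lemma f10c_bound: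
  assumes "3 / 4 \<le> Re z"
  shows "norm (f10c z) \<le> 3000 * norm (gamma_ratio z)"
proof -
  have n1: "z \<notin> \<int>\<^sub>\<le>\<^sub>0" using nonpos_Ints_ImD[of z] assms by auto
  then have z0: "z \<noteq> 0" by auto
  have x: "3 / 4 \<le> norm z" using assms complex_Re_le_cmod[of z] by linarith
  have "1 / 2 \<le> Re (2 * z - 1)" using assms by simp
  then have l: "1 / 2 \<le> norm (2 * z - 1)" using complex_Re_le_cmod[of "2 * z - 1"] by linarith
  then have nz: "2 * z - 1 \<noteq> 0" by auto
  have G: "Gamma (1 + z) = z * Gamma z" using Gamma_plus1[OF n1] by (simp add: add_ac)
  have R: "rGamma (3 * z) = 3 * z * rGamma (1 + 3 * z)" using rGamma_plus1[of "3 * z"] by (simp add: add_ac)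
  define u where "u = inverse z"
  have zu: "z * u = 1" using z0 by (simp add: u_def)
  have u: "norm u \<le> 4 / 3" using x by (simp add: u_def norm_divide inverse_eq_divide divide_le_eq)
  have "Gamma z ^ 6 * rGamma (3 * z) ^ 2 = 9 * u ^ 4 * gamma_ratio z"
    unfolding gamma_ratio_def G R using zu by algebra
  then have "f10c z = (364 * z ^ 2 - 227 * z + 36) * u ^ 4 / (2 * z - 1) * gamma_ratio z"
  proof -
    have "c * (9 * v * g) / (9 * w) = c * v / w * g" for c v g w :: complex by simp
    then show ?thesis
      unfolding f10c_def \<open>Gamma z ^ 6 * rGamma (3 * z) ^ 2 = 9 * u ^ 4 * gamma_ratio z\<close> .
  qed
  also have "(364 * z ^ 2 - 227 * z + 36) * u ^ 4 = 364 * u ^ 2 - 227 * u ^ 3 + 36 * u ^ 4"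
  proof -
    have "z ^ 2 * u ^ 4 = (z * u) ^ 2 * u ^ 2" "z * u ^ 4 = (z * u) * u ^ 3"
      by (simp_all add: power_mult_distrib power_numeral_reduce)
    then show ?thesis unfolding zu by (simp add: distrib_right left_diff_distrib mult.assoc)
  qed
  finally have eq: "f10c z = (364 * u ^ 2 - 227 * u ^ 3 + 36 * u ^ 4) / (2 * z - 1) * gamma_ratio z" .
  have "norm (364 * u ^ 2 - 227 * u ^ 3 + 36 * u ^ 4) \<le> 364 * norm u ^ 2 + 227 * norm u ^ 3 + 36 * norm u ^ 4"
    using norm_triangle_ineq[of "364 * u ^ 2 - 227 * u ^ 3" "36 * u ^ 4"] norm_triangle_ineq4[of "364 * u ^ 2" "227 * u ^ 3"]
    by (simp add: norm_mult norm_power)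
  also have "\<dots> \<le> 364 * (4 / 3) ^ 2 + 227 * (4 / 3) ^ 3 + 36 * (4 / 3) ^ 4"
    using u by (intro add_mono mult_left_mono power_mono) auto
  also have "\<dots> \<le> 1500" by (simp add: power_numeral_reduce)
  finally have m: "norm (364 * u ^ 2 - 227 * u ^ 3 + 36 * u ^ 4) \<le> 1500" .
  have "norm ((364 * u ^ 2 - 227 * u ^ 3 + 36 * u ^ 4) / (2 * z - 1)) \<le> 1500 / (1 / 2)"
    unfolding norm_divide using m l by (intro frac_le) auto
  then show ?thesis unfolding eq norm_mult by (intro mult_right_mono) auto
qed

lemma f10c_shift_bound:
  assumes "- (1 / 4) \<le> Re a"
  shows "norm (f10c (a + of_nat (Suc n))) \<le> 3000 * norm (gamma_ratio (a + 1)) / real (Suc n) ^ 2"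
proof -
  have g: "norm (gamma_ratio (a + of_nat (Suc n))) \<le> norm (gamma_ratio (a + 1)) * (1 / 36) ^ n" for n
  proof (induction n)
    case (Suc n)
    have "norm (gamma_ratio (a + of_nat (Suc n) + 1)) \<le> norm (gamma_ratio (a + of_nat (Suc n))) / 36"
      by (rule gamma_ratio_step) (use assms in simp)
    also have "\<dots> \<le> norm (gamma_ratio (a + 1)) * (1 / 36) ^ n / 36"
      using Suc by (intro divide_right_mono) auto
    finally show ?case by (simp add: add_ac)
  qed simp
  \<comment> \<open>The geometric rate is weakened to 1 / (n + 1)^2, via n + 1 <= 2^n, so that one
    kind of majorant serves all series.\<close>
  have p: "(1 / 36) ^ n \<le> 1 / real (Suc n) ^ 2"
  proof -
    have "Suc n \<le> 2 ^ n" by (induction n) auto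
    then have "real (Suc n) \<le> 2 ^ n" using of_nat_le_iff[of "Suc n" "2 ^ n", where 'a = real] by simp
    then have "real (Suc n) ^ 2 \<le> (2 ^ n) ^ 2" by (intro power_mono) auto
    also have "\<dots> = 4 ^ n" by (simp add: power2_eq_square flip: power_mult_distrib)
    also have "\<dots> \<le> (36 :: real) ^ n" by (intro power_mono) auto
    finally have "1 / 36 ^ n \<le> 1 / real (Suc n) ^ 2" by (intro divide_left_mono mult_pos_pos) auto
    then show ?thesis by (simp add: power_divide)
  qed
  have "norm (f10c (a + of_nat (Suc n))) \<le> 3000 * norm (gamma_ratio (a + of_nat (Suc n)))"
    by (rule f10c_bound) (use assms in simp)
  also have "\<dots> \<le> 3000 * (norm (gamma_ratio (a + 1)) * (1 / real (Suc n) ^ 2))"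
    using order_trans[OF g mult_left_mono[OF p norm_ge_zero]] by simp
  finally show ?thesis by simp
qed

definition half_plane :: "complex set" where "half_plane = {z. - (1 / 4) < Re z}"

lemma open_half_plane: "open half_plane"
  unfolding half_plane_def by (rule open_halfspace_Re_gt)

lemma f10c_holomorphic: "(\<lambda>a. f10c (a + of_nat (Suc n))) holomorphic_on half_plane"
proof -
  have "z + of_nat (Suc n) \<notin> \<int>\<^sub>\<le>\<^sub>0" "9 * (2 * (z + of_nat (Suc n)) - 1) \<noteq> 0" if "z \<in> half_plane" for z
  proof -
    show "z + of_nat (Suc n) \<notin> \<int>\<^sub>\<le>\<^sub>0"
      using nonpos_Ints_ImD[of "z + of_nat (Suc n)"] that by (auto simp: half_plane_def)
    have "0 < Re (2 * (z + of_nat (Suc n)) - 1)" using that by (simp add: half_plane_def)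
    then have "2 * (z + of_nat (Suc n)) - 1 \<noteq> 0" by (metis less_irrefl zero_complex.sel(1))
    then show "9 * (2 * (z + of_nat (Suc n)) - 1) \<noteq> 0" by (metis mult_eq_0_iff zero_neq_numeral)
  qed
  then show ?thesis unfolding f10c_def by (intro holomorphic_intros) auto
qed

lemma gamma_ratio_holomorphic: "(\<lambda>a. gamma_ratio (a + 1)) holomorphic_on half_plane"
proof -
  have "1 + (z + 1) \<notin> \<int>\<^sub>\<le>\<^sub>0" if "z \<in> half_plane" for z
    using nonpos_Ints_ImD[of "1 + (z + 1)"] that by (auto simp: half_plane_def)
  then show ?thesis unfolding gamma_ratio_def by (intro holomorphic_intros) auto
qed

lemma f10_sum_holomorphic:
  shows "f10_sum holomorphic_on half_plane"
    and "\<And>z. z \<in> half_plane \<Longrightarrow> summable (\<lambda>n. f10c (z + of_nat (Suc n)))"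
proof -
  have bd: "\<exists>d>0. \<exists>K J. \<forall>n\<ge>J. \<forall>y\<in>ball z d \<inter> half_plane. norm (f10c (y + of_nat (Suc n))) \<le> K / real (Suc n) ^ 2"
    if z: "z \<in> half_plane" for z
  proof -
    from locally_bounded_at[OF open_half_plane gamma_ratio_holomorphic z] obtain d B
      where d: "0 < d" and B: "\<And>y. y \<in> ball z d \<Longrightarrow> norm (gamma_ratio (y + 1)) \<le> B" by blast
    have "norm (f10c (y + of_nat (Suc n))) \<le> 3000 * B / real (Suc n) ^ 2" if "y \<in> ball z d \<inter> half_plane" for y n
    proof -
      have "norm (f10c (y + of_nat (Suc n))) \<le> 3000 * norm (gamma_ratio (y + 1)) / real (Suc n) ^ 2"
        by (rule f10c_shift_bound) (use that in \<open>simp add: half_plane_def\<close>)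
      also have "\<dots> \<le> 3000 * B / real (Suc n) ^ 2"
        using B that by (intro divide_right_mono mult_left_mono) auto
      finally show ?thesis .
    qed
    then show ?thesis using d by blast
  qed
  show "f10_sum holomorphic_on half_plane"
    using holomorphic_suminf(1)[OF open_half_plane f10c_holomorphic bd] unfolding f10_sum_def .
  show "\<And>z. z \<in> half_plane \<Longrightarrow> summable (\<lambda>n. f10c (z + of_nat (Suc n)))"
    using holomorphic_suminf(2)[OF open_half_plane f10c_holomorphic bd] .
qed

text \<open>Reflection at \<open>a\<close> and at \<open>3 * a\<close> rewrites half of the Gamma
  values. The identity controls the shifted series in the imaginary direction:
  \<open>sine_factor\<close> and \<open>ph 3 a 0\<close> are bounded there, so
  \<open>gamma_ratio\<close> is at most quadratic in |a|.\<close>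

lemma gamma_ratio_conv_ph:
  assumes "3 * a \<notin> \<int>"
  shows "3 * gamma_ratio a = a ^ 2 * sine_factor a * ph 3 a 0"
proof -
  have a: "a \<notin> \<int>" using assms Ints_mult[of 3 a] by auto
  have a0: "a \<noteq> 0" using a by auto
  have s: "sin (of_real pi * a) \<noteq> 0" by (rule sin_pi_nonzero[OF a])
  have n: "1 - 3 * a \<notin> \<int>\<^sub>\<le>\<^sub>0" using assms Ints_diff[of 1 "1 - 3 * a"] nonpos_Ints_Int by auto
  have e1: "Gamma (1 + a) * (rGamma (1 + a) * rGamma (1 - a)) = rGamma (1 - a)"
  proof -
    have "1 + a \<notin> \<int>\<^sub>\<le>\<^sub>0" using a Ints_diff[of "1 + a" 1] nonpos_Ints_Int by auto
    then have "Gamma (1 + a) * rGamma (1 + a) = 1"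
      by (simp add: Gamma_def rGamma_eq_zero_iff)
    then show ?thesis by (simp add: mult.assoc [symmetric])
  qed
  have e2: "rGamma (1 + a) * rGamma (1 - a) = sin (of_real pi * a) / (of_real pi * a)"
  proof -
    have "a * (rGamma (1 + a) * rGamma (1 - a)) = rGamma a * rGamma (1 - a)"
      using rGamma_plus1[of a] by (simp add: add_ac mult.assoc [symmetric])
    also have "\<dots> = sin (of_real pi * a) / of_real pi" by (rule rGamma_reflection_complex)
    finally show ?thesis using a0 by (simp add: field_simps)
  qed
  have e3: "rGamma (1 + 3 * a) * rGamma (1 - 3 * a) = sin (of_real pi * (3 * a)) / (of_real pi * (3 * a))"
  proof -
    have "3 * a * (rGamma (1 + 3 * a) * rGamma (1 - 3 * a)) = rGamma (3 * a) * rGamma (1 - 3 * a)"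
      using rGamma_plus1[of "3 * a"] by (simp add: add_ac mult.assoc [symmetric])
    also have "\<dots> = sin (of_real pi * (3 * a)) / of_real pi" by (rule rGamma_reflection_complex)
    finally show ?thesis using a0 by (simp add: field_simps)
  qed
  have e4: "Gamma (1 - 3 * a) * (rGamma (1 + 3 * a) * rGamma (1 - 3 * a)) = rGamma (1 + 3 * a)"
  proof -
    have "Gamma (1 - 3 * a) * rGamma (1 - 3 * a) = 1" using n by (simp add: Gamma_def rGamma_eq_zero_iff)
    then show ?thesis by (simp add: mult.left_commute)
  qed
  define g h s1 s3 where "g = Gamma (1 + a)" and "h = Gamma (1 - 3 * a)"
    and "s1 = sin (of_real pi * a)" and "s3 = sin (of_real pi * (3 * a))"
  have p: "ph 3 a 0 = g ^ 3 * h * rGamma (1 - a) ^ 3 * rGamma (1 + 3 * a)"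
    by (simp add: ph_def g_def h_def)
  have r1: "rGamma (1 - a) = g * (s1 / (of_real pi * a))"
    using e1 unfolding e2 g_def s1_def by simp
  have r3: "rGamma (1 + 3 * a) = h * (s3 / (of_real pi * (3 * a)))"
    using e4 unfolding e3 h_def s3_def by simp
  have s1: "s1 \<noteq> 0" using s by (simp add: s1_def)
  have "3 * gamma_ratio a = 3 * (g ^ 6 * (h * (s3 / (of_real pi * (3 * a)))) ^ 2)"
    unfolding gamma_ratio_def g_def [symmetric] r3 ..
  also have "\<dots> = a ^ 2 * (of_real pi ^ 2 * s3 / s1 ^ 3) * (g ^ 3 * h * (g * (s1 / (of_real pi * a))) ^ 3 * (h * (s3 / (of_real pi * (3 * a)))))"
  proof -
    define A B K where "A = s1 / (of_real pi * a)" and "B = s3 / (of_real pi * (3 * a))"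
      and "K = of_real pi ^ 2 * s3 / s1 ^ 3"
    have k: "a ^ 2 * K * A ^ 3 = 3 * B"
    proof -
      define u w where "u = inverse (of_real pi * a)" and "w = inverse s1"
      have u: "of_real pi * a * u = 1" unfolding u_def by (rule right_inverse) (use a0 in simp)
      have w: "s1 * w = 1" unfolding w_def using s1 by (rule right_inverse)
      have "A = s1 * u" by (simp only: A_def u_def divide_inverse)
      moreover have "3 * (x / (y * (3 * z))) = x / (y * z)" for x y z :: complex by simp
      then have "3 * B = s3 * u" unfolding B_def u_def divide_inverse .
      moreover have "K = of_real pi ^ 2 * s3 * w ^ 3" by (simp only: K_def w_def divide_inverse power_inverse)
      ultimately have "a ^ 2 * K * A ^ 3 = 3 * B * (of_real pi * a * u) ^ 2 * (s1 * w) ^ 3"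
        by (simp add: power2_eq_square power3_eq_cube mult_ac)
      then show ?thesis unfolding u w by simp
    qed
    have "a ^ 2 * K * (g ^ 3 * h * (g * A) ^ 3 * (h * B)) = g ^ 6 * h ^ 2 * B * (a ^ 2 * K * A ^ 3)"
      by algebra
    also have "\<dots> = 3 * (g ^ 6 * (h * B) ^ 2)" unfolding k by algebra
    finally show ?thesis unfolding A_def B_def K_def by (rule sym)
  qed
  also have "\<dots> = a ^ 2 * sine_factor a * ph 3 a 0"
    unfolding p r1 r3 sine_factor_conv[OF a] s1_def s3_def ..
  finally show ?thesis .
qed

section \<open>The 1-periodic defect of the Wilf-Zeilberger summation\<close>

text \<open>The Digamma term offsets the limit of \<open>wz_column\<close> at infinity. The last
  term is \<open>sine_factor a\<close> times pi cot(3 pi a), written so as to be regular at a = 1/3;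
  it has period 1 and cancels the cotangent that reflection produces in
  \<open>wz_rest_sums\<close>.\<close>

definition wz_defect :: "complex \<Rightarrow> complex" where
  "wz_defect a = f10_sum a - 2 * ((\<Sum>n. wz_periodic_term n a) +
     3 * sine_factor a * (Digamma (1 + 2 * a) + euler_mascheroni) +
     of_real pi ^ 3 * cos (of_real pi * (3 * a)) / sin (of_real pi * a) ^ 3)"

lemma wz_defect_holomorphic: "wz_defect holomorphic_on strip"
proof -
  have dg: "(\<lambda>z. Digamma (1 + 2 * z)) holomorphic_on strip"
    by (intro holomorphic_on_compose_gen[OF _ holomorphic_on_Polygamma[of "- \<int>\<^sub>\<le>\<^sub>0"], unfolded o_def] holomorphic_intros;
        use strip_Gamma_args in auto)
  have "strip \<subseteq> half_plane" by (auto simp: strip_def half_plane_def)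
  then have "f10_sum holomorphic_on strip" using f10_sum_holomorphic(1) holomorphic_on_subset by blast
  then show ?thesis
    unfolding wz_defect_def
    by (intro holomorphic_intros wz_periodic_sum(1) sine_factor_holomorphic dg)
       (use sin_pi_nonzero strip_notin_Ints in auto)
qed

lemma sine_factor_bound: "1 \<le> \<bar>Im a\<bar> \<Longrightarrow> norm (sine_factor a) \<le> 112"
proof -
  assume "1 \<le> \<bar>Im a\<bar>"
  from norm_sin_pi_ge[OF this] have s: "1 \<le> norm (sin (of_real pi * a)) ^ 2" by (intro one_le_power)
  have "norm (3 / sin (of_real pi * a) ^ 2 - 4) \<le> 3 / norm (sin (of_real pi * a)) ^ 2 + 4"
    using norm_triangle_ineq4[of "3 / sin (of_real pi * a) ^ 2" 4] by (simp add: norm_divide norm_power)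
  also have "\<dots> \<le> 3 / 1 + 4" using s by (intro add_right_mono divide_left_mono) auto
  finally have "norm (3 / sin (of_real pi * a) ^ 2 - 4) \<le> 7" by simp
  moreover have "norm (of_real pi ^ 2 :: complex) \<le> 4 ^ 2"
    unfolding norm_power norm_of_real using pi_less_4 pi_ge_zero by (intro power_mono) auto
  ultimately have "norm (of_real pi ^ 2 :: complex) * norm (3 / sin (of_real pi * a) ^ 2 - 4) \<le> 4 ^ 2 * 7"
    by (intro mult_mono) auto
  then show ?thesis unfolding sine_factor_def norm_mult by simp
qed

text \<open>Seven linear factors in the denominator face j^4 from \<open>wz_poly\<close> and j^3
  from the Gamma recurrence, so only the leading coefficient 9 + 12 a survives. The limit is - 6
  \<open>sine_factor a\<close> times 1 / (2 a + 1) + 1 / (2 a + 2), the increment of Digamma at 1 +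
  2 a.\<close>

lemma wz_column_limit:
  fixes a :: complex
  assumes a: "a \<notin> \<int>"
  shows "wz_column a \<longlonglongrightarrow> - (3 * sine_factor a * (4 * a + 3) / ((a + 1) * (2 * a + 1)))"
proof -
  define P where "P = sine_factor a"
  define den where "den = (a + 1) * (2 * a + 1)"
  define c0 where "c0 = 173 + 1020 * a + 2386 * a ^ 2 + 2768 * a ^ 3 + 1593 * a ^ 4 + 364 * a ^ 5"
  define c2 where "c2 = 86 + 288 * a + 322 * a ^ 2 + 120 * a ^ 3"
  define c4 where "c4 = 9 + 12 * a"
  define r where "r = (\<lambda>b n. (of_nat n + b) / of_nat n :: complex)"
  have r: "r b \<longlonglongrightarrow> 1" for b unfolding r_def by (rule LIMSEQ_shift_ratio)
  have inv: "(\<lambda>n. inverse (of_nat n) :: complex) \<longlonglongrightarrow> 0" by (rule lim_inverse_n)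
  define E where "E = (\<lambda>n. - (P / den * ph 3 a n * (c0 * inverse (of_nat n) ^ 4 - c2 * inverse (of_nat n) ^ 2 + c4) * r (- a) n ^ 3 /
      (r (3 * a + 2) n * r (3 * a + 3) n * (r (- (3 * a + 1)) n * r (- (3 * a + 2)) n * r (- (3 * a + 3)) n) *
       (r (- (3 * a)) n * r (3 * a + 1) n))))"
  have "E \<longlonglongrightarrow> - (P / den * 1 * (c0 * 0 ^ 4 - c2 * 0 ^ 2 + c4) * 1 ^ 3 / (1 * 1 * (1 * 1 * 1) * (1 * 1)))"
    unfolding E_def by (intro tendsto_intros r inv ph_lim) auto
  moreover have "\<forall>\<^sub>F n in sequentially. E n = wz_column a n"
  proof -
    obtain N where N: "6 * (norm a + 1) \<le> real N" using real_arch_simple by blast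
    show ?thesis
      using eventually_ge_at_top[of N]
    proof eventually_elim
      case (elim n)
      define J :: complex where "J = of_nat n"
      have n6: "6 * norm a + 6 \<le> real n" using elim N by (simp add: distrib_left)
      then have "6 \<le> real n" by (rule order_trans[rotated]) simp
      then have n0: "0 < n" by (cases n) auto
      have n: "6 * norm a \<le> real n" using n6 by simp
      have J0: "J \<noteq> 0" using n0 by (simp add: J_def)
      have ne: "of_nat n - 3 * a \<notin> \<int>\<^sub>\<le>\<^sub>0" using shift_lower_bounds(4)[OF _ n n0, of a 3] by simp
      have big: "J + b \<noteq> 0" if "norm b \<le> 3 * norm a + 3" for b
      proof
        assume "J + b = 0"
        then have "J = - b" by (simp add: eq_neg_iff_add_eq_0)
        then have "norm J = norm b" by simp
        then have "real n \<le> 3 * norm a + 3" using that by (simp add: J_def)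
        then have "6 * norm a + 6 \<le> 3 * norm a + 3" using n6 by (rule order_trans[rotated])
        then show False using norm_ge_zero[of a] by simp
      qed
      have nb: "norm (3 * a + 1) \<le> 3 * norm a + 3" "norm (3 * a + 2) \<le> 3 * norm a + 3" "norm (3 * a + 3) \<le> 3 * norm a + 3"
        using norm_triangle_ineq[of "3 * a" 1] norm_triangle_ineq[of "3 * a" 2] norm_triangle_ineq[of "3 * a" 3] by (simp_all add: norm_mult)
      have b2: "J - b \<noteq> 0" if "norm b \<le> 3 * norm a + 3" for b using big[of "- b"] that by simp
      have nz: "J + (3 * a + 1) \<noteq> 0" "J + (3 * a + 2) \<noteq> 0" "J + (3 * a + 3) \<noteq> 0"
        "J - (3 * a + 1) \<noteq> 0" "J - (3 * a + 2) \<noteq> 0" "J - (3 * a + 3) \<noteq> 0" "J - 3 * a \<noteq> 0"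
        using big[OF nb(1)] big[OF nb(2)] big[OF nb(3)] b2[OF nb(1)] b2[OF nb(2)] b2[OF nb(3)] b2[of "3 * a"]
        by (simp_all add: norm_mult)
      have k0: "2 * J + 1 \<noteq> 0"
      proof -
        have "2 * J + 1 = of_nat (2 * n + 1)" by (simp add: J_def)
        then show ?thesis by (simp only: of_nat_eq_0_iff)
      qed
      have na: "a - of_nat n \<notin> \<int>\<^sub>\<le>\<^sub>0" using Re_minus_of_nat_notin_Ints(1)[OF a] nonpos_Ints_Int by blast
      have G: "Gamma (a + 1 - of_nat n) = (a - J) * Gamma (a - of_nat n)"
        using Gamma_plus1[OF na] by (simp add: J_def algebra_simps)
      have rg: "rGamma z = z * rGamma w" if "w = z + 1" for z w :: complex
        using rGamma_plus1[of z] that by simp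
      define U V where "U = rGamma (3 * a + 4 + of_nat n)" and "V = rGamma (3 * a + 4 - of_nat n)"
      have U: "rGamma (3 * a + 2 + of_nat n) = (J + (3 * a + 2)) * ((J + (3 * a + 3)) * U)"
      proof -
        have "rGamma (3 * a + 2 + of_nat n) = (3 * a + 2 + of_nat n) * rGamma (3 * a + 3 + of_nat n)" by (rule rg) simp
        also have "rGamma (3 * a + 3 + of_nat n) = (3 * a + 3 + of_nat n) * U" unfolding U_def by (rule rg) simp
        finally show ?thesis by (simp add: J_def add_ac)
      qed
      have V: "rGamma (3 * a + 1 - of_nat n) = - ((J - (3 * a + 1)) * ((J - (3 * a + 2)) * ((J - (3 * a + 3)) * V)))"
      proof -
        have "rGamma (3 * a + 1 - of_nat n) = (3 * a + 1 - of_nat n) * rGamma (3 * a + 2 - of_nat n)" by (rule rg) simp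
        also have "rGamma (3 * a + 2 - of_nat n) = (3 * a + 2 - of_nat n) * rGamma (3 * a + 3 - of_nat n)" by (rule rg) simp
        also have "rGamma (3 * a + 3 - of_nat n) = (3 * a + 3 - of_nat n) * V" unfolding V_def by (rule rg) simp
        finally have "rGamma (3 * a + 1 - of_nat n) = (3 * a + 1 - J) * ((3 * a + 2 - J) * ((3 * a + 3 - J) * V))"
          by (simp add: J_def)
        also have "\<dots> = - ((J - (3 * a + 1)) * ((J - (3 * a + 2)) * ((J - (3 * a + 3)) * V)))"
          by algebra
        finally show ?thesis .
      qed
      define X Y where "X = Gamma (a + 1 + of_nat n)" and "Y = Gamma (a - of_nat n)"
      have col: "wz_column a n = (c0 - c2 * J ^ 2 + c4 * J ^ 4) / den * X ^ 3 * ((a - J) * Y) ^ 3 * U * V"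
        unfolding wz_column_def G X_def Y_def U_def V_def den_def c0_def c2_def c4_def wz_poly_def J_def ..
      have row: "wz_row a n = - (2 * J + 1) * X ^ 3 * Y ^ 3 * ((J + (3 * a + 2)) * ((J + (3 * a + 3)) * U)) *
          (- ((J - (3 * a + 1)) * ((J - (3 * a + 2)) * ((J - (3 * a + 3)) * V))))"
        unfolding wz_row_def U V X_def Y_def J_def by simp
      have row2: "wz_row a n = P * (ph 3 a n * (2 * J + 1) / ((J - 3 * a) * (J + (3 * a + 1))))"
      proof -
        have "of_nat (Suc n) + 3 * a \<noteq> 0" using nz(1) by (simp add: J_def add_ac)
        from wz_row_conv_ph[OF a ne this] show ?thesis by (simp add: P_def J_def add_ac)
      qed
      have alg: "q / den * x ^ 3 * (z * y) ^ 3 * u * v = z ^ 3 * (q / den) * (w / (k * (u1 * u2 * (v1 * v2 * v3))))"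
        if "w = - k * x ^ 3 * y ^ 3 * (u1 * (u2 * u)) * (- (v1 * (v2 * (v3 * v))))" "k \<noteq> 0"
          "u1 \<noteq> 0" "u2 \<noteq> 0" "v1 \<noteq> 0" "v2 \<noteq> 0" "v3 \<noteq> 0" for q x y z u v w k u1 u2 v1 v2 v3 :: complex
      proof -
        have "w = (k * (u1 * u2 * (v1 * v2 * v3))) * (x ^ 3 * y ^ 3 * u * v)" unfolding that(1) by simp
        then have "w / (k * (u1 * u2 * (v1 * v2 * v3))) = x ^ 3 * y ^ 3 * u * v" using that(2-) by simp
        then show ?thesis by (simp only:) (simp add: power_mult_distrib)
      qed
      have "wz_column a n = (a - J) ^ 3 * ((c0 - c2 * J ^ 2 + c4 * J ^ 4) / den) *
         (wz_row a n / ((2 * J + 1) * ((J + (3 * a + 2)) * (J + (3 * a + 3)) *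
          ((J - (3 * a + 1)) * (J - (3 * a + 2)) * (J - (3 * a + 3))))))"
        unfolding col by (rule alg[OF row k0 nz(2,3,4,5,6)])
      also have "wz_row a n / ((2 * J + 1) * ((J + (3 * a + 2)) * (J + (3 * a + 3)) *
          ((J - (3 * a + 1)) * (J - (3 * a + 2)) * (J - (3 * a + 3))))) =
          P * ph 3 a n / ((J + (3 * a + 2)) * (J + (3 * a + 3)) * ((J - (3 * a + 1)) * (J - (3 * a + 2)) * (J - (3 * a + 3))) *
            ((J - 3 * a) * (J + (3 * a + 1))))"
        unfolding row2 using k0 by simp
      finally have col2: "wz_column a n = (a - J) ^ 3 * ((c0 - c2 * J ^ 2 + c4 * J ^ 4) / den) *
         (P * ph 3 a n / ((J + (3 * a + 2)) * (J + (3 * a + 3)) * ((J - (3 * a + 1)) * (J - (3 * a + 2)) * (J - (3 * a + 3))) *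
            ((J - 3 * a) * (J + (3 * a + 1)))))" .
      have e: "c0 * inverse J ^ 4 - c2 * inverse J ^ 2 + c4 = (c0 - c2 * J ^ 2 + c4 * J ^ 4) / J ^ 4"
      proof -
        have "J ^ 4 = J ^ 2 * J ^ 2" by (simp flip: power_add)
        then show ?thesis using J0 by (simp add: field_simps)
      qed
      have e3: "(a - J) ^ 3 = - ((J - a) ^ 3)" by (simp add: power3_eq_cube algebra_simps)
      have alg2: "- (z ^ 3) * (q / d) * (p / (u1 * u2 * (v1 * v2 * v3) * (t * s))) =
          - (p / d * (q / J ^ 4) * (z / J) ^ 3 / (u1 / J * (u2 / J) * (v1 / J * (v2 / J) * (v3 / J)) * (t / J * (s / J))))"
        for z q d p u1 u2 v1 v2 v3 t s :: complex
      proof -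
        have j7: "J ^ 7 = J * J * (J * J * J) * (J * J)" by (simp add: eval_nat_numeral mult.assoc)
        have 1: "u1 / J * (u2 / J) * (v1 / J * (v2 / J) * (v3 / J)) * (t / J * (s / J)) =
           u1 * u2 * (v1 * v2 * v3) * (t * s) / J ^ 7"
          unfolding j7 by (simp only: times_divide_times_eq)
        have j7': "J ^ 7 = J ^ 4 * J ^ 3" by (simp flip: power_add)
        have 2: "p / d * (q / J ^ 4) * (z / J) ^ 3 = p * q * z ^ 3 / (d * J ^ 7)"
          unfolding j7' power_divide by (simp only: times_divide_times_eq mult.assoc)
        have "p * q * z ^ 3 / (d * J ^ 7) / (x / J ^ 7) = z ^ 3 * (q / d) * (p / x)" for x
          using J0 by simp
        then show ?thesis unfolding 1 2 by simp
      qed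
      show "E n = wz_column a n"
        unfolding col2 e3 alg2 unfolding E_def r_def unfolding J_def [symmetric] e add_uminus_conv_diff
        by (simp only: times_divide_eq_left)
    qed
  qed
  ultimately have "wz_column a \<longlonglongrightarrow> - (P / den * 1 * (c0 * 0 ^ 4 - c2 * 0 ^ 2 + c4) * 1 ^ 3 / (1 * 1 * (1 * 1 * 1) * (1 * 1)))"
    by (rule Lim_transform_eventually)
  moreover have "c4 = 3 * (4 * a + 3)" by (simp add: c4_def)
  ultimately show ?thesis by (simp add: P_def den_def mult_ac)
qed

text \<open>At j = 0 the polynomial factors as (a + 1)^3 times the quadratic of \<open>f10\<close>
  at a + 1; the 9 in the denominator comes from rGamma(3 a + 3) = 3 (a + 1) rGamma(3 a + 4),
  squared.\<close>

lemma wz_column_0: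
  fixes a :: complex
  assumes "a + 1 \<noteq> 0" "2 * a + 1 \<noteq> 0"
  shows "wz_column a 0 = f10c (a + 1)"
proof -
  have r: "rGamma (3 * (a + 1)) = 3 * (a + 1) * rGamma (3 * a + 4)"
    using rGamma_plus1[of "3 * (a + 1)"] by (simp add: algebra_simps)
  have p: "wz_poly a 0 = (a + 1) ^ 3 * (364 * (a + 1) ^ 2 - 227 * (a + 1) + 36)"
    unfolding wz_poly_def by (simp add: algebra_simps power_numeral_reduce)
  define q where "q = 364 * (a + 1) ^ 2 - 227 * (a + 1) + 36"
  have alg: "v ^ 3 * q / (v * w) * g ^ 3 * g ^ 3 * r * r = q * (g ^ 6 * (3 * v * r) ^ 2) / (9 * w)"
    if "v \<noteq> 0" for v w g r :: complex
  proof -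
    have "v ^ 3 * q / (v * w) = v ^ 2 * q / w" using that by (simp add: power2_eq_square power3_eq_cube)
    then show ?thesis by (simp add: power_mult_distrib power_numeral_reduce mult_ac)
  qed
  have e: "2 * (a + 1) - 1 = 2 * a + 1" by simp
  have "wz_column a 0 = (a + 1) ^ 3 * q / ((a + 1) * (2 * a + 1)) * Gamma (a + 1) ^ 3 * Gamma (a + 1) ^ 3 *
      rGamma (3 * a + 4) * rGamma (3 * a + 4)"
    by (simp only: wz_column_def of_nat_0 add_0_right diff_zero p q_def)
  also have "\<dots> = q * (Gamma (a + 1) ^ 6 * (3 * (a + 1) * rGamma (3 * a + 4)) ^ 2) / (9 * (2 * a + 1))"
    by (rule alg[OF assms(1)])
  also have "\<dots> = f10c (a + 1)"
    by (simp only: f10c_def r q_def e)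
  finally show ?thesis .
qed

lemma sine_factor_plus_1: "sine_factor (a + 1) = sine_factor a"
  by (simp add: sine_factor_def distrib_left sin_add flip: sin_of_real cos_of_real)

text \<open>The increments cancel in pairs: the shifted series loses its first term
  \<open>f10c (a + 1)\<close>, which is the boundary value at j = 0, and the boundary value at
  infinity is matched by the Digamma term.\<close>

lemma wz_defect_periodic:
  assumes z: "- (1/4) < Re a" "Re a < 1/4" "a \<noteq> 0"
  shows "wz_defect (a + 1) = wz_defect a"
proof -
  have as: "a \<in> strip" "a + 1 \<in> strip"
    using z by (auto simp: strip_def complex_eq_iff)
  then have ah: "a \<in> half_plane" "a + 1 \<in> half_plane" by (auto simp: strip_def half_plane_def)
  have a: "a \<notin> \<int>" by (rule strip_notin_Ints[OF as(1)])
  have nz: "a \<noteq> 0" "a + 1 \<noteq> 0" "2 * a + 1 \<noteq> 0"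
  proof -
    have "Re (a + 1) \<noteq> 0" "Re (2 * a + 1) \<noteq> 0" using z by auto
    then show "a \<noteq> 0" "a + 1 \<noteq> 0" "2 * a + 1 \<noteq> 0" using z by (auto simp del: plus_complex.sel)
  qed
  define P where "P = sine_factor a"
  define q where "q = (4 * a + 3) / ((a + 1) * (2 * a + 1))"
  have "wz_column a \<longlonglongrightarrow> - (3 * P * q)"
    using wz_column_limit[OF a] by (simp add: P_def q_def)
  from telescope_sums[OF this]
  have "(\<lambda>n. wz_column a (Suc n) - wz_column a n) sums (- (3 * P * q) - f10c (a + 1))"
    by (simp add: wz_column_0 nz)
  then have *: "(\<lambda>n. 2 * (wz_periodic_term n (a + 1) - wz_periodic_term n a)) sums (- (3 * P * q) - f10c (a + 1))"
    unfolding wz_telescope[OF a nz(2,3), symmetric] wz_periodic_term_def sine_factor_plus_1 by simp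
  have s: "2 * (\<Sum>n. wz_periodic_term n (a + 1)) - 2 * (\<Sum>n. wz_periodic_term n a) = - (3 * P * q) - f10c (a + 1)"
  proof -
    have sm: "summable (\<lambda>n. wz_periodic_term n (a + 1) - wz_periodic_term n a)"
      by (intro summable_diff wz_periodic_sum(2) as)
    have "2 * (\<Sum>n. wz_periodic_term n (a + 1)) - 2 * (\<Sum>n. wz_periodic_term n a) =
        2 * ((\<Sum>n. wz_periodic_term n (a + 1)) - (\<Sum>n. wz_periodic_term n a))"
      by (simp only: right_diff_distrib)
    also have "\<dots> = 2 * (\<Sum>n. wz_periodic_term n (a + 1) - wz_periodic_term n a)"
      by (simp only: suminf_diff[OF wz_periodic_sum(2)[OF as(2)] wz_periodic_sum(2)[OF as(1)]])
    also have "\<dots> = (\<Sum>n. 2 * (wz_periodic_term n (a + 1) - wz_periodic_term n a))"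
      by (rule suminf_mult[OF sm, symmetric])
    also have "\<dots> = - (3 * P * q) - f10c (a + 1)"
      using * by (rule sums_unique[symmetric])
    finally show ?thesis .
  qed
  have S: "f10_sum a = f10_sum (a + 1) + f10c (a + 1)"
  proof -
    have "f10_sum a = (\<Sum>n. f10c (a + of_nat (Suc (Suc n)))) + f10c (a + of_nat (Suc 0))"
      unfolding f10_sum_def using suminf_split_head[OF f10_sum_holomorphic(2)[OF ah(1)]] by simp
    then show ?thesis by (simp add: f10_sum_def add_ac)
  qed
  have "2 + 2 * a = 2 * (a + 1)" by simp
  then have nz2: "2 + 2 * a \<noteq> 0" using nz(2) by (metis mult_eq_0_iff zero_neq_numeral)
  have d: "Digamma (1 + 2 * (a + 1)) = Digamma (1 + 2 * a) + 1 / (2 * a + 1) + 1 / (2 * (a + 1))"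
    using Digamma_plus1[of "1 + 2 * a"] Digamma_plus1[OF nz2] nz by (simp add: algebra_simps)
  have q2: "2 * (1 / (2 * a + 1) + 1 / (2 * (a + 1))) = q"
  proof -
    have "2 * (1 / w + 1 / (2 * v)) = (2 * v + w) / (v * w)" if "v \<noteq> 0" "w \<noteq> 0" for v w :: complex
      using that by (simp add: field_simps)
    from this[OF nz(2,3)] show ?thesis by (simp add: q_def algebra_simps)
  qed
  have tr: "cos (of_real pi * (3 * (a + 1))) / sin (of_real pi * (a + 1)) ^ 3 = cos (of_real pi * (3 * a)) / sin (of_real pi * a) ^ 3"
  proof -
    have "cos (of_real pi * (3 * (a + 1))) = cos (3 * (of_real pi * a + of_real pi))" by (simp add: algebra_simps)
    also have "\<dots> = - cos (3 * (of_real pi * a))"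
      unfolding cos_triple by (simp add: cos_add power3_eq_cube flip: sin_of_real cos_of_real)
    finally have "cos (of_real pi * (3 * (a + 1))) = - cos (of_real pi * (3 * a))" by (simp add: mult.left_commute)
    moreover have "sin (of_real pi * (a + 1)) = - sin (of_real pi * a)"
      by (simp add: distrib_left sin_add flip: sin_of_real cos_of_real)
    ultimately show ?thesis by (simp add: power3_eq_cube)
  qed
  have "wz_defect (a + 1) - wz_defect a = - f10c (a + 1) - (- (3 * P * q) - f10c (a + 1)) -
      3 * P * (2 * (1 / (2 * a + 1) + 1 / (2 * (a + 1))))"
  proof -
    have tr': "of_real pi ^ 3 * cos (of_real pi * (3 * (a + 1))) / sin (of_real pi * (a + 1)) ^ 3 =
        of_real pi ^ 3 * cos (of_real pi * (3 * a)) / sin (of_real pi * a) ^ 3"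
      by (simp only: times_divide_eq_right [symmetric] tr)
    have "A - 2 * (W1 + 3 * p * (D + e1 + e2 + G) + T) - (A + f - 2 * (W0 + 3 * p * (D + G) + T)) =
        - f - (2 * W1 - 2 * W0) - 3 * p * (2 * (e1 + e2))" for A W1 p D e1 e2 G T f W0 :: complex
      by (simp add: algebra_simps)
    then show ?thesis
      unfolding s [symmetric] unfolding wz_defect_def S d sine_factor_plus_1 tr' P_def .
  qed
  then show ?thesis unfolding q2 by simp
qed

lemma wz_defect_growth:
  obtains K where "\<And>a. 0 \<le> Re a \<Longrightarrow> Re a \<le> 1 \<Longrightarrow> 1 \<le> \<bar>Im a\<bar> \<Longrightarrow> norm (wz_defect a) \<le> K * \<bar>Im a\<bar> ^ 3"
proof -
  define h where "h = 64 * exp (192 :: real)"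
  define s where "s = (\<Sum>n. 1 / real (Suc n) ^ 2)"
  have s0: "0 \<le> s" unfolding s_def by (intro suminf_nonneg summable_inverse_Suc_square) auto
  have h0: "0 \<le> h" by (simp add: h_def)
  define K1 where "K1 = 112 * (16 * h + 200) * s"
  define K0 where "K0 = 10000 * exp 192 * s + 2 * (K1 + 2100 + 2500)"
  have K1: "0 \<le> K1" using h0 s0 by (simp add: K1_def)
  have K0: "0 \<le> K0" using K1 s0 by (simp add: K0_def)
  have "norm (wz_defect a) \<le> (K0 * 8) * \<bar>Im a\<bar> ^ 3" if a: "0 \<le> Re a" "Re a \<le> 1" "1 \<le> \<bar>Im a\<bar>" for a
  proof -
    define x where "x = norm a"
    have x: "1 \<le> x" "x \<le> 2 * \<bar>Im a\<bar>" using norm_le_2_Im[OF a] by (simp_all add: x_def)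
    have x23: "x ^ 2 \<le> x ^ 3" "x \<le> x ^ 3" "1 \<le> x ^ 3"
      using x power_increasing[of 2 3 x] power_increasing[of 1 3 x] one_le_power[of x 3] by auto
    have nI: "a \<notin> \<int>" "3 * a \<notin> \<int>" using a by (auto elim!: Ints_cases simp: complex_eq_iff)
    define P where "P = sine_factor a"
    have P: "norm P \<le> 112" unfolding P_def by (rule sine_factor_bound[OF a(3)])
    have r: "norm (wz_rest n a) \<le> (16 * h + 200) * x ^ 3 * (1 / real (Suc n) ^ 2)" for n
    proof -
      have "norm (wz_rest n a) \<le> (16 * (h * x ^ 3) + 8 * (1 + 6 * norm a + 18 * norm a ^ 2)) / real (Suc n) ^ 2"
      proof (rule wz_rest_bound)
        show "real (Suc n) / 2 \<le> norm (of_nat (Suc n) + 3 * a)"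
        proof -
          have "real (Suc n) \<le> Re (of_nat (Suc n) + 3 * a)" using a by simp
          also have "\<dots> \<le> norm (of_nat (Suc n) + 3 * a)" by (rule complex_Re_le_cmod)
          finally show ?thesis by simp
        qed
        show "real (Suc n) / 4 \<le> norm (of_nat n - 3 * a)"
        proof (cases n)
          case 0
          then show ?thesis using x by (simp add: norm_mult x_def)
        next
          case (Suc m)
          then have "real (Suc n) / 4 \<le> real n / 2" by simp
          also have "\<dots> \<le> norm (of_nat n - 3 * a)" using strip_lower_bounds(2)[OF a, of 3 n] by simp
          finally show ?thesis .
        qed
        show "norm (ph 3 a n - 1) \<le> h * x ^ 3 / real (Suc n) ^ 2"
          using ph_bounds_strip(2)[OF a, of 3 n] by (simp add: h_def x_def)
      qed (use h0 x in simp)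
      also have "\<dots> \<le> ((16 * h + 200) * x ^ 3) / real (Suc n) ^ 2"
        using x23 by (intro divide_right_mono) (auto simp: x_def algebra_simps)
      finally show ?thesis by (simp only: mult.assoc times_divide_eq_right mult_1_right)
    qed
    have n1: "of_nat n - 3 * a \<notin> \<int>\<^sub>\<le>\<^sub>0" "of_nat (Suc n) + 3 * a \<noteq> 0" for n
      using nonpos_Ints_ImD[of "of_nat n - 3 * a"] a by (auto simp: complex_eq_iff)
    have t: "wz_periodic_term n a = P * wz_rest n a" for n
      using wz_periodic_term_eq[OF nI(1) n1] by (simp add: P_def)
    have sm: "summable (\<lambda>n. (16 * h + 200) * x ^ 3 * (1 / real (Suc n) ^ 2))"
      by (intro summable_mult summable_inverse_Suc_square)
    have "norm (\<Sum>n. wz_rest n a) \<le> (\<Sum>n. (16 * h + 200) * x ^ 3 * (1 / real (Suc n) ^ 2))"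
      by (rule norm_suminf_le[OF r sm])
    also have "\<dots> = (16 * h + 200) * x ^ 3 * s"
      unfolding s_def by (rule suminf_mult[OF summable_inverse_Suc_square])
    finally have sb: "norm (\<Sum>n. wz_rest n a) \<le> (16 * h + 200) * x ^ 3 * s" .
    have "summable (\<lambda>n. wz_rest n a)"
      by (rule summable_comparison_test'[OF sm r])
    then have "(\<Sum>n. wz_periodic_term n a) = P * (\<Sum>n. wz_rest n a)"
      unfolding t by (rule suminf_mult)
    then have "norm (\<Sum>n. wz_periodic_term n a) \<le> 112 * ((16 * h + 200) * x ^ 3 * s)"
      using P sb by (auto simp: norm_mult intro!: mult_mono)
    then have t1: "norm (\<Sum>n. wz_periodic_term n a) \<le> K1 * x ^ 3" by (simp add: K1_def mult_ac)
    have t2: "norm (3 * P * (Digamma (1 + 2 * a) + euler_mascheroni)) \<le> 2100 * x ^ 3"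
    proof -
      have d2: "norm (Digamma (1 + 2 * a) + euler_mascheroni) \<le> 6 * x"
        using norm_Digamma_Suc_le[of "2 * a"] a(1) by (simp add: x_def norm_mult)
      have "norm P * norm (Digamma (1 + 2 * a) + euler_mascheroni) \<le> 112 * (6 * x)"
        using P d2 by (intro mult_mono) auto
      then show ?thesis using x23 by (simp add: norm_mult)
    qed
    have t3: "norm (of_real pi ^ 3 * cos (of_real pi * (3 * a)) / sin (of_real pi * a) ^ 3) \<le> 2500 * x ^ 3"
    proof -
      define C S where "C = cot (of_real pi * a)" and "S = sin (of_real pi * a)"
      have C: "norm C \<le> 2" unfolding C_def by (rule norm_cot_pi_le[OF a(3)])
      have S: "1 \<le> norm S" unfolding S_def by (rule norm_sin_pi_ge[OF a(3)])
      then have S0: "S \<noteq> 0" by auto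
      have cos: "cos (of_real pi * a) = C * S" using S0 by (simp add: C_def S_def cot_def)
      have "cos (of_real pi * (3 * a)) = 4 * (C * S) ^ 3 - 3 * (C * S)"
        using cos_triple[of "of_real pi * a"] cos by (simp add: mult.left_commute)
      then have "cos (of_real pi * (3 * a)) / S ^ 3 = 4 * C ^ 3 - 3 * C / S ^ 2"
        using S0 by (simp add: field_simps power2_eq_square power3_eq_cube)
      also have "norm \<dots> \<le> 4 * norm C ^ 3 + 3 * norm C / norm S ^ 2"
        using norm_triangle_ineq4[of "4 * C ^ 3" "3 * C / S ^ 2"] by (simp add: norm_mult norm_power norm_divide)
      also have "\<dots> \<le> 4 * 2 ^ 3 + 3 * 2 / 1"
        using C one_le_power[OF S, of 2] by (intro add_mono mult_left_mono power_mono frac_le) auto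
      finally have c: "norm (cos (of_real pi * (3 * a)) / S ^ 3) \<le> 38" by simp
      have "norm (of_real pi ^ 3 :: complex) \<le> 4 ^ 3"
        unfolding norm_power norm_of_real using pi_less_4 pi_ge_zero by (intro power_mono) auto
      then have "norm (of_real pi ^ 3 :: complex) * norm (cos (of_real pi * (3 * a)) / S ^ 3) \<le> 4 ^ 3 * 38"
        using c by (intro mult_mono) auto
      then have "norm (of_real pi ^ 3 * cos (of_real pi * (3 * a)) / S ^ 3) \<le> 2500"
        by (simp add: norm_mult norm_divide)
      then show ?thesis using x23(3) unfolding S_def by linarith
    qed
    have t0: "norm (f10_sum a) \<le> 10000 * exp 192 * s * x ^ 3"
    proof -
      define g where "g = norm (gamma_ratio (a + 1))"
      \<comment> \<open>\<open>gamma_ratio\<close> is bounded at \<open>a\<close> through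
        \<open>ph 3 a 0\<close> and carried to a + 1 by one step of the recurrence; 112 bounds
        \<open>sine_factor\<close>, and 112 / 108 is rounded up to 2.\<close>
      have g: "g \<le> x ^ 3 * (2 * exp 192)"
      proof -
        have "3 * norm (gamma_ratio a) = x ^ 2 * norm P * norm (ph 3 a 0)"
          using arg_cong[OF gamma_ratio_conv_ph[OF nI(2)], of norm] by (simp add: norm_mult norm_power P_def x_def)
        also have "\<dots> \<le> x ^ 3 * 112 * exp 192"
          using P ph_bounds_strip(1)[OF a, of 3 0] x23 x by (intro mult_mono) auto
        finally have "norm (gamma_ratio a) \<le> x ^ 3 * 112 * exp 192 / 3" by simp
        then have "g \<le> x ^ 3 * 112 * exp 192 / 3 / 36"
          using gamma_ratio_step[OF a(1)] by (simp add: g_def)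
        also have "\<dots> = (112 / 108) * (x ^ 3 * exp 192)" by simp
        also have "\<dots> \<le> 2 * (x ^ 3 * exp 192)" using x by (intro mult_right_mono) auto
        finally show ?thesis by (simp add: mult_ac)
      qed
      have f: "norm (f10c (a + of_nat (Suc n))) \<le> 3000 * g * (1 / real (Suc n) ^ 2)" for n
        using f10c_shift_bound[of a n] a by (simp add: g_def)
      have "norm (f10_sum a) \<le> (\<Sum>n. 3000 * g * (1 / real (Suc n) ^ 2))"
        unfolding f10_sum_def by (rule norm_suminf_le[OF f]) (intro summable_mult summable_inverse_Suc_square)
      also have "\<dots> = 3000 * g * s" unfolding s_def by (rule suminf_mult[OF summable_inverse_Suc_square])
      also have "\<dots> \<le> 3000 * (x ^ 3 * (2 * exp 192)) * s"
        using g s0 by (intro mult_right_mono mult_left_mono) auto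
      also have "\<dots> = 6000 * (exp 192 * s * x ^ 3)" by (simp add: mult_ac)
      also have "\<dots> \<le> 10000 * (exp 192 * s * x ^ 3)" using s0 x by (intro mult_right_mono) auto
      finally show ?thesis by (simp add: mult.assoc)
    qed
    have "norm (wz_defect a) \<le> norm (f10_sum a) + 2 * (norm (\<Sum>n. wz_periodic_term n a) +
        norm (3 * P * (Digamma (1 + 2 * a) + euler_mascheroni)) +
        norm (of_real pi ^ 3 * cos (of_real pi * (3 * a)) / sin (of_real pi * a) ^ 3))"
    proof -
      have "norm (A - 2 * (B + C + D)) \<le> norm A + 2 * (norm B + norm C + norm D)" for A B C D :: complex
      proof -
        have "norm (A - 2 * E) \<le> norm A + 2 * norm E" for E
          using norm_triangle_ineq4[of A "2 * E"] by (simp add: norm_mult)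
        from this[of "B + C + D"] show ?thesis
        proof (rule order_trans)
          have "norm (B + C + D) \<le> norm B + norm C + norm D"
            using norm_triangle_ineq[of "B + C" D] norm_triangle_ineq[of B C] by linarith
          then show "norm A + 2 * norm (B + C + D) \<le> norm A + 2 * (norm B + norm C + norm D)"
            by (intro add_left_mono mult_left_mono) auto
        qed
      qed
      then show ?thesis unfolding wz_defect_def P_def .
    qed
    also have "\<dots> \<le> 10000 * exp 192 * s * x ^ 3 + 2 * (K1 * x ^ 3 + 2100 * x ^ 3 + 2500 * x ^ 3)"
      by (intro add_mono mult_left_mono t0 t1 t2 t3) auto
    also have "\<dots> = K0 * x ^ 3" by (simp add: K0_def distrib_right distrib_left)
    also have "\<dots> \<le> K0 * (2 * \<bar>Im a\<bar>) ^ 3"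
      using x K0 by (intro mult_left_mono power_mono) auto
    finally show ?thesis by (simp add: power_mult_distrib mult.assoc)
  qed
  then show ?thesis by (rule that)
qed

section \<open>Taylor coefficients at the origin\<close>

text \<open>For s >= 2 this is the part of zeta(s) with indices greater than j, as a complex number;
  the offset matches the arguments \<open>Suc j\<close> in \<open>ph\<close>.\<close>

definition zeta_tail :: "nat \<Rightarrow> nat \<Rightarrow> complex" where
  "zeta_tail s j = (\<Sum>k. 1 / of_nat (Suc (j + k)) ^ s)"

lemma Polygamma_of_nat_Suc:
  assumes "0 < m"
  shows "Polygamma m (of_nat (Suc j)) / fact m = (- 1) ^ Suc m * zeta_tail (Suc m) j"
  using assms by (simp add: Polygamma_def zeta_tail_def inverse_eq_divide add_ac)

lemma has_fps_expansion_Digamma: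
  fixes c :: complex
  shows "(\<lambda>a. Digamma (of_nat (Suc j) + c * a)) has_fps_expansion
     Abs_fps (\<lambda>m. c ^ m * Polygamma m (of_nat (Suc j)) / fact m)"
proof -
  define S where "S = {w. 0 < Re (of_nat (Suc j) + c * w)}"
  have S: "open S" unfolding S_def by (intro open_Collect_less continuous_intros)
  have T: "open (- \<int>\<^sub>\<le>\<^sub>0 :: complex set)" by (intro open_Compl closed_nonpos_Ints)
  have ST: "c * w + of_nat (Suc j) \<in> - \<int>\<^sub>\<le>\<^sub>0" if "w \<in> S" for w
  proof -
    have "0 < Re (of_nat (Suc j) + c * w)" using that by (simp only: S_def mem_Collect_eq)
    then show ?thesis using nonpos_Ints_ImD[of "c * w + of_nat (Suc j)"] by (auto simp: add_ac)
  qed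
  have hol: "Digamma holomorphic_on (- \<int>\<^sub>\<le>\<^sub>0 :: complex set)" by (rule holomorphic_on_Polygamma) auto
  have 0: "0 \<in> S" by (simp add: S_def)
  have h: "(\<lambda>a. Digamma (c * a + of_nat (Suc j))) holomorphic_on S"
    by (intro holomorphic_on_compose_gen[OF _ hol, unfolded o_def] holomorphic_intros) (use ST in auto)
  have "(\<lambda>a. Digamma (c * a + of_nat (Suc j))) has_fps_expansion
      fps_expansion (\<lambda>a. Digamma (c * a + of_nat (Suc j))) 0"
    by (rule has_fps_expansion_fps_expansion[OF S 0 h])
  also have "fps_expansion (\<lambda>a. Digamma (c * a + of_nat (Suc j))) 0 =
      Abs_fps (\<lambda>m. c ^ m * Polygamma m (of_nat (Suc j)) / fact m)"
  proof (rule fps_ext)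
    fix m
    have "of_nat (Suc j) \<notin> (\<int>\<^sub>\<le>\<^sub>0 :: complex set)" using ST[OF 0] by simp
    then show "fps_nth (fps_expansion (\<lambda>a. Digamma (c * a + of_nat (Suc j))) 0) m =
        fps_nth (Abs_fps (\<lambda>m. c ^ m * Polygamma m (of_nat (Suc j)) / fact m)) m"
      unfolding fps_expansion_def
      using higher_deriv_compose_linear'[OF hol S T 0 ST, of m] by (simp add: higher_deriv_Polygamma)
  qed
  finally show ?thesis by (simp add: add.commute)
qed

lemma fps_expansion_eqI:
  fixes f g :: "complex \<Rightarrow> complex"
  assumes "\<forall>\<^sub>F x in nhds 0. f x = g x" "f has_fps_expansion F" "g has_fps_expansion G"
  shows "F = G"
  using fps_expansion_unique_complex[OF assms(2)] has_fps_expansion_cong[OF assms(1) refl[of G]] assms(3) by simp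

text \<open>The product form makes sense at zeros of \<open>f\<close> as well and turns products
  into sums.\<close>

definition has_log_deriv :: "(complex \<Rightarrow> complex) \<Rightarrow> complex \<Rightarrow> complex \<Rightarrow> bool" where
  "has_log_deriv f l x \<longleftrightarrow> (f has_field_derivative f x * l) (at x)"

lemma has_log_deriv_mult:
  "has_log_deriv f l x \<Longrightarrow> has_log_deriv g m x \<Longrightarrow> has_log_deriv (\<lambda>x. f x * g x) (l + m) x"
  unfolding has_log_deriv_def by (auto intro!: derivative_eq_intros simp: algebra_simps)

lemma has_log_deriv_power: "has_log_deriv f l x \<Longrightarrow> has_log_deriv (\<lambda>x. f x ^ p) (of_nat p * l) x"
proof (induction p)
  case 0
  then show ?case by (simp add: has_log_deriv_def)
next
  case (Suc p)
  from has_log_deriv_mult[OF Suc.prems Suc.IH[OF Suc.prems]]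
  show ?case by (simp add: distrib_right)
qed

text \<open>Each argument is displayed as z + c * a, with c one of 1, -1, p, -p, to match
  \<open>has_fps_expansion_Digamma\<close>.\<close>

lemma ph_log_deriv:
  fixes a :: complex and j p :: nat
  defines "z \<equiv> of_nat (Suc j)"
  assumes "z + a \<notin> \<int>\<^sub>\<le>\<^sub>0" "z - of_nat p * a \<notin> \<int>\<^sub>\<le>\<^sub>0" "z - a \<notin> \<int>\<^sub>\<le>\<^sub>0" "z + of_nat p * a \<notin> \<int>\<^sub>\<le>\<^sub>0"
  shows "has_log_deriv (\<lambda>a. ph p a j) (of_nat p * Digamma (z + 1 * a) - of_nat p * Digamma (z + (- of_nat p) * a) +
     of_nat p * Digamma (z + (- 1) * a) - of_nat p * Digamma (z + of_nat p * a)) a"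
proof -
  have 1: "has_log_deriv (\<lambda>a. Gamma (z + a)) (Digamma (z + a)) a"
    unfolding has_log_deriv_def using assms(2) by (auto intro!: derivative_eq_intros)
  have 2: "has_log_deriv (\<lambda>a. Gamma (z - of_nat p * a)) (- (of_nat p * Digamma (z - of_nat p * a))) a"
    unfolding has_log_deriv_def using assms(3) by (auto intro!: derivative_eq_intros)
  have rG: "(rGamma has_field_derivative - rGamma w * Digamma w) (at w)" if "w \<notin> \<int>\<^sub>\<le>\<^sub>0" for w :: complex
    using has_field_derivative_rGamma[of w UNIV] that by simp
  have d3: "((\<lambda>a. z - a) has_field_derivative - 1) (at a)"
    and d4: "((\<lambda>a. z + of_nat p * a) has_field_derivative of_nat p) (at a)"
    by (auto intro!: derivative_eq_intros)
  have 3: "has_log_deriv (\<lambda>a. rGamma (z - a)) (Digamma (z - a)) a"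
    unfolding has_log_deriv_def
    using DERIV_chain2[where f = rGamma and g = "\<lambda>a. z - a" and x = a and s = UNIV, OF rG[OF assms(4)] d3] by simp
  have 4: "has_log_deriv (\<lambda>a. rGamma (z + of_nat p * a)) (- (of_nat p * Digamma (z + of_nat p * a))) a"
    unfolding has_log_deriv_def
    using DERIV_chain2[where f = rGamma and g = "\<lambda>a. z + of_nat p * a" and x = a and s = UNIV, OF rG[OF assms(5)] d4]
    by (simp add: mult_ac)
  have "has_log_deriv (\<lambda>a. ph p a j) (of_nat p * Digamma (z + a) + - (of_nat p * Digamma (z - of_nat p * a)) +
     of_nat p * Digamma (z - a) + - (of_nat p * Digamma (z + of_nat p * a))) a"
    unfolding ph_def z_def [symmetric]
    by (intro has_log_deriv_mult has_log_deriv_power 1 2 3 4)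
  then show ?thesis by simp
qed

definition ph_fps :: "nat \<Rightarrow> nat \<Rightarrow> complex fps" where
  "ph_fps p j = fps_expansion (\<lambda>a. ph p a j) 0"

lemma ph_args_small:
  fixes a :: complex
  assumes "norm a < 1 / 3" "p \<le> 3"
  shows "of_nat (Suc j) + of_nat p * a \<notin> \<int>\<^sub>\<le>\<^sub>0" "of_nat (Suc j) - of_nat p * a \<notin> \<int>\<^sub>\<le>\<^sub>0"
proof -
  have "norm (of_nat p * a) \<le> 3 * norm a"
    unfolding norm_mult using assms(2) by (intro mult_right_mono) auto
  then have "norm (of_nat p * a) < 1" using assms(1) by simp
  then have "\<bar>Re (of_nat p * a)\<bar> < 1" using abs_Re_le_cmod[of "of_nat p * a"] by linarith
  then have "0 < Re (of_nat (Suc j) + of_nat p * a)" "0 < Re (of_nat (Suc j) - of_nat p * a)"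
    by (auto simp: abs_less_iff)
  then show "of_nat (Suc j) + of_nat p * a \<notin> \<int>\<^sub>\<le>\<^sub>0" "of_nat (Suc j) - of_nat p * a \<notin> \<int>\<^sub>\<le>\<^sub>0"
    using nonpos_Ints_ImD[of "of_nat (Suc j) + of_nat p * a"] nonpos_Ints_ImD[of "of_nat (Suc j) - of_nat p * a"] by linarith+
qed

lemma ph_holomorphic_small:
  assumes "p \<le> 3"
  shows "(\<lambda>a. ph p a j) holomorphic_on ball 0 (1 / 3)"
proof -
  have "of_nat (Suc j) + of_nat p * z \<notin> \<int>\<^sub>\<le>\<^sub>0" "of_nat (Suc j) - of_nat p * z \<notin> \<int>\<^sub>\<le>\<^sub>0" "of_nat (Suc j) + z \<notin> \<int>\<^sub>\<le>\<^sub>0"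
    if "z \<in> ball (0 :: complex) (1 / 3)" for z
    using ph_args_small[OF _ assms, of z j] ph_args_small(1)[of z 1 j] that
    by (simp_all del: of_nat_Suc One_nat_def)
  then show ?thesis
    unfolding ph_def by (intro holomorphic_intros)
qed

lemma has_fps_expansion_ph: "p \<le> 3 \<Longrightarrow> (\<lambda>a. ph p a j) has_fps_expansion ph_fps p j"
  unfolding ph_fps_def
  by (rule has_fps_expansion_fps_expansion[OF open_ball _ ph_holomorphic_small]) auto

lemma ph_at_0: "ph p 0 j = 1"
proof -
  have "Gamma (of_nat (Suc j) :: complex) * rGamma (of_nat (Suc j)) = 1"
    using ph_args_small(1)[of 0 0 j] by (simp add: Gamma_def rGamma_eq_zero_iff del: of_nat_Suc)
  then show ?thesis
    unfolding ph_def by (simp add: power_mult_distrib [symmetric] mult_ac del: of_nat_Suc)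
qed

text \<open>In order m the four Digamma expansions combine to the factor 1 + (-1)^m - p^m - (-p)^m,
  which is 0 for m = 0 and for odd m. Hence only tails of odd zeta values occur.\<close>

lemma ph_fps_deriv:
  assumes p: "p \<le> 3"
  shows "fps_deriv (ph_fps p j) = ph_fps p j *
     Abs_fps (\<lambda>m. if even m \<and> 0 < m then 2 * (of_nat p ^ Suc m - of_nat p) * zeta_tail (Suc m) j else 0)"
proof -
  define D where "D = (\<lambda>c. Abs_fps (\<lambda>m. c ^ m * Polygamma m (of_nat (Suc j)) / fact m) :: complex fps)"
  define P where "P = fps_const (of_nat p :: complex)"
  define L where "L = P * D 1 - P * D (- of_nat p) + P * D (- 1) - P * D (of_nat p)"
  have Lexp: "(\<lambda>a. of_nat p * Digamma (of_nat (Suc j) + 1 * a) - of_nat p * Digamma (of_nat (Suc j) + (- of_nat p) * a) +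
     of_nat p * Digamma (of_nat (Suc j) + (- 1) * a) - of_nat p * Digamma (of_nat (Suc j) + of_nat p * a)) has_fps_expansion L"
    unfolding L_def D_def P_def by (intro fps_expansion_intros has_fps_expansion_Digamma)
  have "\<forall>\<^sub>F a in nhds 0. a \<in> ball (0 :: complex) (1 / 3)" by (intro eventually_nhds_in_open) auto
  then have "\<forall>\<^sub>F a in nhds 0. deriv (\<lambda>a. ph p a j) a = ph p a j *
     (of_nat p * Digamma (of_nat (Suc j) + 1 * a) - of_nat p * Digamma (of_nat (Suc j) + (- of_nat p) * a) +
     of_nat p * Digamma (of_nat (Suc j) + (- 1) * a) - of_nat p * Digamma (of_nat (Suc j) + of_nat p * a))"
  proof eventually_elim
    case (elim a)
    then have a: "norm a < 1 / 3" by simp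
    show ?case
      by (rule DERIV_imp_deriv, rule ph_log_deriv[unfolded has_log_deriv_def])
         (use ph_args_small[OF a p] ph_args_small[OF a, of 1] in \<open>simp_all del: of_nat_Suc One_nat_def\<close>)
  qed
  moreover have "deriv (\<lambda>a. ph p a j) has_fps_expansion fps_deriv (ph_fps p j)"
    by (intro has_fps_expansion_deriv has_fps_expansion_ph p)
  moreover have "(\<lambda>a. ph p a j * (of_nat p * Digamma (of_nat (Suc j) + 1 * a) - of_nat p * Digamma (of_nat (Suc j) + (- of_nat p) * a) +
     of_nat p * Digamma (of_nat (Suc j) + (- 1) * a) - of_nat p * Digamma (of_nat (Suc j) + of_nat p * a))) has_fps_expansion ph_fps p j * L"
    by (intro has_fps_expansion_mult has_fps_expansion_ph p Lexp)
  ultimately have "fps_deriv (ph_fps p j) = ph_fps p j * L"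
    by (rule fps_expansion_eqI)
  also have "L = Abs_fps (\<lambda>m. if even m \<and> 0 < m then 2 * (of_nat p ^ Suc m - of_nat p) * zeta_tail (Suc m) j else 0)"
  proof (rule fps_ext)
    fix m
    have "fps_nth L m = of_nat p * (1 - (- of_nat p) ^ m + (- 1) ^ m - of_nat p ^ m) * (Polygamma m (of_nat (Suc j)) / fact m)"
      by (simp add: L_def P_def D_def algebra_simps diff_divide_distrib add_divide_distrib)
    also have "\<dots> = (if even m \<and> 0 < m then 2 * (of_nat p ^ Suc m - of_nat p) * zeta_tail (Suc m) j else 0)"
    proof (cases "even m \<and> 0 < m")
      case True
      then show ?thesis unfolding Polygamma_of_nat_Suc[OF conjunct2[OF True]] by (simp add: algebra_simps)
    next
      case False
      then have "m = 0 \<or> odd m" by auto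
      then show ?thesis by (auto simp: power_minus_odd)
    qed
    finally show "fps_nth L m = fps_nth (Abs_fps (\<lambda>m. if even m \<and> 0 < m then 2 * (of_nat p ^ Suc m - of_nat p) * zeta_tail (Suc m) j else 0)) m"
      by simp
  qed
  finally show ?thesis .
qed

text \<open>Coefficients of the exponential of an odd power series without linear term, read off from its logarithmic derivative \<open>G\<close>.\<close>

lemma fps_log_deriv_coeffs:
  fixes F G :: "complex fps"
  assumes d: "fps_deriv F = F * G" and F0: "fps_nth F 0 = 1"
    and G: "fps_nth G 0 = 0" "\<And>m. odd m \<Longrightarrow> fps_nth G m = 0"
  shows "fps_nth F 1 = 0" "fps_nth F 2 = 0" "fps_nth F 3 = fps_nth G 2 / 3" "fps_nth F 4 = 0"
    "fps_nth F 5 = fps_nth G 4 / 5" "fps_nth F 6 = fps_nth G 2 ^ 2 / 18" "fps_nth F 7 = fps_nth G 6 / 7"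
    "fps_nth F 8 = fps_nth G 2 * fps_nth G 4 / 15" "fps_nth F 9 = (fps_nth G 8 + fps_nth G 2 ^ 3 / 18) / 9"
proof -
  have r: "of_nat (Suc n) * fps_nth F (Suc n) = (\<Sum>i=0..n. fps_nth F i * fps_nth G (n - i))" for n
    using arg_cong[OF d, of "\<lambda>H. fps_nth H n"] by (simp add: fps_mult_nth)
  have o: "fps_nth G 1 = 0" "fps_nth G 3 = 0" "fps_nth G 5 = 0" "fps_nth G 7 = 0"
    by (rule G(2); simp)+
  show 1: "fps_nth F 1 = 0" using r[of 0] G(1) by simp
  show 2: "fps_nth F 2 = 0" using r[of 1] G(1) o 1 by (simp add: numeral_2_eq_2)
  have solve: "x = y / c" if "c * x = y" "c \<noteq> 0" for x y c :: complex
    using that by auto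
  have "3 * fps_nth F 3 = fps_nth G 2"
    using r[of 2] G(1) o 1 2 F0 by (simp add: sum.atLeast0_atMost_Suc eval_nat_numeral)
  then show 3: "fps_nth F 3 = fps_nth G 2 / 3" by (rule solve) simp
  show 4: "fps_nth F 4 = 0"
    using r[of 3] G(1) o 1 2 F0 by (simp add: sum.atLeast0_atMost_Suc eval_nat_numeral)
  have "5 * fps_nth F 5 = fps_nth G 4"
    using r[of 4] G(1) o 1 2 4 F0 by (simp add: sum.atLeast0_atMost_Suc eval_nat_numeral)
  then show 5: "fps_nth F 5 = fps_nth G 4 / 5" by (rule solve) simp
  have "6 * fps_nth F 6 = fps_nth F 3 * fps_nth G 2"
    using r[of 5] G(1) o 1 2 4 F0 by (simp add: sum.atLeast0_atMost_Suc eval_nat_numeral)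
  from solve[OF this] show 6: "fps_nth F 6 = fps_nth G 2 ^ 2 / 18" by (simp add: 3 power2_eq_square)
  have "7 * fps_nth F 7 = fps_nth G 6"
    using r[of 6] G(1) o 1 2 4 F0 by (simp add: sum.atLeast0_atMost_Suc eval_nat_numeral)
  then show 7: "fps_nth F 7 = fps_nth G 6 / 7" by (rule solve) simp
  have "8 * fps_nth F 8 = fps_nth F 3 * fps_nth G 4 + fps_nth F 5 * fps_nth G 2"
    using r[of 7] G(1) o 1 2 4 F0 by (simp add: sum.atLeast0_atMost_Suc eval_nat_numeral)
  from solve[OF this] show 8: "fps_nth F 8 = fps_nth G 2 * fps_nth G 4 / 15" by (simp add: 3 5 field_simps)
  have "9 * fps_nth F 9 = fps_nth G 8 + fps_nth F 6 * fps_nth G 2"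
    using r[of 8] G(1) o 1 2 4 F0 by (simp add: sum.atLeast0_atMost_Suc eval_nat_numeral)
  from solve[OF this] show 9: "fps_nth F 9 = (fps_nth G 8 + fps_nth G 2 ^ 3 / 18) / 9"
    by (simp add: 6 power2_eq_square power3_eq_cube)
qed

lemma ph_fps_0: "p \<le> 3 \<Longrightarrow> fps_nth (ph_fps p j) 0 = 1"
  using fps_nth_fps_expansion[OF has_fps_expansion_ph, of p j 0] by (simp add: ph_at_0)

lemma ph_fps_nth_2:
  "fps_nth (ph_fps 2 j) 1 = 0" "fps_nth (ph_fps 2 j) 2 = 0" "fps_nth (ph_fps 2 j) 3 = 4 * zeta_tail 3 j"
  "fps_nth (ph_fps 2 j) 4 = 0" "fps_nth (ph_fps 2 j) 5 = 12 * zeta_tail 5 j"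
  "fps_nth (ph_fps 2 j) 6 = 8 * zeta_tail 3 j ^ 2" "fps_nth (ph_fps 2 j) 7 = 36 * zeta_tail 7 j"
  "fps_nth (ph_fps 2 j) 8 = 48 * zeta_tail 3 j * zeta_tail 5 j"
  "fps_nth (ph_fps 2 j) 9 = 340 / 3 * zeta_tail 9 j + 32 / 3 * zeta_tail 3 j ^ 3"
proof -
  have "x = 340 / 3 * u + 32 / 3 * w" if "x = (1020 * u + 96 * w) / 9" for x u w :: complex
    using that by (simp add: add_divide_distrib)
  note r = this fps_log_deriv_coeffs[OF ph_fps_deriv[of 2 j] ph_fps_0]
  show "fps_nth (ph_fps 2 j) 9 = 340 / 3 * zeta_tail 9 j + 32 / 3 * zeta_tail 3 j ^ 3"
    by (rule r(1), subst r(10)) (simp_all add: power_mult_distrib)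
qed (use fps_log_deriv_coeffs[OF ph_fps_deriv[of 2 j] ph_fps_0] in \<open>simp_all add: power_mult_distrib\<close>)

lemma ph_fps_nth_3:
  "fps_nth (ph_fps 3 j) 1 = 0" "fps_nth (ph_fps 3 j) 2 = 0" "fps_nth (ph_fps 3 j) 3 = 16 * zeta_tail 3 j"
  "fps_nth (ph_fps 3 j) 4 = 0" "fps_nth (ph_fps 3 j) 5 = 96 * zeta_tail 5 j"
  "fps_nth (ph_fps 3 j) 6 = 128 * zeta_tail 3 j ^ 2" "fps_nth (ph_fps 3 j) 7 = 624 * zeta_tail 7 j"
  "fps_nth (ph_fps 3 j) 8 = 1536 * zeta_tail 3 j * zeta_tail 5 j"
  "fps_nth (ph_fps 3 j) 9 = 13120 / 3 * zeta_tail 9 j + 2048 / 3 * zeta_tail 3 j ^ 3"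
proof -
  have "x = 13120 / 3 * u + 2048 / 3 * w" if "x = (39360 * u + 6144 * w) / 9" for x u w :: complex
    using that by (simp add: add_divide_distrib)
  note r = this fps_log_deriv_coeffs[OF ph_fps_deriv[of 3 j] ph_fps_0]
  show "fps_nth (ph_fps 3 j) 9 = 13120 / 3 * zeta_tail 9 j + 2048 / 3 * zeta_tail 3 j ^ 3"
    by (rule r(1), subst r(10)) (simp_all add: power_mult_distrib)
qed (use fps_log_deriv_coeffs[OF ph_fps_deriv[of 3 j] ph_fps_0] in \<open>simp_all add: power_mult_distrib\<close>)

definition digamma_fps :: "complex \<Rightarrow> complex fps" where
  "digamma_fps c = Abs_fps (\<lambda>m. if m = 0 then 0 else (- 1) ^ Suc m * c ^ m * zeta_tail (Suc m) 0)"

lemma has_fps_expansion_Digamma_1: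
  "(\<lambda>a. Digamma (1 + c * a) + euler_mascheroni) has_fps_expansion digamma_fps c"
proof -
  have "(\<lambda>a. Digamma (of_nat (Suc 0) + c * a) + euler_mascheroni) has_fps_expansion
      Abs_fps (\<lambda>m. c ^ m * Polygamma m (of_nat (Suc 0)) / fact m) + fps_const euler_mascheroni"
    by (intro fps_expansion_intros has_fps_expansion_Digamma)
  also have "Abs_fps (\<lambda>m. c ^ m * Polygamma m (of_nat (Suc 0)) / fact m) + fps_const euler_mascheroni = digamma_fps c"
  proof (rule fps_ext)
    fix m
    have "c ^ m * Polygamma m (of_nat (Suc 0)) / fact m = c ^ m * ((- 1) ^ Suc m * zeta_tail (Suc m) 0)" if "0 < m"
      unfolding Polygamma_of_nat_Suc[OF that, of 0, symmetric] by simp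
    then show "fps_nth (Abs_fps (\<lambda>m. c ^ m * Polygamma m (of_nat (Suc 0)) / fact m) + fps_const euler_mascheroni) m =
        fps_nth (digamma_fps c) m"
      by (cases "m = 0") (auto simp: digamma_fps_def)
  qed
  finally show ?thesis by simp
qed

text \<open>1/6 is the largest radius for which \<open>ph_bounds_local\<close> applies with
  \<open>J = 0\<close>. As 512 / 216 < 3 and exp 3 <= 27, the constant comes out as 64, rounded up
  to 100.\<close>

lemma ph_minus_1_small:
  assumes "norm a \<le> 1 / 6" and p: "p = 2 \<or> p = 3"
  shows "norm (ph p a j - 1) \<le> 100 / real (Suc j) ^ 2"
proof -
  have e: "exp (512 * (1 / 6) ^ 3 :: real) \<le> 27"
  proof -
    have "exp (512 * (1 / 6) ^ 3 :: real) \<le> exp 3" by (simp add: power3_eq_cube)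
    also have "\<dots> = exp 1 ^ 3" by (simp flip: exp_of_nat_mult)
    also have "\<dots> \<le> 3 ^ 3" by (intro power_mono exp_le) auto
    finally show ?thesis by simp
  qed
  have "norm (ph p a j - 1) \<le> 512 * exp (512 * (1 / 6) ^ 3) * (1 / 6) ^ 3 / real (Suc j) ^ 2"
    by (rule ph_bounds_local(2)[of a "1/6" 0]) (use assms in auto)
  also have "\<dots> \<le> 512 * 27 * (1 / 6) ^ 3 / real (Suc j) ^ 2"
    using e by (intro divide_right_mono mult_right_mono mult_left_mono) auto
  also have "\<dots> \<le> 100 / real (Suc j) ^ 2"
    by (intro divide_right_mono) (auto simp: power3_eq_cube)
  finally show ?thesis .
qed

text \<open>Up to a telescoping term, \<open>a\<close> times this is \<open>a\<close> times
  \<open>dixon_rest\<close>; here \<open>a\<close> occurs only inside \<open>ph\<close>, so the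
  Taylor coefficients are immediate.\<close>

definition dixon_sym :: "nat \<Rightarrow> complex \<Rightarrow> complex" where
  "dixon_sym n a = (ph 2 a (Suc n) + ph 2 a n - 2) / of_nat (Suc n)"

lemma dixon_sym_bound:
  assumes "norm a \<le> 1 / 6"
  shows "norm (dixon_sym n a) \<le> 200 / real (Suc n) ^ 2"
proof -
  have "norm (dixon_sym n a) = norm ((ph 2 a (Suc n) - 1) + (ph 2 a n - 1)) / real (Suc n)"
    unfolding dixon_sym_def norm_divide norm_of_nat by (simp add: algebra_simps)
  also have "\<dots> \<le> (norm (ph 2 a (Suc n) - 1) + norm (ph 2 a n - 1)) / 1"
    by (intro frac_le norm_triangle_ineq) auto
  also have "\<dots> \<le> 100 / real (Suc (Suc n)) ^ 2 + 100 / real (Suc n) ^ 2"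
    using ph_minus_1_small[OF assms, of 2] by (simp add: add_mono del: of_nat_Suc)
  also have "100 / real (Suc (Suc n)) ^ 2 \<le> 100 / real (Suc n) ^ 2"
    by (intro divide_left_mono power_mono mult_pos_pos) auto
  finally show ?thesis by simp
qed

lemma dixon_sym_suminf:
  assumes a: "norm a < 1 / 6"
  shows "a * (\<Sum>n. dixon_sym n a) = 3 / 2 * (1 - ph 2 a 0) -
     a * (2 * (Digamma (1 + a) + euler_mascheroni) + (Digamma (1 - 2 * a) + euler_mascheroni))"
proof (cases "a = 0")
  case True
  then show ?thesis by (simp add: ph_at_0)
next
  case False
  have sm: "summable (\<lambda>n. dixon_sym n a)"
    by (rule summable_comparison_test'[OF summable_inverse_Suc_square dixon_sym_bound]) (use a in simp)
  \<comment> \<open>With \<open>m\<close> the common quotient, the two values of \<open>ph\<close>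
    are m (j^3 - 3 a^2 j - 2 a^3) and m (j^3 - 3 a^2 j + 2 a^3). Their sum is 2 j^3 m - 6 a^2 j m,
    and the unwanted second part is recovered from their difference - 4 a^3 m.\<close>
  have rel: "a * dixon_rest n a = a * dixon_sym n a - 3 / 2 * (ph 2 a (Suc n) - ph 2 a n)" for n
  proof -
    define j :: complex where "j = of_nat (Suc n)"
    have j0: "j \<noteq> 0" unfolding j_def by (simp del: of_nat_Suc)
    have na: "j + a \<notin> \<int>\<^sub>\<le>\<^sub>0" "j - 2 * a \<notin> \<int>\<^sub>\<le>\<^sub>0"
      using ph_args_small(1)[of a 1 n] ph_args_small(2)[of a 2 n] a unfolding j_def by (simp_all del: of_nat_Suc One_nat_def)
    then have nz: "j + a \<noteq> 0" "j - 2 * a \<noteq> 0" by auto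
    define m where "m = ph 2 a (Suc n) / ((j + a) ^ 2 * (j - 2 * a))"
    have p1: "ph 2 a (Suc n) = m * ((j + a) ^ 2 * (j - 2 * a))" using nz by (simp add: m_def)
    have "ph 2 a n = ph 2 a (Suc n) * qf 2 a (Suc n)"
      using ph_step[of "Suc n" a 2] na unfolding j_def by (simp del: of_nat_Suc)
    also have "\<dots> = m * ((j - a) ^ 2 * (j + 2 * a))"
      unfolding p1 qf_def j_def [symmetric] using nz by (simp del: of_nat_Suc)
    finally have p0: "ph 2 a n = m * ((j - a) ^ 2 * (j + 2 * a))" .
    have "a * dixon_rest n a = a * (2 * j ^ 2 * m - 2 / j)"
      unfolding dixon_rest_def m_def j_def by simp
    also have "2 * j ^ 2 * m - 2 / j = (2 * j ^ 3 * m - 2) / j"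
      using j0 by (simp add: field_simps power2_eq_square power3_eq_cube)
    also have "a * ((2 * j ^ 3 * m - 2) / j) = a * ((ph 2 a (Suc n) + ph 2 a n - 2) / j) - 3 / 2 * (ph 2 a (Suc n) - ph 2 a n)"
    proof -
      have e1: "ph 2 a (Suc n) + ph 2 a n - 2 = (2 * j ^ 3 * m - 2) - 6 * a ^ 2 * m * j"
        unfolding p1 p0 by algebra
      have e2: "ph 2 a (Suc n) - ph 2 a n = - (4 * a ^ 3 * m)"
        unfolding p1 p0 by algebra
      have "((2 * j ^ 3 * m - 2) - 6 * a ^ 2 * m * j) / j = (2 * j ^ 3 * m - 2) / j - 6 * a ^ 2 * m"
        using j0 by (simp add: diff_divide_distrib)
      have "a * A = a * (A - 6 * a ^ 2 * m) - 3 / 2 * - (4 * a ^ 3 * m)" for A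
        by (simp add: algebra_simps power2_eq_square power3_eq_cube)
      then show ?thesis unfolding e1 e2 \<open>_ = (2 * j ^ 3 * m - 2) / j - 6 * a ^ 2 * m\<close> .
    qed
    finally show ?thesis by (simp add: dixon_sym_def j_def)
  qed
  have "(\<lambda>n. ph 2 a (Suc n) - ph 2 a n) sums (1 - ph 2 a 0)"
    by (rule telescope_sums[OF ph_lim])
  then have "(\<lambda>n. a * dixon_sym n a - 3 / 2 * (ph 2 a (Suc n) - ph 2 a n)) sums
      (a * (\<Sum>n. dixon_sym n a) - 3 / 2 * (1 - ph 2 a 0))"
    by (rule sums_diff[OF sums_mult[OF summable_sums[OF sm]] sums_mult])
  then have "(\<lambda>n. a * dixon_rest n a) sums (a * (\<Sum>n. dixon_sym n a) - 3 / 2 * (1 - ph 2 a 0))"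
    unfolding rel .
  moreover have "(\<lambda>n. a * dixon_rest n a) sums (a * - (2 * Digamma (1 + a) + Digamma (1 - 2 * a) + 3 * euler_mascheroni))"
  proof -
    have "6 * norm a \<le> 1" using a by simp
    then have "summable (\<lambda>n. dixon_rest n a)"
      by (intro summable_comparison_test'[OF summable_inverse_Suc_square dixon_rest_small])
    then show ?thesis
      unfolding dixon_log_sum[OF \<open>6 * norm a \<le> 1\<close> False, symmetric] by (intro sums_mult summable_sums)
  qed
  ultimately have "a * (\<Sum>n. dixon_sym n a) - 3 / 2 * (1 - ph 2 a 0) =
      a * - (2 * Digamma (1 + a) + Digamma (1 - 2 * a) + 3 * euler_mascheroni)"
    by (rule sums_unique2)
  then show ?thesis by (simp add: algebra_simps)
qed

text \<open>These are the coefficients of orders 3, 5, 6, 7 and 8 in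
  \<open>dixon_sym_suminf\<close>; the values come from \<open>ph\<close> at j = 0 and the Digamma
  expansions. The weight 1 / (n + 1), unlike higher powers, is not a difference of zeta
  tails.\<close>

lemma dixon_coeffs:
  defines "z \<equiv> \<lambda>s. zeta_tail s 0"
  shows "(\<lambda>n. (zeta_tail 3 (Suc n) + zeta_tail 3 n) / of_nat (Suc n)) sums (3 / 2 * z 4)"
    and "(\<lambda>n. (zeta_tail 5 (Suc n) + zeta_tail 5 n) / of_nat (Suc n)) sums (5 / 2 * z 6 - z 3 ^ 2)"
    and "(\<lambda>n. (zeta_tail 3 (Suc n) ^ 2 + zeta_tail 3 n ^ 2) / of_nat (Suc n)) sums (3 / 2 * z 7)"
    and "(\<lambda>n. (zeta_tail 7 (Suc n) + zeta_tail 7 n) / of_nat (Suc n)) sums (7 / 2 * z 8 - 2 * z 3 * z 5)"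
    and "(\<lambda>n. (zeta_tail 3 (Suc n) * zeta_tail 5 (Suc n) + zeta_tail 3 n * zeta_tail 5 n) / of_nat (Suc n)) sums
      (11 / 6 * z 9 - z 3 ^ 3 / 3)"
proof -
  define F where "F = (\<lambda>n. fps_const (1 / of_nat (Suc n)) * (ph_fps 2 (Suc n) + ph_fps 2 n - fps_const 2))"
  have Fe: "dixon_sym n has_fps_expansion F n" for n
  proof -
    have "(\<lambda>a. 1 / of_nat (Suc n) * (ph 2 a (Suc n) + ph 2 a n - 2)) has_fps_expansion F n"
      unfolding F_def by (intro fps_expansion_intros has_fps_expansion_ph) auto
    then show ?thesis by (simp add: dixon_sym_def [abs_def])
  qed
  have hol: "dixon_sym n holomorphic_on ball 0 (1 / 6)" for n
    unfolding dixon_sym_def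
    by (intro holomorphic_intros holomorphic_on_subset[OF ph_holomorphic_small]) (auto simp del: of_nat_Suc)
  have sm: "summable (\<lambda>n. 200 / real (Suc n) ^ 2)" by (rule summable_inverse_Suc_square)
  have bd: "norm (dixon_sym n a) \<le> 200 / real (Suc n) ^ 2" if "a \<in> ball 0 (1 / 6)" for n a
    by (rule dixon_sym_bound) (use that in simp)
  note S = has_fps_expansion_suminf[OF _ hol bd sm Fe]
  define G where "G = Abs_fps (\<lambda>m. \<Sum>n. fps_nth (F n) m)"
  have G: "(\<lambda>a. \<Sum>n. dixon_sym n a) has_fps_expansion G" unfolding G_def by (rule S(1)) auto
  have 1: "(\<lambda>a. a * (\<Sum>n. dixon_sym n a)) has_fps_expansion fps_X * G"
    by (intro fps_expansion_intros G)
  have 2: "(\<lambda>a. 3 / 2 * (1 - ph 2 a 0) - a * (2 * (Digamma (1 + 1 * a) + euler_mascheroni) + (Digamma (1 + (- 2) * a) + euler_mascheroni)))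
     has_fps_expansion fps_const (3 / 2) * (1 - ph_fps 2 0) - fps_X * (fps_const 2 * digamma_fps 1 + digamma_fps (- 2))"
    by (intro fps_expansion_intros has_fps_expansion_Digamma_1 has_fps_expansion_ph) auto
  have "\<forall>\<^sub>F a in nhds 0. a \<in> ball (0 :: complex) (1 / 6)" by (intro eventually_nhds_in_open) auto
  then have "\<forall>\<^sub>F a in nhds 0. a * (\<Sum>n. dixon_sym n a) = 3 / 2 * (1 - ph 2 a 0) -
      a * (2 * (Digamma (1 + 1 * a) + euler_mascheroni) + (Digamma (1 + (- 2) * a) + euler_mascheroni))"
    by eventually_elim (use dixon_sym_suminf in simp)
  then have "fps_X * G = fps_const (3 / 2) * (1 - ph_fps 2 0) - fps_X * (fps_const 2 * digamma_fps 1 + digamma_fps (- 2))"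
    using 1 2 by (rule fps_expansion_eqI)
  from arg_cong[OF this, of "\<lambda>H. fps_nth H (Suc m)" for m]
  have Gm: "fps_nth G m = - (3 / 2) * fps_nth (ph_fps 2 0) (Suc m) - (2 * fps_nth (digamma_fps 1) m + fps_nth (digamma_fps (- 2)) m)" for m
    by simp
  have sums: "(\<lambda>n. fps_nth (F n) m) sums fps_nth G m" for m
    unfolding G_def using summable_sums[OF S(2), of m] by simp
  have Fm: "fps_nth (F n) m = (fps_nth (ph_fps 2 (Suc n)) m + fps_nth (ph_fps 2 n) m) / of_nat (Suc n)" if "0 < m" for n m
    using that by (simp add: F_def del: of_nat_Suc)
  have key: "(\<lambda>n. X n) sums A" if "\<And>n. fps_nth (F n) m = k * X n" "fps_nth G m = k * A" "k \<noteq> 0" for X k A m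
    using sums_divide[OF sums[of m], of k] that by simp
  have c3: "fps_nth G 3 = 4 * (3 / 2 * z 4)" and c5: "fps_nth G 5 = 12 * (5 / 2 * z 6 - z 3 ^ 2)"
    and c6: "fps_nth G 6 = 8 * (3 / 2 * z 7)" and c7: "fps_nth G 7 = 36 * (7 / 2 * z 8 - 2 * z 3 * z 5)"
    and c8: "fps_nth G 8 = 48 * (11 / 6 * z 9 - z 3 ^ 3 / 3)"
    unfolding Gm by (simp_all add: ph_fps_nth_2 digamma_fps_def z_def add_divide_distrib diff_divide_distrib)
  have f: "fps_nth (F n) 3 = 4 * ((zeta_tail 3 (Suc n) + zeta_tail 3 n) / of_nat (Suc n))"
    "fps_nth (F n) 5 = 12 * ((zeta_tail 5 (Suc n) + zeta_tail 5 n) / of_nat (Suc n))"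
    "fps_nth (F n) 6 = 8 * ((zeta_tail 3 (Suc n) ^ 2 + zeta_tail 3 n ^ 2) / of_nat (Suc n))"
    "fps_nth (F n) 7 = 36 * ((zeta_tail 7 (Suc n) + zeta_tail 7 n) / of_nat (Suc n))"
    "fps_nth (F n) 8 = 48 * ((zeta_tail 3 (Suc n) * zeta_tail 5 (Suc n) + zeta_tail 3 n * zeta_tail 5 n) / of_nat (Suc n))" for n
    by (simp_all add: Fm ph_fps_nth_2 algebra_simps del: of_nat_Suc)
  show "(\<lambda>n. (zeta_tail 3 (Suc n) + zeta_tail 3 n) / of_nat (Suc n)) sums (3 / 2 * z 4)"
    by (rule key[OF f(1) c3]) simp
  show "(\<lambda>n. (zeta_tail 5 (Suc n) + zeta_tail 5 n) / of_nat (Suc n)) sums (5 / 2 * z 6 - z 3 ^ 2)"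
    by (rule key[OF f(2) c5]) simp
  show "(\<lambda>n. (zeta_tail 3 (Suc n) ^ 2 + zeta_tail 3 n ^ 2) / of_nat (Suc n)) sums (3 / 2 * z 7)"
    by (rule key[OF f(3) c6]) simp
  show "(\<lambda>n. (zeta_tail 7 (Suc n) + zeta_tail 7 n) / of_nat (Suc n)) sums (7 / 2 * z 8 - 2 * z 3 * z 5)"
    by (rule key[OF f(4) c7]) simp
  show "(\<lambda>n. (zeta_tail 3 (Suc n) * zeta_tail 5 (Suc n) + zeta_tail 3 n * zeta_tail 5 n) / of_nat (Suc n)) sums
      (11 / 6 * z 9 - z 3 ^ 3 / 3)"
    by (rule key[OF f(5) c8]) simp
qed

section \<open>Taylor expansion of the shifted series\<close>

text \<open>Partial fractions split (2 n + 1) / ((n - 3 a) (n + 1 + 3 a)) in \<open>wz_rest\<close>,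
  and the first part is shifted by one index, so that all zeros of the denominators have modulus at
  least 1/3. The detached term with denominator - 3 a moves into \<open>log_part\<close>.\<close>

definition log_sum_term :: "nat \<Rightarrow> complex \<Rightarrow> complex" where
  "log_sum_term n a = (ph 3 a (Suc n) - 1) / (of_nat (Suc n) - 3 * a) + (ph 3 a n - 1) / (of_nat (Suc n) + 3 * a)"

text \<open>This is \<open>a\<close> times the factor that multiplies
  \<open>2 * sine_factor a\<close> in \<open>f10_sum a - wz_defect a\<close>, after the terms pi
  cot(3 pi a) have cancelled.\<close>

definition log_part :: "complex \<Rightarrow> complex" where
  "log_part a = a * (\<Sum>n. log_sum_term n a) - (ph 3 a 0 - 1) / 3 +
     a * (3 * (Digamma (1 + 2 * a) + euler_mascheroni) - 2 * (Digamma (1 + 3 * a) + euler_mascheroni))"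

text \<open>The function pi a cot(pi a), continued over 0 by Digamma reflection; its Taylor
  coefficients are then zeta values directly.\<close>

definition cot_part :: "complex \<Rightarrow> complex" where
  "cot_part a = 1 + a * ((Digamma (1 + (- 1) * a) + euler_mascheroni) - (Digamma (1 + 1 * a) + euler_mascheroni))"

lemma small_denominators:
  fixes a :: complex
  assumes "norm a \<le> 1 / 6"
  shows "real (Suc n) / 2 \<le> norm (of_nat (Suc n) - 3 * a)" "real (Suc n) / 2 \<le> norm (of_nat (Suc n) + 3 * a)"
proof -
  have 3: "norm (3 * a) = 3 * norm a" by (simp add: norm_mult)
  have "real (Suc n) - norm (3 * a) \<le> norm (of_nat (Suc n) - 3 * a)"
    using norm_triangle_ineq2[of "of_nat (Suc n)" "3 * a"] by (simp del: of_nat_Suc)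
  moreover have "real (Suc n) - norm (3 * a) \<le> norm (of_nat (Suc n) + 3 * a)"
    using norm_triangle_ineq2[of "of_nat (Suc n)" "- (3 * a)"] by (simp del: of_nat_Suc)
  ultimately show "real (Suc n) / 2 \<le> norm (of_nat (Suc n) - 3 * a)" "real (Suc n) / 2 \<le> norm (of_nat (Suc n) + 3 * a)"
    using assms 3 by simp_all
qed

lemma log_sum_parts_bound:
  assumes a: "norm a \<le> 1 / 6"
  shows "norm ((ph 3 a (Suc n) - 1) / (of_nat (Suc n) - 3 * a)) \<le> 200 / real (Suc n) ^ 2"
    and "norm ((ph 3 a n - 1) / (of_nat (Suc n) + 3 * a)) \<le> 200 / real (Suc n) ^ 2"
proof -
  have q: "norm (x / y) \<le> 200 / real (Suc n) ^ 2"
    if "norm x \<le> 100 / real (Suc n) ^ 2" "real (Suc n) / 2 \<le> norm y" for x y :: complex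
  proof -
    have "1 / 2 \<le> norm y" using that(2) by simp
    then have "norm (x / y) \<le> 100 / real (Suc n) ^ 2 / (1 / 2)"
      unfolding norm_divide using that(1) by (intro frac_le) auto
    then show ?thesis by simp
  qed
  have "100 / real (Suc (Suc n)) ^ 2 \<le> 100 / real (Suc n) ^ 2"
    by (intro divide_left_mono power_mono mult_pos_pos) auto
  then have "norm (ph 3 a (Suc n) - 1) \<le> 100 / real (Suc n) ^ 2"
    using ph_minus_1_small[OF a, of 3 "Suc n"] by simp
  from q[OF this small_denominators(1)[OF a]]
  show "norm ((ph 3 a (Suc n) - 1) / (of_nat (Suc n) - 3 * a)) \<le> 200 / real (Suc n) ^ 2" .
  have "norm (ph 3 a n - 1) \<le> 100 / real (Suc n) ^ 2"
    using ph_minus_1_small[OF a, of 3 n] by simp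
  from q[OF this small_denominators(2)[OF a]]
  show "norm ((ph 3 a n - 1) / (of_nat (Suc n) + 3 * a)) \<le> 200 / real (Suc n) ^ 2" .
qed

lemma Digamma_sums:
  fixes z :: complex
  assumes "z \<noteq> 0"
  shows "(\<lambda>n. 1 / (z + of_nat n) - 1 / of_nat (Suc n)) sums - (Digamma z + euler_mascheroni)"
proof -
  have "(\<lambda>n. inverse (of_nat (Suc n)) - inverse (z + of_nat n)) sums (Digamma z + euler_mascheroni)"
    using summable_sums[OF summable_Digamma[OF assms]] by (simp add: Digamma_def)
  from sums_minus[OF this] show ?thesis by (simp add: inverse_eq_divide)
qed

lemma small_notin_Ints:
  fixes a :: complex
  assumes "norm a < 1" "a \<noteq> 0"
  shows "a \<notin> \<int>"
proof
  assume "a \<in> \<int>"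
  then obtain k where k: "a = of_int k" by (auto elim: Ints_cases)
  with assms have "k = 0" by simp
  then show False using k assms by simp
qed

text \<open>With \<open>ph\<close> split as 1 + (ph - 1), the part from 1 sums to Digamma values at
  - 3 a and 1 + 3 a, merged by reflection at the cost of a cotangent. The part from
  \<open>ph - 1\<close> is the series of \<open>log_sum_term\<close> plus the detached term at n =
  0.\<close>

lemma wz_rest_sums:
  assumes a: "norm a < 1 / 6" "a \<noteq> 0"
  shows "(\<lambda>n. wz_rest n a) sums ((\<Sum>n. log_sum_term n a) - (ph 3 a 0 - 1) / (3 * a) -
     of_real pi * cot (of_real pi * (3 * a)) - 2 * (Digamma (1 + 3 * a) + euler_mascheroni))"
proof -
  define u where "u = (\<lambda>n. (ph 3 a n - 1) / (of_nat n - 3 * a))"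
  define v where "v = (\<lambda>n. (ph 3 a n - 1) / (of_nat (Suc n) + 3 * a))"
  have a': "norm a \<le> 1 / 6" using a by simp
  have "summable (\<lambda>n. u (Suc n))" unfolding u_def
    by (rule summable_comparison_test'[OF summable_inverse_Suc_square log_sum_parts_bound(1)[OF a']])
  then have u': "(\<lambda>n. u (Suc n)) sums (\<Sum>n. u (Suc n))" by (rule summable_sums)
  then have u: "u sums ((\<Sum>n. u (Suc n)) + u 0)" by (simp add: sums_Suc_iff)
  have "summable v" unfolding v_def
    by (rule summable_comparison_test'[OF summable_inverse_Suc_square log_sum_parts_bound(2)[OF a']])
  then have v: "v sums (\<Sum>n. v n)" by (rule summable_sums)
  have uv: "(\<Sum>n. u (Suc n)) + (\<Sum>n. v n) = (\<Sum>n. log_sum_term n a)"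
    using sums_unique[OF sums_add[OF u' v]] by (simp add: u_def v_def log_sum_term_def)
  have nz: "- (3 * a) \<noteq> 0" using a by simp
  have nz1: "1 + 3 * a \<noteq> 0"
    using small_denominators(2)[OF a', of 0] by auto
  have "norm (3 * a) < 1" using a by (simp add: norm_mult)
  then have "3 * a \<notin> \<int>" by (rule small_notin_Ints) (use a in auto)
  then have "- (3 * a) \<notin> \<int>" by simp
  then have refl: "Digamma (- (3 * a)) = Digamma (1 + 3 * a) + of_real pi * cot (of_real pi * (3 * a))"
    using Digamma_reflection[of "- (3 * a)"] by (simp add: cot_def algebra_simps)
  have rest: "wz_rest n a = (u n + v n) + ((1 / (- (3 * a) + of_nat n) - 1 / of_nat (Suc n)) +
      (1 / (1 + 3 * a + of_nat n) - 1 / of_nat (Suc n)))" for n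
  proof -
    have x: "of_nat n - 3 * a \<noteq> 0"
    proof (cases n)
      case (Suc k)
      have "0 < norm (of_nat (Suc k) - 3 * a)"
        by (rule less_le_trans[OF _ small_denominators(1)[OF a']]) simp
      then show ?thesis using Suc by (simp del: of_nat_Suc)
    qed (use a in simp)
    have y: "of_nat (Suc n) + 3 * a \<noteq> 0"
      using small_denominators(2)[OF a', of n] by auto
    have "p * (x + y) / (x * y) - 2 / N = ((p - 1) / x + (p - 1) / y) + ((1 / x - 1 / N) + (1 / y - 1 / N))"
      if "x \<noteq> 0" "y \<noteq> 0" for p x y N :: complex
    proof -
      have "p * (x + y) / (x * y) = p / y + p / x"
        using that by (simp add: distrib_left add_divide_distrib)
      then show ?thesis by (simp add: diff_divide_distrib)
    qed
    from this[OF x y, of "ph 3 a n" "of_nat (Suc n)"]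
    have "ph 3 a n * of_nat (2 * n + 1) / ((of_nat n - 3 * a) * (of_nat (Suc n) + 3 * a)) - 2 / of_nat (Suc n) =
      ((ph 3 a n - 1) / (of_nat n - 3 * a) + (ph 3 a n - 1) / (of_nat (Suc n) + 3 * a)) +
      ((1 / (of_nat n - 3 * a) - 1 / of_nat (Suc n)) + (1 / (of_nat (Suc n) + 3 * a) - 1 / of_nat (Suc n)))"
      by (simp add: add_ac)
    moreover have "- (3 * a) + of_nat n = of_nat n - 3 * a" "1 + 3 * a + of_nat n = of_nat (Suc n) + 3 * a"
      by simp_all
    ultimately show ?thesis unfolding wz_rest_def u_def v_def by (simp only:)
  qed
  have "(\<lambda>n. wz_rest n a) sums (((\<Sum>n. u (Suc n)) + u 0 + (\<Sum>n. v n)) +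
      (- (Digamma (- (3 * a)) + euler_mascheroni) + - (Digamma (1 + 3 * a) + euler_mascheroni)))"
    unfolding rest by (intro sums_add u v Digamma_sums nz nz1)
  also have "((\<Sum>n. u (Suc n)) + u 0 + (\<Sum>n. v n)) +
      (- (Digamma (- (3 * a)) + euler_mascheroni) + - (Digamma (1 + 3 * a) + euler_mascheroni)) =
      (\<Sum>n. log_sum_term n a) - (ph 3 a 0 - 1) / (3 * a) -
     of_real pi * cot (of_real pi * (3 * a)) - 2 * (Digamma (1 + 3 * a) + euler_mascheroni)"
    unfolding uv [symmetric] refl by (simp add: u_def algebra_simps)
  finally show ?thesis .
qed

lemma cot_part_eq:
  assumes "norm a < 1" "a \<noteq> 0"
  shows "cot_part a = of_real pi * a * cot (of_real pi * a)"
proof -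
  have "Digamma (1 + a) = Digamma a + 1 / a" using Digamma_plus1[OF assms(2)] by (simp add: add.commute)
  moreover have "Digamma (1 - a) - Digamma a = of_real pi * cot (of_real pi * a)"
    by (rule Digamma_reflection[OF small_notin_Ints[OF assms]])
  ultimately have "cot_part a = 1 + a * (of_real pi * cot (of_real pi * a) - 1 / a)"
    unfolding cot_part_def by (simp add: algebra_simps)
  then show ?thesis using assms(2) by (simp add: right_diff_distrib)
qed

lemma sine_factor_cot_part:
  assumes "norm a < 1" "a \<noteq> 0"
  shows "a ^ 2 * sine_factor a = 3 * (cot_part a ^ 2 - of_real pi ^ 2 / 3 * a ^ 2)"
proof -
  have s: "sin (of_real pi * a) \<noteq> 0" by (rule sin_pi_nonzero[OF small_notin_Ints[OF assms]])
  have "1 / sin (of_real pi * a) ^ 2 = cot (of_real pi * a) ^ 2 + 1"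
  proof -
    have "1 = cos (of_real pi * a) ^ 2 + sin (of_real pi * a) ^ 2" by simp
    then have "1 / sin (of_real pi * a) ^ 2 = (cos (of_real pi * a) ^ 2 + sin (of_real pi * a) ^ 2) / sin (of_real pi * a) ^ 2"
      by simp
    then show ?thesis unfolding cot_def add_divide_distrib using s by (simp add: power_divide)
  qed
  then have "3 / sin (of_real pi * a) ^ 2 = 3 * (cot (of_real pi * a) ^ 2 + 1)"
    by (metis mult.right_neutral times_divide_eq_right)
  then show ?thesis
    unfolding sine_factor_def cot_part_eq[OF assms] by (simp add: algebra_simps power2_eq_square)
qed

text \<open>Of the factor \<open>a^3\<close>, two powers remove the double pole of
  \<open>sine_factor\<close> and one goes into \<open>log_part\<close>.\<close>

lemma wz_defect_near_0:
  assumes a: "norm a < 1 / 6" "a \<noteq> 0"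
  shows "a ^ 3 * (f10_sum a - wz_defect a) = 6 * (cot_part a ^ 2 - of_real pi ^ 2 / 3 * a ^ 2) * log_part a"
proof -
  define c where "c = of_real pi * cot (of_real pi * (3 * a))"
  define P where "P = sine_factor a"
  define R where "R = (\<Sum>n. wz_rest n a)"
  have aI: "a \<notin> \<int>" by (rule small_notin_Ints) (use a in auto)
  have "norm (3 * a) < 1" using a by (simp add: norm_mult)
  then have a3I: "3 * a \<notin> \<int>" by (rule small_notin_Ints) (use a in auto)
  have nn: "of_nat n - 3 * a \<notin> \<int>\<^sub>\<le>\<^sub>0" for n
    using a3I nonpos_Ints_Int[of "of_nat n - 3 * a"] Ints_diff[of "of_nat n" "of_nat n - 3 * a"] by auto
  have np: "of_nat (Suc n) + 3 * a \<noteq> 0" for n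
    using small_denominators(2)[of a n] a by auto
  have R: "(\<lambda>n. wz_rest n a) sums R"
    unfolding R_def using wz_rest_sums[OF a] by (auto intro: summable_sums sums_summable)
  have "(\<Sum>n. wz_periodic_term n a) = P * R"
    unfolding wz_periodic_term_eq[OF aI nn np] using sums_unique[OF sums_mult[OF R, of P]] by (simp add: P_def)
  moreover have "of_real pi ^ 3 * cos (of_real pi * (3 * a)) / sin (of_real pi * a) ^ 3 = P * c"
  proof -
    have "sin (of_real pi * (3 * a)) \<noteq> 0" "sin (of_real pi * a) \<noteq> 0"
      using sin_pi_nonzero[OF a3I] sin_pi_nonzero[OF aI] .
    then show ?thesis unfolding P_def c_def cot_def sine_factor_conv[OF aI]
      by (simp add: power2_eq_square power3_eq_cube mult_ac)
  qed
  ultimately have "f10_sum a - wz_defect a = 2 * P * (R + 3 * (Digamma (1 + 2 * a) + euler_mascheroni) + c)"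
    unfolding wz_defect_def P_def [symmetric] by (simp add: algebra_simps)
  moreover have "a * (R + 3 * (Digamma (1 + 2 * a) + euler_mascheroni) + c) = log_part a"
  proof -
    have Req: "R = (\<Sum>n. log_sum_term n a) - (ph 3 a 0 - 1) / (3 * a) - c - 2 * (Digamma (1 + 3 * a) + euler_mascheroni)"
      using sums_unique2[OF R wz_rest_sums[OF a]] by (simp add: c_def)
    have "a * (S - q / (3 * a) - c - 2 * E + 3 * D + c) = a * S - q / 3 + a * (3 * D - 2 * E)" for S q D E
      using a by (simp add: algebra_simps)
    then show ?thesis unfolding log_part_def Req .
  qed
  moreover have "a ^ 2 * P = 3 * (cot_part a ^ 2 - of_real pi ^ 2 / 3 * a ^ 2)"
    unfolding P_def by (rule sine_factor_cot_part) (use a in auto)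
  moreover have "a ^ 3 * (2 * P * X) = 2 * (a ^ 2 * P) * (a * X)" for X
    by (simp add: power2_eq_square power3_eq_cube algebra_simps)
  ultimately have "a ^ 3 * (f10_sum a - wz_defect a) =
      2 * (3 * (cot_part a ^ 2 - of_real pi ^ 2 / 3 * a ^ 2)) * log_part a" by (simp only:)
  then show ?thesis by (simp only: mult.assoc [symmetric]) simp
qed

definition log_part_fps :: "complex fps" where
  "log_part_fps = fps_expansion log_part 0"

definition inverse_linear_fps :: "nat \<Rightarrow> complex \<Rightarrow> complex fps" where
  "inverse_linear_fps n c = Abs_fps (\<lambda>m. (- c) ^ m / of_nat n ^ Suc m)"

lemma has_fps_expansion_inverse_linear:
  fixes c :: complex
  assumes n: "0 < n"
  shows "(\<lambda>a. inverse (of_nat n + c * a)) has_fps_expansion inverse_linear_fps n c"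
proof -
  define F where "F = fps_const (of_nat n) + fps_const c * fps_X"
  have F: "(\<lambda>a. of_nat n + c * a) has_fps_expansion F"
    unfolding F_def by (intro fps_expansion_intros)
  have F0: "fps_nth F 0 \<noteq> 0" using n by (simp add: F_def)
  have "F * inverse_linear_fps n c = 1"
  proof (rule fps_ext)
    fix m show "fps_nth (F * inverse_linear_fps n c) m = fps_nth 1 m"
      using n by (cases m) (simp_all add: F_def inverse_linear_fps_def distrib_right mult.assoc field_simps)
  qed
  then have "inverse_linear_fps n c = inverse F"
    by (metis fps_inverse_unique)
  then show ?thesis using has_fps_expansion_inverse[OF F F0] by simp
qed

definition log_sum_fps :: "nat \<Rightarrow> complex fps" where
  "log_sum_fps n = (ph_fps 3 (Suc n) - 1) * inverse_linear_fps (Suc n) (- 3) +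
     (ph_fps 3 n - 1) * inverse_linear_fps (Suc n) 3"

lemma has_fps_expansion_log_sum_term: "log_sum_term n has_fps_expansion log_sum_fps n"
proof -
  have "(\<lambda>a. (ph 3 a (Suc n) - 1) * inverse (of_nat (Suc n) + (- 3) * a) + (ph 3 a n - 1) * inverse (of_nat (Suc n) + 3 * a))
     has_fps_expansion log_sum_fps n"
    unfolding log_sum_fps_def
    by (intro has_fps_expansion_add has_fps_expansion_mult has_fps_expansion_diff has_fps_expansion_1
      has_fps_expansion_ph has_fps_expansion_inverse_linear) auto
  also have "(\<lambda>a. (ph 3 a (Suc n) - 1) * inverse (of_nat (Suc n) + (- 3) * a) + (ph 3 a n - 1) * inverse (of_nat (Suc n) + 3 * a)) = log_sum_term n"
    unfolding log_sum_term_def by (simp add: divide_inverse)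
  finally show ?thesis .
qed

lemma log_sum_expansion:
  shows "(\<lambda>a. \<Sum>n. log_sum_term n a) has_fps_expansion Abs_fps (\<lambda>m. \<Sum>n. fps_nth (log_sum_fps n) m)"
    and "summable (\<lambda>n. fps_nth (log_sum_fps n) m)"
proof -
  have hol: "log_sum_term n holomorphic_on ball 0 (1 / 6)" for n
  proof -
    have "(\<lambda>a. ph 3 a j) holomorphic_on ball 0 (1 / 6)" for j
      by (rule holomorphic_on_subset[OF ph_holomorphic_small]) auto
    moreover have "of_nat (Suc n) - 3 * a \<noteq> 0" "of_nat (Suc n) + 3 * a \<noteq> 0" if "a \<in> ball (0 :: complex) (1 / 6)" for a
      using small_denominators[of a n] that by auto
    ultimately show ?thesis unfolding log_sum_term_def by (intro holomorphic_intros)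
  qed
  have bd: "norm (log_sum_term n a) \<le> 400 / real (Suc n) ^ 2" if "a \<in> ball 0 (1 / 6)" for n a
  proof -
    have "norm (log_sum_term n a) \<le> 200 / real (Suc n) ^ 2 + 200 / real (Suc n) ^ 2"
      unfolding log_sum_term_def
      by (intro norm_triangle_mono log_sum_parts_bound) (use that in auto)
    then show ?thesis by simp
  qed
  note S = has_fps_expansion_suminf[OF _ hol bd summable_inverse_Suc_square has_fps_expansion_log_sum_term]
  show "(\<lambda>a. \<Sum>n. log_sum_term n a) has_fps_expansion Abs_fps (\<lambda>m. \<Sum>n. fps_nth (log_sum_fps n) m)"
    by (rule S(1)) auto
  show "summable (\<lambda>n. fps_nth (log_sum_fps n) m)"
    by (rule S(2)) auto
qed

lemma has_fps_expansion_log_part: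
  "log_part has_fps_expansion fps_X * Abs_fps (\<lambda>m. \<Sum>n. fps_nth (log_sum_fps n) m) - fps_const (1 / 3) * (ph_fps 3 0 - 1) +
     fps_X * (fps_const 3 * digamma_fps 2 - fps_const 2 * digamma_fps 3)" (is "_ has_fps_expansion ?F")
proof -
  have "(\<lambda>a. a * (\<Sum>n. log_sum_term n a) - 1 / 3 * (ph 3 a 0 - 1) +
     a * (3 * (Digamma (1 + 2 * a) + euler_mascheroni) - 2 * (Digamma (1 + 3 * a) + euler_mascheroni))) has_fps_expansion ?F"
    by (intro fps_expansion_intros log_sum_expansion has_fps_expansion_ph has_fps_expansion_Digamma_1) auto
  then show ?thesis by (simp add: log_part_def [abs_def])
qed

lemma log_part_fps_0: "fps_nth log_part_fps 0 = 0"
  and log_part_fps_Suc: "fps_nth log_part_fps (Suc m) = (\<Sum>n. fps_nth (log_sum_fps n) m) - fps_nth (ph_fps 3 0) (Suc m) / 3 +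
     3 * fps_nth (digamma_fps 2) m - 2 * fps_nth (digamma_fps 3) m"
proof -
  have "log_part_fps = fps_X * Abs_fps (\<lambda>m. \<Sum>n. fps_nth (log_sum_fps n) m) - fps_const (1 / 3) * (ph_fps 3 0 - 1) +
     fps_X * (fps_const 3 * digamma_fps 2 - fps_const 2 * digamma_fps 3)"
    unfolding log_part_fps_def
    by (rule fps_ext) (use fps_nth_fps_expansion[OF has_fps_expansion_log_part] in \<open>simp add: fps_expansion_def\<close>)
  note e = this
  show "fps_nth log_part_fps 0 = 0" by (simp add: e ph_fps_0)
  show "fps_nth log_part_fps (Suc m) = (\<Sum>n. fps_nth (log_sum_fps n) m) - fps_nth (ph_fps 3 0) (Suc m) / 3 +
     3 * fps_nth (digamma_fps 2) m - 2 * fps_nth (digamma_fps 3) m"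
    by (simp add: e)
qed

definition cot_fps :: "complex fps" where
  "cot_fps = 1 + fps_X * (digamma_fps (- 1) - digamma_fps 1)"

lemma has_fps_expansion_cot_part: "cot_part has_fps_expansion cot_fps"
  unfolding cot_part_def [abs_def] cot_fps_def
  by (intro fps_expansion_intros has_fps_expansion_Digamma_1)

definition log_sum_coeff :: "nat \<Rightarrow> nat \<Rightarrow> complex" where
  "log_sum_coeff n m = (\<Sum>i=0..m. (fps_nth (ph_fps 3 (Suc n)) i - (if i = 0 then 1 else 0)) * 3 ^ (m - i) / of_nat (Suc n) ^ Suc (m - i) +
     (fps_nth (ph_fps 3 n) i - (if i = 0 then 1 else 0)) * (- 3) ^ (m - i) / of_nat (Suc n) ^ Suc (m - i))"

lemma log_sum_fps_nth: "fps_nth (log_sum_fps n) m = log_sum_coeff n m"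
  unfolding log_sum_fps_def log_sum_coeff_def inverse_linear_fps_def fps_add_nth fps_mult_nth sum.distrib [symmetric]
  by (intro sum.cong refl) (simp del: of_nat_Suc)

lemma cot_fps_nth:
  assumes "0 < m"
  shows "fps_nth cot_fps m = (if even m then - 2 * zeta_tail m 0 else 0)"
proof -
  define k where "k = m - 1"
  have k: "m = Suc k" using assms by (simp add: k_def)
  have "fps_nth cot_fps m = fps_nth (digamma_fps (- 1)) k - fps_nth (digamma_fps 1) k"
    by (simp add: cot_fps_def k)
  then show ?thesis by (cases "even k"; cases "k = 0") (simp_all add: digamma_fps_def k power_minus_odd)
qed

text \<open>The even zeta values are obtained by comparing coefficients in \<open>cot_part a * sin (pi * a) = pi * a * cos (pi * a)\<close>.\<close>

lemma even_zeta_values: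
  defines "p \<equiv> of_real pi :: complex"
  shows "zeta_tail 2 0 = p ^ 2 / 6" "zeta_tail 4 0 = p ^ 4 / 90" "zeta_tail 6 0 = p ^ 6 / 945" "zeta_tail 8 0 = p ^ 8 / 9450"
proof -
  have p0: "p \<noteq> 0" by (simp add: p_def)
  have "\<forall>\<^sub>F a in nhds 0. a \<in> ball (0 :: complex) 1" by (intro eventually_nhds_in_open) auto
  then have ev: "\<forall>\<^sub>F a in nhds 0. cot_part a * sin (p * a) = p * a * cos (p * a)"
  proof eventually_elim
    case (elim a)
    show ?case
    proof (cases "a = 0")
      case False
      then have "cot_part a = p * a * cot (p * a)" using cot_part_eq[of a] elim by (simp add: p_def)
      moreover have "sin (p * a) \<noteq> 0"
        unfolding p_def by (rule sin_pi_nonzero, rule small_notin_Ints) (use elim False in auto)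
      ultimately show ?thesis by (simp add: cot_def)
    qed simp
  qed
  have "cot_fps * fps_sin p = fps_const p * fps_X * fps_cos p"
    by (rule fps_expansion_eqI[OF ev]) (intro fps_expansion_intros has_fps_expansion_cot_part)+
  then have pr: "fps_nth (cot_fps * fps_sin p) (Suc m) = p * fps_nth (fps_cos p) m" for m
    by (simp add: mult.assoc)
  have r: "(\<Sum>i=0..m. fps_nth cot_fps i * fps_nth (fps_sin p) (m - i)) = p * fps_nth (fps_cos p) (m - 1)" if "0 < m" for m
    unfolding fps_mult_nth [symmetric] using pr[of "m - 1"] that by simp
  have sum3: "(\<Sum>i=0..3. f i) = f 0 + f 1 + f 2 + f 3" 
    and sum5: "(\<Sum>i=0..5. f i) = f 0 + f 1 + f 2 + f 3 + f 4 + f 5"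
    and sum7: "(\<Sum>i=0..7. f i) = f 0 + f 1 + f 2 + f 3 + f 4 + f 5 + f 6 + f 7"
    and sum9: "(\<Sum>i=0..9. f i) = f 0 + f 1 + f 2 + f 3 + f 4 + f 5 + f 6 + f 7 + f 8 + f 9"
    for f :: "nat \<Rightarrow> complex"
    by (simp_all add: eval_nat_numeral)
  have c0: "fps_nth cot_fps 0 = 1" by (simp add: cot_fps_def)
  have sc: "fps_nth (fps_sin p) 1 = p" "fps_nth (fps_sin p) 3 = - (p ^ 3) / 6" "fps_nth (fps_sin p) 5 = p ^ 5 / 120"
    "fps_nth (fps_sin p) 7 = - (p ^ 7) / 5040" "fps_nth (fps_sin p) 9 = p ^ 9 / 362880"
    "fps_nth (fps_cos p) 2 = - (p ^ 2) / 2" "fps_nth (fps_cos p) 4 = p ^ 4 / 24" "fps_nth (fps_cos p) 6 = - (p ^ 6) / 720"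
    "fps_nth (fps_cos p) 8 = p ^ 8 / 40320"
    by (simp_all add: fps_sin_def fps_cos_def fact_numeral)
  note simps = c0 cot_fps_nth sc
  have solve: "z = w" if "A + - 2 * z * p = B" "A - B = 2 * w * p" for A B z w
  proof -
    have "z * p = w * p" using that by (simp add: algebra_simps)
    then show ?thesis using p0 by simp
  qed
  have "z = p ^ 2 / 6" if "- (p ^ 3) / 6 + - 2 * z * p = p * (- (p ^ 2) / 2)" for z
    by (rule solve[OF that]) (simp flip: power_add power_Suc power_Suc2)
  from this[of "zeta_tail 2 0"] show z2: "zeta_tail 2 0 = p ^ 2 / 6"
    using r[of 3] by (simp add: sum3 simps)
  have "z = p ^ 4 / 90" if "p ^ 5 / 120 + - 2 * (p ^ 2 / 6) * (- (p ^ 3) / 6) + - 2 * z * p = p * (p ^ 4 / 24)" for z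
    by (rule solve[OF that]) (simp flip: power_add power_Suc power_Suc2)
  from this[of "zeta_tail 4 0"] show z4: "zeta_tail 4 0 = p ^ 4 / 90"
    using r[of 5] by (simp add: sum5 simps z2)
  have "z = p ^ 6 / 945" if "- (p ^ 7) / 5040 + - 2 * (p ^ 2 / 6) * (p ^ 5 / 120) + - 2 * (p ^ 4 / 90) * (- (p ^ 3) / 6) + - 2 * z * p = p * (- (p ^ 6) / 720)" for z
    by (rule solve[OF that]) (simp flip: power_add power_Suc power_Suc2)
  from this[of "zeta_tail 6 0"] show z6: "zeta_tail 6 0 = p ^ 6 / 945"
    using r[of 7] by (simp add: sum7 simps z2 z4)
  have "z = p ^ 8 / 9450" if "p ^ 9 / 362880 + - 2 * (p ^ 2 / 6) * (- (p ^ 7) / 5040) + - 2 * (p ^ 4 / 90) * (p ^ 5 / 120) +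
      - 2 * (p ^ 6 / 945) * (- (p ^ 3) / 6) + - 2 * z * p = p * (p ^ 8 / 40320)" for z
    by (rule solve[OF that]) (simp flip: power_add power_Suc power_Suc2)
  note solve8 = this
  have ct: "fps_nth cot_fps 2 = - 2 * zeta_tail 2 0" "fps_nth cot_fps 4 = - 2 * zeta_tail 4 0"
    "fps_nth cot_fps 6 = - 2 * zeta_tail 6 0" "fps_nth cot_fps 8 = - 2 * zeta_tail 8 0"
    by (simp_all add: cot_fps_nth)
  have "fps_nth cot_fps 0 * fps_nth (fps_sin p) 9 + fps_nth cot_fps 2 * fps_nth (fps_sin p) 7 +
      fps_nth cot_fps 4 * fps_nth (fps_sin p) 5 + fps_nth cot_fps 6 * fps_nth (fps_sin p) 3 +
      fps_nth cot_fps 8 * fps_nth (fps_sin p) 1 = p * fps_nth (fps_cos p) 8"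
    using r[of 9] by (simp add: sum9 cot_fps_nth)
  from solve8[OF this[unfolded c0 sc ct z2 z4 z6 mult_1]]
  show z8: "zeta_tail 8 0 = p ^ 8 / 9450" .
qed

lemma zeta_tail_sums:
  assumes "2 \<le> s"
  shows "(\<lambda>k. 1 / real (Suc (j + k)) ^ s) sums (\<Sum>k. 1 / real (Suc (j + k)) ^ s)"
proof -
  have "summable (\<lambda>k. 1 / real (Suc (j + k)) ^ s)"
  proof (rule summable_comparison_test'[OF summable_inverse_Suc_square[of 1]])
    fix k
    have "real (Suc k) ^ 2 \<le> real (Suc (j + k)) ^ 2" by (intro power_mono) auto
    also have "\<dots> \<le> real (Suc (j + k)) ^ s" using assms by (intro power_increasing) auto
    finally have "1 / real (Suc (j + k)) ^ s \<le> 1 / real (Suc k) ^ 2" by (intro divide_left_mono mult_pos_pos) auto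
    then show "norm (1 / real (Suc (j + k)) ^ s) \<le> 1 / real (Suc k) ^ 2" by simp
  qed
  then show ?thesis by (rule summable_sums)
qed

lemma zeta_tail_of_real:
  assumes "2 \<le> s"
  shows "zeta_tail s j = of_real (\<Sum>k. 1 / real (Suc (j + k)) ^ s)"
proof -
  have "(\<lambda>k. of_real (1 / real (Suc (j + k)) ^ s) :: complex) sums of_real (\<Sum>k. 1 / real (Suc (j + k)) ^ s)"
    by (rule sums_of_real[OF zeta_tail_sums[OF assms]])
  then have "(\<lambda>k. 1 / of_nat (Suc (j + k)) ^ s :: complex) sums of_real (\<Sum>k. 1 / real (Suc (j + k)) ^ s)"
    by (simp del: of_nat_Suc)
  then show ?thesis unfolding zeta_tail_def by (rule sums_unique[symmetric])
qed

lemma zeta_tail_nonzero: "2 \<le> s \<Longrightarrow> zeta_tail s j \<noteq> 0"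
proof -
  assume s: "2 \<le> s"
  have "0 < (\<Sum>k. 1 / real (Suc (j + k)) ^ s)"
    by (rule suminf_pos[OF sums_summable[OF zeta_tail_sums[OF s]]]) simp
  then show ?thesis unfolding zeta_tail_of_real[OF s] by simp
qed

section \<open>Order of vanishing at 0 and the value of the constant\<close>

lemma log_sum_coeff_small: "m \<le> 2 \<Longrightarrow> log_sum_coeff n m = 0"
proof -
  assume "m \<le> 2"
  then have "m = 0 \<or> m = 1 \<or> m = 2" by auto
  then show ?thesis
    using ph_fps_nth_3(1,2)[of n] ph_fps_nth_3(1,2)[of "Suc n"]
    by (auto simp: log_sum_coeff_def ph_fps_0 numeral_2_eq_2)
qed

text \<open>Order 2 vanishes because 3 * 2 = 2 * 3 in the two Digamma terms; order 3 is 18 - 12 - 16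
  / 3 = 2 / 3 times zeta(3). The vanishing lower orders make the singularity of
  \<open>wz_defect\<close> at 0 removable.\<close>

lemma log_part_fps_small:
  "fps_nth log_part_fps 1 = 0" "fps_nth log_part_fps 2 = 0" "fps_nth log_part_fps 3 = 2 / 3 * zeta_tail 3 0"
proof -
  have "fps_nth log_part_fps (Suc 0) = 0" "fps_nth log_part_fps (Suc 1) = 0" "fps_nth log_part_fps (Suc 2) = 2 / 3 * zeta_tail 3 0"
    unfolding log_part_fps_Suc log_sum_fps_nth
    using ph_fps_nth_3(1,2,3)[of 0]
    by (simp_all add: log_sum_coeff_small digamma_fps_def numeral_2_eq_2 numeral_3_eq_3)
  then show "fps_nth log_part_fps 1 = 0" "fps_nth log_part_fps 2 = 0" "fps_nth log_part_fps 3 = 2 / 3 * zeta_tail 3 0"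
    by (simp_all add: numeral_2_eq_2 numeral_3_eq_3)
qed

definition main_fps :: "complex fps" where
  "main_fps = fps_const 6 * (cot_fps ^ 2 - fps_const (of_real pi ^ 2 / 3) * fps_X ^ 2) * log_part_fps"

lemma has_fps_expansion_main:
  "(\<lambda>a. 6 * (cot_part a ^ 2 - of_real pi ^ 2 / 3 * a ^ 2) * log_part a) has_fps_expansion main_fps"
proof -
  have "log_part has_fps_expansion log_part_fps"
  proof -
    have "log_part has_fps_expansion log_part_fps" if "log_part has_fps_expansion F" for F
    proof -
      have "log_part_fps = F"
        by (rule fps_ext) (simp add: log_part_fps_def fps_expansion_def fps_nth_fps_expansion[OF that])
      then show ?thesis using that by simp
    qed
    then show ?thesis using has_fps_expansion_log_part .
  qed
  then show ?thesis
    unfolding main_fps_def by (intro fps_expansion_intros has_fps_expansion_cot_part)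
qed

lemma main_fps_small:
  "fps_nth main_fps 0 = 0" "fps_nth main_fps 1 = 0" "fps_nth main_fps 2 = 0" "fps_nth main_fps 3 = 4 * zeta_tail 3 0"
proof -
  define T where "T = fps_const 6 * (cot_fps ^ 2 - fps_const (of_real pi ^ 2 / 3) * fps_X ^ 2)"
  have T0: "fps_nth T 0 = 6" by (simp add: T_def cot_fps_def power2_eq_square)
  have M: "fps_nth main_fps m = (\<Sum>i=0..m. fps_nth T i * fps_nth log_part_fps (m - i))" for m
    unfolding main_fps_def T_def by (rule fps_mult_nth)
  note W = log_part_fps_0 log_part_fps_small
  have s: "(\<Sum>i=0..1. f i) = f 0 + f 1" "(\<Sum>i=0..2. f i) = f 0 + f 1 + f 2" "(\<Sum>i=0..3. f i) = f 0 + f 1 + f 2 + f 3"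
    for f :: "nat \<Rightarrow> complex" by (simp_all add: eval_nat_numeral)
  show "fps_nth main_fps 0 = 0" unfolding M by (simp add: log_part_fps_0)
  show "fps_nth main_fps 1 = 0" unfolding M s by (simp add: W[unfolded One_nat_def])
  show "fps_nth main_fps 2 = 0" unfolding M s by (simp add: W[unfolded One_nat_def])
  show "fps_nth main_fps 3 = 4 * zeta_tail 3 0" unfolding M s by (simp add: W[unfolded One_nat_def] T0)
qed

text \<open>Since \<open>main_fps\<close> starts in order 3, division by \<open>a^3\<close> leaves a
  continuous function. The limit keeps \<open>f10_sum 0\<close> unevaluated, as it affects only the
  coefficient of order 0.\<close>

lemma wz_defect_tendsto: "wz_defect \<midarrow>0\<rightarrow> f10_sum 0 - 4 * zeta_tail 3 0"
proof -
  define g where "g = (\<lambda>a. 6 * (cot_part a ^ 2 - of_real pi ^ 2 / 3 * a ^ 2) * log_part a)"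
  have g: "g has_fps_expansion main_fps" unfolding g_def by (rule has_fps_expansion_main)
  have nz: "fps_nth main_fps 3 \<noteq> 0" by (simp add: main_fps_small zeta_tail_nonzero)
  have "3 \<le> subdegree main_fps"
  proof (rule subdegree_geI)
    show "main_fps \<noteq> 0" using nz by auto
    fix i :: nat assume "i < 3"
    then have "i = 0 \<or> i = 1 \<or> i = 2" by auto
    then show "fps_nth main_fps i = 0" using main_fps_small by auto
  qed
  from has_fps_expansion_shift[OF g this refl]
  have "isCont (\<lambda>a. if a = 0 then fps_nth main_fps 3 else g a / a ^ 3) 0"
    by (rule has_fps_expansion_imp_continuous)
  then have "(\<lambda>a. if a = 0 then fps_nth main_fps 3 else g a / a ^ 3) \<midarrow>0\<rightarrow> fps_nth main_fps 3"
    by (simp add: isCont_def)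
  moreover have "f10_sum \<midarrow>0\<rightarrow> f10_sum 0"
  proof -
    have "isCont f10_sum 0"
      using holomorphic_on_imp_continuous_on[OF f10_sum_holomorphic(1)] open_half_plane
      by (simp add: continuous_on_eq_continuous_at half_plane_def)
    then show ?thesis by (simp add: isCont_def)
  qed
  ultimately have "(\<lambda>a. f10_sum a - (if a = 0 then fps_nth main_fps 3 else g a / a ^ 3)) \<midarrow>0\<rightarrow> f10_sum 0 - fps_nth main_fps 3"
    by (intro tendsto_diff)
  moreover have "\<forall>\<^sub>F a in at 0. f10_sum a - (if a = 0 then fps_nth main_fps 3 else g a / a ^ 3) = wz_defect a"
  proof -
    have "\<forall>\<^sub>F a in at 0. a \<in> ball (0 :: complex) (1 / 6) - {0}"
      by (intro eventually_at_in_open) auto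
    then show ?thesis
    proof eventually_elim
      case (elim a)
      then have a: "norm a < 1 / 6" "a \<noteq> 0" by auto
      have "a ^ 3 * (f10_sum a - wz_defect a) = g a" unfolding g_def by (rule wz_defect_near_0[OF a])
      then have "g a / a ^ 3 = f10_sum a - wz_defect a" using a by (simp add: nonzero_divide_eq_eq mult.commute)
      then show ?case using a by simp
    qed
  qed
  ultimately show ?thesis unfolding main_fps_small by (rule Lim_transform_eventually)
qed

lemma wz_defect_const:
  assumes "norm a < 1 / 6" "a \<noteq> 0"
  shows "wz_defect a = f10_sum 0 - 4 * zeta_tail 3 0"
proof -
  obtain K where K: "\<And>a. 0 \<le> Re a \<Longrightarrow> Re a \<le> 1 \<Longrightarrow> 1 \<le> \<bar>Im a\<bar> \<Longrightarrow> norm (wz_defect a) \<le> K * \<bar>Im a\<bar> ^ 3"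
    using wz_defect_growth by blast
  have "\<bar>Re a\<bar> < 1 / 6" using assms abs_Re_le_cmod[of a] by linarith
  then have r: "- (1 / 4) < Re a" "Re a < 1 + 1 / 4" "a \<noteq> 1" by auto
  show ?thesis
  proof (rule strip_periodic_const[where d = "1 / 4" and n = 3 and C = K and f = wz_defect])
    show "wz_defect holomorphic_on {z. - (1 / 4) < Re z \<and> Re z < 1 + 1 / 4} - {0, 1}"
      using wz_defect_holomorphic unfolding strip_def by simp
  qed (use r assms wz_defect_periodic wz_defect_tendsto K in auto)
qed

section \<open>Derivatives of the summands as Taylor coefficients\<close>

lemma f10c_holomorphic_half_plane: "f10c holomorphic_on {z. 3 / 4 < Re z}"
proof -
  have "(\<lambda>a. f10c (a + of_nat (Suc 0))) \<circ> (\<lambda>z. z - 1) holomorphic_on {z. 3 / 4 < Re z}"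
    by (rule holomorphic_on_compose_gen[OF _ f10c_holomorphic[of 0]]) (auto intro!: holomorphic_intros simp: half_plane_def)
  then show ?thesis by (simp add: o_def)
qed

lemma f10c_higher_deriv_shift:
  "(deriv ^^ m) (\<lambda>a. f10c (a + of_nat (Suc n))) 0 = (deriv ^^ m) f10c (of_nat (Suc n))"
proof -
  have T: "open {z. 3 / 4 < Re z}" by (rule open_halfspace_Re_gt)
  have "(deriv ^^ m) (\<lambda>w. f10c (1 * w + of_nat (Suc n))) 0 = 1 ^ m * (deriv ^^ m) f10c (1 * 0 + of_nat (Suc n))"
    by (rule higher_deriv_compose_linear'[OF f10c_holomorphic_half_plane open_half_plane T]) (auto simp: half_plane_def)
  then show ?thesis by simp
qed

text \<open>Expanding each summand at a = 0 produces the derivatives of \<open>f10c\<close> at the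
  positive integers, and the majorant of \<open>f10c_shift_bound\<close> is uniform on a small disc.
  This also provides the convergence of the derivative series.\<close>

lemma f10_sum_expansion:
  shows "f10_sum has_fps_expansion Abs_fps (\<lambda>m. \<Sum>n. (deriv ^^ m) f10c (of_nat (Suc n)) / fact m)"
    and "summable (\<lambda>n. (deriv ^^ m) f10c (of_nat (Suc n)) / fact m)"
proof -
  have 0: "0 \<in> half_plane" by (simp add: half_plane_def)
  obtain d B where d: "0 < d" and B: "\<And>y. y \<in> ball 0 d \<Longrightarrow> norm (gamma_ratio (y + 1)) \<le> B"
    using locally_bounded_at[OF open_half_plane gamma_ratio_holomorphic 0] by blast
  define r where "r = min d (1 / 4)"
  have r: "0 < r" "r \<le> d" "r \<le> 1 / 4" using d by (auto simp: r_def)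
  have hp: "z \<in> half_plane" if "z \<in> ball 0 r" for z
  proof -
    have "norm z < 1 / 4" using that r by simp
    then show ?thesis using abs_Re_le_cmod[of z] by (simp add: half_plane_def)
  qed
  have hol: "(\<lambda>a. f10c (a + of_nat (Suc n))) holomorphic_on ball 0 r" for n
    by (rule holomorphic_on_subset[OF f10c_holomorphic]) (use hp in auto)
  have bd: "norm (f10c (z + of_nat (Suc n))) \<le> 3000 * B / real (Suc n) ^ 2" if z: "z \<in> ball 0 r" for n z
  proof -
    have "norm (f10c (z + of_nat (Suc n))) \<le> 3000 * norm (gamma_ratio (z + 1)) / real (Suc n) ^ 2"
      by (rule f10c_shift_bound) (use hp[OF z] in \<open>simp add: half_plane_def\<close>)
    also have "\<dots> \<le> 3000 * B / real (Suc n) ^ 2"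
      by (intro divide_right_mono mult_left_mono B) (use z r in auto)
    finally show ?thesis .
  qed
  have exp: "(\<lambda>a. f10c (a + of_nat (Suc n))) has_fps_expansion Abs_fps (\<lambda>m. (deriv ^^ m) f10c (of_nat (Suc n)) / fact m)" for n
    using has_fps_expansion_fps_expansion[OF open_ball _ hol[of n]] r
    by (simp only: fps_expansion_def f10c_higher_deriv_shift) simp
  note S = has_fps_expansion_suminf[OF r(1) hol bd summable_inverse_Suc_square exp]
  show "f10_sum has_fps_expansion Abs_fps (\<lambda>m. \<Sum>n. (deriv ^^ m) f10c (of_nat (Suc n)) / fact m)"
    using S(1) by (simp add: f10_sum_def [abs_def])
  show "summable (\<lambda>n. (deriv ^^ m) f10c (of_nat (Suc n)) / fact m)"
    using S(2)[of m] by simp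
qed

theorem f10c_derivative_sums:
  assumes "0 < m"
  shows "(\<lambda>n. (deriv ^^ m) f10c (of_nat (Suc n)) / fact m) sums fps_nth main_fps (m + 3)"
proof -
  \<comment> \<open>Subtracting \<open>L\<close> alters only order 0 and the factor
    \<open>a^3\<close> shifts orders by 3, so order m > 0 of the series is order m + 3 of
    \<open>main_fps\<close>.\<close>
  define L where "L = f10_sum 0 - 4 * zeta_tail 3 0"
  define S where "S = Abs_fps (\<lambda>m. \<Sum>n. (deriv ^^ m) f10c (of_nat (Suc n)) / fact m)"
  have e: "(\<lambda>a. a ^ 3 * (f10_sum a - L)) has_fps_expansion fps_X ^ 3 * (S - fps_const L)"
    unfolding S_def by (intro fps_expansion_intros f10_sum_expansion)
  have "\<forall>\<^sub>F a in nhds 0. a \<in> ball (0 :: complex) (1 / 6)" by (intro eventually_nhds_in_open) auto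
  then have ev: "\<forall>\<^sub>F a in nhds 0. a ^ 3 * (f10_sum a - L) = 6 * (cot_part a ^ 2 - of_real pi ^ 2 / 3 * a ^ 2) * log_part a"
  proof eventually_elim
    case (elim a)
    show ?case
    proof (cases "a = 0")
      case False
      then show ?thesis
        using wz_defect_near_0[of a] wz_defect_const[of a] elim by (simp add: L_def)
    qed (simp add: log_part_def ph_at_0)
  qed
  have "fps_X ^ 3 * (S - fps_const L) = main_fps"
    by (rule fps_expansion_eqI[OF ev e has_fps_expansion_main])
  then have "fps_nth main_fps (m + 3) = fps_nth (fps_X ^ 3 * (S - fps_const L)) (m + 3)" by simp
  also have "\<dots> = fps_nth S m"
    using assms by (simp add: fps_X_power_mult_nth)
  finally show ?thesis
    using summable_sums[OF f10_sum_expansion(2)[of m]] by (simp add: S_def)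
qed

section \<open>Evaluation of the coefficients\<close>

lemma zeta_tail_split:
  assumes "2 \<le> s"
  shows "zeta_tail s j = zeta_tail s 0 - (\<Sum>i<j. 1 / of_nat (Suc i) ^ s)"
    and "summable (\<lambda>i. 1 / of_nat (Suc i) ^ s :: complex)"
proof -
  have "summable (\<lambda>k. of_real (1 / real (Suc (0 + k)) ^ s) :: complex)"
    by (rule summable_of_real[OF sums_summable[OF zeta_tail_sums[OF assms]]])
  then show s: "summable (\<lambda>i. 1 / of_nat (Suc i) ^ s :: complex)" by (simp del: of_nat_Suc)
  show "zeta_tail s j = zeta_tail s 0 - (\<Sum>i<j. 1 / of_nat (Suc i) ^ s)"
    using suminf_split_initial_segment[OF s, of j] by (simp add: zeta_tail_def add_ac)
qed

lemma zeta_tail_step: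
  assumes "2 \<le> s"
  shows "zeta_tail s n = zeta_tail s (Suc n) + 1 / of_nat (Suc n) ^ s"
  by (simp add: zeta_tail_split(1)[OF assms, of n] zeta_tail_split(1)[OF assms, of "Suc n"])

lemma zeta_tail_lim:
  assumes "2 \<le> s"
  shows "zeta_tail s \<longlonglongrightarrow> 0"
proof -
  have "(\<lambda>j. zeta_tail s 0 - (\<Sum>i<j. 1 / of_nat (Suc i) ^ s :: complex)) \<longlonglongrightarrow> zeta_tail s 0 - (\<Sum>i. 1 / of_nat (Suc i) ^ s)"
    by (intro tendsto_diff tendsto_const summable_LIMSEQ zeta_tail_split(2) assms)
  moreover have "(\<Sum>i. 1 / of_nat (Suc i) ^ s) = zeta_tail s 0" by (simp add: zeta_tail_def)
  ultimately show ?thesis unfolding zeta_tail_split(1)[OF assms, symmetric] by simp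
qed

lemma zeta_tail_0_sums:
  assumes "2 \<le> s"
  shows "(\<lambda>n. 1 / of_nat (Suc n) ^ s) sums zeta_tail s 0"
  using summable_sums[OF zeta_tail_split(2)[OF assms]] by (simp add: zeta_tail_def)

lemma zeta_of_nat: "2 \<le> s \<Longrightarrow> of_real (zeta (real s)) = zeta_tail s 0"
proof -
  assume s: "2 \<le> s"
  have "zeta (real s) = (\<Sum>n. 1 / real (Suc n) ^ s)"
    unfolding zeta_def by (simp add: powr_minus powr_realpow inverse_eq_divide del: of_nat_Suc)
  then show ?thesis using zeta_tail_of_real[OF s, of 0] by simp
qed

text \<open>Summation over k1 > k2 = n + 1 gives the tail in the numerator. All terms are
  nonnegative, so the iterated sum agrees with the unordered sum in
  \<open>double_zeta\<close>.\<close>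

lemma double_zeta_sums:
  "(\<lambda>n. zeta_tail 5 (Suc n) / of_nat (Suc n) ^ 3) sums of_real (double_zeta 5 3)"
proof -
  define t where "t = (\<lambda>j. \<Sum>k. 1 / real (Suc (j + k)) ^ 5)"
  have ts: "(\<lambda>k. 1 / real (Suc (j + k)) ^ 5) sums t j" for j
    unfolding t_def by (rule zeta_tail_sums) simp
  have t0: "0 \<le> t j" for j
    by (rule sums_le[OF _ sums_zero ts]) simp
  have tle: "t j \<le> t 0" for j
    by (rule sums_le[OF _ ts ts]) (auto intro!: divide_left_mono power_mono mult_pos_pos)
  have sm: "summable (\<lambda>n. t (Suc n) / real (Suc n) ^ 3)"
  proof (rule summable_comparison_test'[OF summable_mult[OF sums_summable[OF zeta_tail_sums[of 3 0]], of "t 0"]])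
    show "norm (t (Suc n) / real (Suc n) ^ 3) \<le> t 0 * (1 / real (Suc (0 + n)) ^ 3)" for n
      using t0[of "Suc n"] tle[of "Suc n"] by (simp add: divide_right_mono del: of_nat_Suc)
  qed simp
  \<comment> \<open>The pair (n, k) encodes k2 = n + 1 and k1 = n + k + 2, a bijection of all pairs
    of naturals with the index set of the double sum.\<close>
  define f where "f = (\<lambda>(n, k). 1 / (real (n + k + 2) ^ 5 * real (Suc n) ^ 3))"
  define g where "g = (\<lambda>n. t (Suc n) / real (Suc n) ^ 3)"
  have g: "(g has_sum suminf g) UNIV"
    using sm t0 unfolding g_def by (intro sums_nonneg_imp_has_sum summable_sums) simp_all
  have fg: "((\<lambda>k. f (n, k)) has_sum g n) UNIV" for n
  proof -
    have "(\<lambda>k. 1 / real (Suc (Suc n + k)) ^ 5 / real (Suc n) ^ 3) sums g n"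
      unfolding g_def by (rule sums_divide[OF ts])
    then have "(\<lambda>k. f (n, k)) sums g n" by (simp add: f_def)
    then show ?thesis by (rule sums_nonneg_imp_has_sum) (simp add: f_def)
  qed
  have "f summable_on UNIV \<times> UNIV"
    by (rule summable_on_SigmaI[OF fg has_sum_imp_summable[OF g]]) (auto simp: f_def)
  from has_sum_SigmaI[OF fg g this] have "(f has_sum suminf g) (UNIV \<times> UNIV)" .
  also have "(f has_sum suminf g) (UNIV \<times> UNIV) \<longleftrightarrow>
      ((\<lambda>(k1, k2). 1 / (real k1 ^ 5 * real k2 ^ 3)) has_sum suminf g) {(k1, k2). k1 > k2 \<and> k2 > 0}"
    by (rule has_sum_reindex_bij_witness[of _ "\<lambda>(k1, k2). (k2 - 1, k1 - k2 - 1)" "\<lambda>(n, k). (n + k + 2, Suc n)"])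
       (auto simp: f_def)
  finally have "double_zeta 5 3 = suminf g"
    unfolding double_zeta_def by (rule infsumI)
  moreover have "(\<lambda>n. of_real (g n) :: complex) sums of_real (suminf g)"
    by (rule sums_of_real[OF summable_sums]) (use sm in \<open>simp add: g_def\<close>)
  moreover have "of_real (g n) = zeta_tail 5 (Suc n) / of_nat (Suc n) ^ 3" for n
  proof -
    have "zeta_tail 5 (Suc n) = of_real (t (Suc n))" unfolding t_def by (rule zeta_tail_of_real) simp
    then show ?thesis by (simp add: g_def del: of_nat_Suc)
  qed
  ultimately show ?thesis by simp
qed

lemma f10c_of_real:
  assumes "1 / 2 < x"
  shows "f10c (of_real x) = of_real (f10 x)"
proof -
  have "of_real 3 * complex_of_real x = of_real (3 * x)" by simp
  then have "rGamma (3 * complex_of_real x) = of_real (rGamma (3 * x))"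
    by (metis of_real_numeral rGamma_complex_of_real)
  then show ?thesis
    unfolding f10c_def f10_def Gamma_complex_of_real
    by (simp add: rGamma_inverse_Gamma power_inverse divide_inverse mult_ac)
qed

text \<open>Along the real axis the complex derivative is the vector derivative of the restriction.
  By the induction hypothesis that restriction is real-valued, so its imaginary part has derivative
  0.\<close>

lemma higher_deriv_f10c_of_real:
  assumes "3 / 4 < x"
  shows "(deriv ^^ m) f10c (of_real x) = of_real ((deriv ^^ m) f10 x)"
  using assms
proof (induction m arbitrary: x)
  case 0
  then show ?case using f10c_of_real[of x] by simp
next
  case (Suc m)
  define D where "D = (deriv ^^ Suc m) f10c (of_real x)"
  have "(deriv ^^ m) f10c holomorphic_on {z. 3 / 4 < Re z}"
    by (rule holomorphic_higher_deriv[OF f10c_holomorphic_half_plane open_halfspace_Re_gt])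
  from holomorphic_derivI[OF this open_halfspace_Re_gt, of "of_real x"]
  have "((deriv ^^ m) f10c has_field_derivative D) (at (of_real x))"
    using Suc.prems by (simp add: D_def)
  from has_vector_derivative_real_field[OF this]
  have "((\<lambda>y. (deriv ^^ m) f10c (of_real y)) has_vector_derivative D) (at x)" .
  then have d: "((\<lambda>y. complex_of_real ((deriv ^^ m) f10 y)) has_vector_derivative D) (at x)"
    by (rule has_vector_derivative_transform_within_open[where S = "{3 / 4<..}"]) (use Suc in auto)
  have "((\<lambda>y. Re (complex_of_real ((deriv ^^ m) f10 y))) has_vector_derivative Re D) (at x)"
    by (rule bounded_linear.has_vector_derivative[OF bounded_linear_Re d])
  then have "deriv ((deriv ^^ m) f10) x = Re D"
    by (simp add: has_real_derivative_iff_has_vector_derivative [symmetric] DERIV_imp_deriv)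
  moreover have "((\<lambda>y. Im (complex_of_real ((deriv ^^ m) f10 y))) has_vector_derivative Im D) (at x)"
    by (rule bounded_linear.has_vector_derivative[OF bounded_linear_Im d])
  then have "Im D = 0"
    by (simp add: has_real_derivative_iff_has_vector_derivative [symmetric]) (metis DERIV_const DERIV_unique)
  ultimately show ?case by (simp add: D_def complex_eq_iff)
qed

text \<open>The second sum is not elementary; the others telescope up to it and single zeta values, since \<open>1 / n^s\<close> is the
  difference of consecutive tails.\<close>

lemma zeta_tail_power_sums:
  fixes d :: complex
  defines "z \<equiv> \<lambda>s. zeta_tail s 0"
  assumes d: "(\<lambda>n. zeta_tail 5 (Suc n) / of_nat (Suc n) ^ 3) sums d"
  shows "(\<lambda>n. (zeta_tail 3 (Suc n) + zeta_tail 3 n) / of_nat (Suc n) ^ 3) sums (z 3 ^ 2)"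
    and "(\<lambda>n. (zeta_tail 5 (Suc n) + zeta_tail 5 n) / of_nat (Suc n) ^ 3) sums (2 * d + z 8)"
    and "(\<lambda>n. (zeta_tail 3 (Suc n) + zeta_tail 3 n) / of_nat (Suc n) ^ 5) sums (2 * z 3 * z 5 - (2 * d + z 8))"
    and "(\<lambda>n. (zeta_tail 3 (Suc n) ^ 2 + zeta_tail 3 n ^ 2) / of_nat (Suc n) ^ 3) sums (2 / 3 * z 3 ^ 3 + z 9 / 3)"
proof -
  have tel: "(\<lambda>n. zeta_tail 3 n ^ i * zeta_tail 5 n ^ j - zeta_tail 3 (Suc n) ^ i * zeta_tail 5 (Suc n) ^ j) sums (z 3 ^ i * z 5 ^ j)"
    if "0 < i + j" for i j
  proof -
    have "(\<lambda>n. zeta_tail 3 n ^ i * zeta_tail 5 n ^ j) \<longlonglongrightarrow> 0 ^ i * 0 ^ j"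
      by (intro tendsto_mult tendsto_power zeta_tail_lim) auto
    moreover have "0 ^ i * 0 ^ j = (0 :: complex)" using that by auto
    ultimately have "(\<lambda>n. zeta_tail 3 n ^ i * zeta_tail 5 n ^ j) \<longlonglongrightarrow> 0" by simp
    from telescope_sums'[OF this] show ?thesis by (simp add: z_def)
  qed
  define u where "u = (\<lambda>n. 1 / of_nat (Suc n) :: complex)"
  have t3: "zeta_tail 3 n = zeta_tail 3 (Suc n) + u n ^ 3" and t5: "zeta_tail 5 n = zeta_tail 5 (Suc n) + u n ^ 5" for n
    using zeta_tail_step[of 3 n] zeta_tail_step[of 5 n] by (simp_all add: u_def power_one_over)
  have div: "x / of_nat (Suc n) ^ k = x * u n ^ k" for x k n
    by (simp only: u_def divide_inverse power_inverse mult_1_left)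
  have zs: "(\<lambda>n. u n ^ s) sums z s" if "2 \<le> s" for s
    using zeta_tail_0_sums[OF that] by (simp add: u_def z_def power_one_over del: of_nat_Suc)
  have "(zeta_tail 3 (Suc n) + zeta_tail 3 n) / of_nat (Suc n) ^ 3 =
      zeta_tail 3 n ^ 2 * zeta_tail 5 n ^ 0 - zeta_tail 3 (Suc n) ^ 2 * zeta_tail 5 (Suc n) ^ 0" for n
    unfolding div t3[of n] by (simp add: algebra_simps power2_eq_square)
  then show "(\<lambda>n. (zeta_tail 3 (Suc n) + zeta_tail 3 n) / of_nat (Suc n) ^ 3) sums (z 3 ^ 2)"
    using tel[of 2 0] by simp
  have "(\<lambda>n. 2 * (zeta_tail 5 (Suc n) * u n ^ 3) + u n ^ 8) sums (2 * d + z 8)"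
    using d unfolding div by (intro sums_add sums_mult zs) auto
  moreover have "(zeta_tail 5 (Suc n) + zeta_tail 5 n) / of_nat (Suc n) ^ 3 = 2 * (zeta_tail 5 (Suc n) * u n ^ 3) + u n ^ 8" for n
    unfolding div t5[of n] by (simp add: algebra_simps flip: power_add)
  ultimately show G: "(\<lambda>n. (zeta_tail 5 (Suc n) + zeta_tail 5 n) / of_nat (Suc n) ^ 3) sums (2 * d + z 8)"
    by simp
  \<comment> \<open>Twice the difference of consecutive products of tails is the sum of two
    symmetric products, one with weight \<open>u^3\<close> and one with \<open>u^5\<close>; the
    former has just been summed.\<close>
  have "(zeta_tail 3 (Suc n) + zeta_tail 3 n) / of_nat (Suc n) ^ 5 =
      2 * (zeta_tail 3 n ^ 1 * zeta_tail 5 n ^ 1 - zeta_tail 3 (Suc n) ^ 1 * zeta_tail 5 (Suc n) ^ 1) -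
      (zeta_tail 5 (Suc n) + zeta_tail 5 n) / of_nat (Suc n) ^ 3" for n
    unfolding div t3[of n] t5[of n] by (simp add: algebra_simps)
  then show "(\<lambda>n. (zeta_tail 3 (Suc n) + zeta_tail 3 n) / of_nat (Suc n) ^ 5) sums (2 * z 3 * z 5 - (2 * d + z 8))"
    using sums_diff[OF sums_mult[OF tel[of 1 1], of 2] G] by (simp add: mult.assoc)
  \<comment> \<open>A discrete integral of t^2: the cubes telescope, and \<open>v^9 / 3\<close> is
    the error of the trapezoidal average.\<close>
  have "2 / 3 * ((a + v ^ 3) ^ 3 - a ^ 3) + 1 / 3 * v ^ 9 = (a ^ 2 + (a + v ^ 3) ^ 2) * v ^ 3" for a v :: complex
    by (simp add: field_simps eval_nat_numeral)
  then have "(zeta_tail 3 (Suc n) ^ 2 + zeta_tail 3 n ^ 2) / of_nat (Suc n) ^ 3 =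
      2 / 3 * (zeta_tail 3 n ^ 3 * zeta_tail 5 n ^ 0 - zeta_tail 3 (Suc n) ^ 3 * zeta_tail 5 (Suc n) ^ 0) + 1 / 3 * u n ^ 9" for n
    unfolding div t3[of n] by simp
  then show "(\<lambda>n. (zeta_tail 3 (Suc n) ^ 2 + zeta_tail 3 n ^ 2) / of_nat (Suc n) ^ 3) sums (2 / 3 * z 3 ^ 3 + z 9 / 3)"
    using sums_add[OF sums_mult[OF tel[of 3 0], of "2 / 3"] sums_mult[OF zs[of 9], of "1 / 3"]] by simp
qed

lemma log_sum_coeff_eval:
  fixes n :: nat
  defines "u \<equiv> 1 / of_nat (Suc n) :: complex"
  defines "t \<equiv> \<lambda>s. zeta_tail s (Suc n)" and "t' \<equiv> \<lambda>s. zeta_tail s n"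
  shows "log_sum_coeff n 3 = 16 * (t 3 + t' 3) * u"
    and "log_sum_coeff n 4 = 48 * (t 3 - t' 3) * u ^ 2"
    and "log_sum_coeff n 5 = 144 * (t 3 + t' 3) * u ^ 3 + 96 * (t 5 + t' 5) * u"
    and "log_sum_coeff n 6 = 432 * (t 3 - t' 3) * u ^ 4 + 288 * (t 5 - t' 5) * u ^ 2 + 128 * (t 3 ^ 2 + t' 3 ^ 2) * u"
    and "log_sum_coeff n 7 = 1296 * (t 3 + t' 3) * u ^ 5 + 864 * (t 5 + t' 5) * u ^ 3 + 384 * (t 3 ^ 2 - t' 3 ^ 2) * u ^ 2 +
      624 * (t 7 + t' 7) * u"
    and "log_sum_coeff n 8 = 3888 * (t 3 - t' 3) * u ^ 6 + 2592 * (t 5 - t' 5) * u ^ 4 + 1152 * (t 3 ^ 2 + t' 3 ^ 2) * u ^ 3 +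
      1872 * (t 7 - t' 7) * u ^ 2 + 1536 * (t 3 * t 5 + t' 3 * t' 5) * u"
proof -
  define A where "A = (\<lambda>i. fps_nth (ph_fps 3 (Suc n)) i - (if i = 0 then 1 else 0))"
  define B where "B = (\<lambda>i. fps_nth (ph_fps 3 n) i - (if i = 0 then 1 else 0))"
  have c: "log_sum_coeff n m = (\<Sum>i=0..m. A i * 3 ^ (m - i) * u ^ Suc (m - i) + B i * (- 3) ^ (m - i) * u ^ Suc (m - i))" for m
    unfolding log_sum_coeff_def A_def B_def u_def by (simp only: divide_inverse power_inverse mult_1_left)
  have A: "A 0 = 0" "A 1 = 0" "A 2 = 0" "A 3 = 16 * t 3" "A 4 = 0" "A 5 = 96 * t 5" "A 6 = 128 * t 3 ^ 2" "A 7 = 624 * t 7"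
    "A 8 = 1536 * t 3 * t 5"
    using ph_fps_nth_3[of "Suc n"] by (simp_all add: A_def t_def ph_fps_0)
  have B: "B 0 = 0" "B 1 = 0" "B 2 = 0" "B 3 = 16 * t' 3" "B 4 = 0" "B 5 = 96 * t' 5" "B 6 = 128 * t' 3 ^ 2" "B 7 = 624 * t' 7"
    "B 8 = 1536 * t' 3 * t' 5"
    using ph_fps_nth_3[of n] by (simp_all add: B_def t'_def ph_fps_0)
  have s: "(\<Sum>i=0..3. f i) = f 0 + f 1 + f 2 + f 3"
    "(\<Sum>i=0..4. f i) = f 0 + f 1 + f 2 + f 3 + f 4"
    "(\<Sum>i=0..5. f i) = f 0 + f 1 + f 2 + f 3 + f 4 + f 5"
    "(\<Sum>i=0..6. f i) = f 0 + f 1 + f 2 + f 3 + f 4 + f 5 + f 6"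
    "(\<Sum>i=0..7. f i) = f 0 + f 1 + f 2 + f 3 + f 4 + f 5 + f 6 + f 7"
    "(\<Sum>i=0..8. f i) = f 0 + f 1 + f 2 + f 3 + f 4 + f 5 + f 6 + f 7 + f 8" for f :: "nat \<Rightarrow> complex"
    by (simp_all add: eval_nat_numeral)
  note AB = A[unfolded One_nat_def] B[unfolded One_nat_def]
  show "log_sum_coeff n 3 = 16 * (t 3 + t' 3) * u"
    unfolding c s by (simp add: AB algebra_simps)
  show "log_sum_coeff n 4 = 48 * (t 3 - t' 3) * u ^ 2"
    unfolding c s by (simp add: AB algebra_simps power2_eq_square)
  show "log_sum_coeff n 5 = 144 * (t 3 + t' 3) * u ^ 3 + 96 * (t 5 + t' 5) * u"
    unfolding c s by (simp add: AB algebra_simps power3_eq_cube power2_eq_square)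
  show "log_sum_coeff n 6 = 432 * (t 3 - t' 3) * u ^ 4 + 288 * (t 5 - t' 5) * u ^ 2 + 128 * (t 3 ^ 2 + t' 3 ^ 2) * u"
    unfolding c s by (simp add: AB algebra_simps power4_eq_xxxx power3_eq_cube power2_eq_square)
  show "log_sum_coeff n 7 = 1296 * (t 3 + t' 3) * u ^ 5 + 864 * (t 5 + t' 5) * u ^ 3 + 384 * (t 3 ^ 2 - t' 3 ^ 2) * u ^ 2 +
      624 * (t 7 + t' 7) * u"
    unfolding c s by (simp add: AB algebra_simps power_numeral_reduce)
  show "log_sum_coeff n 8 = 3888 * (t 3 - t' 3) * u ^ 6 + 2592 * (t 5 - t' 5) * u ^ 4 + 1152 * (t 3 ^ 2 + t' 3 ^ 2) * u ^ 3 +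
      1872 * (t 7 - t' 7) * u ^ 2 + 1536 * (t 3 * t 5 + t' 3 * t' 5) * u"
    unfolding c s by (simp add: AB algebra_simps power_numeral_reduce)
qed

text \<open>Differences of consecutive tails are powers of 1 / (n + 1) and lead to single zeta
  values; symmetric sums with weight 1 / (n + 1) are those of \<open>dixon_coeffs\<close>, with
  higher powers those of \<open>zeta_tail_power_sums\<close>. The value \<open>d\<close> enters in
  order 7 only.\<close>

lemma log_sum_coeff_suminf:
  fixes d :: complex
  defines "z \<equiv> \<lambda>s. zeta_tail s 0"
  assumes d: "(\<lambda>n. zeta_tail 5 (Suc n) / of_nat (Suc n) ^ 3) sums d"
  shows "(\<Sum>n. log_sum_coeff n 3) = 24 * z 4"
    and "(\<Sum>n. log_sum_coeff n 4) = - 48 * z 5"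
    and "(\<Sum>n. log_sum_coeff n 5) = 48 * z 3 ^ 2 + 240 * z 6"
    and "(\<Sum>n. log_sum_coeff n 6) = - 528 * z 7"
    and "(\<Sum>n. log_sum_coeff n 7) = 576 * z 3 * z 5 - 96 * d + 2136 * z 8"
    and "(\<Sum>n. log_sum_coeff n 8) = - 5152 * z 9 + 256 * z 3 ^ 3"
proof -
  define u where "u = (\<lambda>n. 1 / of_nat (Suc n) :: complex)"
  define t where "t = zeta_tail"
  have step: "t 3 n = t 3 (Suc n) + u n ^ 3" "t 5 n = t 5 (Suc n) + u n ^ 5" "t 7 n = t 7 (Suc n) + u n ^ 7" for n
    using zeta_tail_step[of 3 n] zeta_tail_step[of 5 n] zeta_tail_step[of 7 n] by (simp_all add: u_def t_def power_one_over)
  have div: "x / of_nat (Suc n) ^ k = x * u n ^ k" "x / of_nat (Suc n) = x * u n" for x k n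
    by (simp_all only: u_def divide_inverse power_inverse mult_1_left)
  have zs: "(\<lambda>n. u n ^ s) sums z s" if "2 \<le> s" for s
    using zeta_tail_0_sums[OF that] by (simp add: u_def z_def power_one_over del: of_nat_Suc)
  note Q = dixon_coeffs[folded t_def, unfolded div] zeta_tail_power_sums[OF d, folded t_def, unfolded div]
  have u: "1 / of_nat (Suc n) = u n" for n by (simp add: u_def)
  note c = log_sum_coeff_eval[folded t_def, unfolded u]
  have z: "t s 0 = z s" for s by (simp add: z_def t_def)
  have r3: "log_sum_coeff n 3 = 16 * ((t 3 (Suc n) + t 3 n) * u n)" for n
    unfolding c by (simp add: mult_ac del: of_nat_Suc)
  show "(\<Sum>n. log_sum_coeff n 3) = 24 * z 4"
    using sums_unique[OF sums_mult[OF Q(1), of 16]] unfolding r3 z by simp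
  have r4: "log_sum_coeff n 4 = - 48 * u n ^ 5" for n
  proof -
    have "48 * (a - (a + v ^ 3)) * v ^ 2 = - 48 * v ^ 5" for a v :: complex by algebra
    then show ?thesis unfolding c step[of n] u_def [symmetric] .
  qed
  show "(\<Sum>n. log_sum_coeff n 4) = - 48 * z 5"
    using sums_unique[OF sums_mult[OF zs[of 5], of "- 48"]] unfolding r4 by simp
  have r5: "log_sum_coeff n 5 = 144 * ((t 3 (Suc n) + t 3 n) * u n ^ 3) + 96 * ((t 5 (Suc n) + t 5 n) * u n)" for n
    unfolding c by (simp add: mult_ac del: of_nat_Suc)
  show "(\<Sum>n. log_sum_coeff n 5) = 48 * z 3 ^ 2 + 240 * z 6"
    using sums_unique[OF sums_add[OF sums_mult[OF Q(6), of 144] sums_mult[OF Q(2), of 96]]] unfolding r5 z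
    by (simp add: algebra_simps)
  have r6: "log_sum_coeff n 6 = - 720 * u n ^ 7 + 128 * ((t 3 (Suc n) ^ 2 + t 3 n ^ 2) * u n)" for n
  proof -
    have "432 * (a - (a + v ^ 3)) * v ^ 4 + 288 * (b - (b + v ^ 5)) * v ^ 2 + 128 * (a ^ 2 + (a + v ^ 3) ^ 2) * v =
      - 720 * v ^ 7 + 128 * ((a ^ 2 + (a + v ^ 3) ^ 2) * v)" for a b v :: complex by algebra
    from this[of "t 3 (Suc n)" "u n" "t 5 (Suc n)"] show ?thesis unfolding c step[of n] .
  qed
  show "(\<Sum>n. log_sum_coeff n 6) = - 528 * z 7"
    using sums_unique[OF sums_add[OF sums_mult[OF zs[of 7], of "- 720"] sums_mult[OF Q(3), of 128]]] unfolding r6 z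
    by (simp add: algebra_simps)
  \<comment> \<open>As the difference of the squared tails is minus their sum times
    \<open>u^3\<close>, the coefficient 1296 drops by 384 to 912. Together with 864 this leaves 2
    (864 - 912) = - 96 for \<open>d\<close>.\<close>
  have r7: "log_sum_coeff n 7 = 912 * ((t 3 (Suc n) + t 3 n) * u n ^ 5) + 864 * ((t 5 (Suc n) + t 5 n) * u n ^ 3) +
      624 * ((t 7 (Suc n) + t 7 n) * u n)" for n
  proof -
    have "1296 * (a + (a + v ^ 3)) * v ^ 5 + B + 384 * (a ^ 2 - (a + v ^ 3) ^ 2) * v ^ 2 + C =
      912 * ((a + (a + v ^ 3)) * v ^ 5) + B + C" for a v B C :: complex by algebra
    from this[of "t 3 (Suc n)" "u n"] show ?thesis unfolding c step(1)[of n] by (simp add: mult_ac)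
  qed
  show "(\<Sum>n. log_sum_coeff n 7) = 576 * z 3 * z 5 - 96 * d + 2136 * z 8"
    using sums_unique[OF sums_add[OF sums_add[OF sums_mult[OF Q(8), of 912] sums_mult[OF Q(7), of 864]] sums_mult[OF Q(4), of 624]]]
    unfolding r7 z by (simp add: algebra_simps)
  have r8: "log_sum_coeff n 8 = - 8352 * u n ^ 9 + 1152 * ((t 3 (Suc n) ^ 2 + t 3 n ^ 2) * u n ^ 3) +
      1536 * ((t 3 (Suc n) * t 5 (Suc n) + t 3 n * t 5 n) * u n)" for n
  proof -
    have "3888 * (a - (a + v ^ 3)) * v ^ 6 + 2592 * (b - (b + v ^ 5)) * v ^ 4 + B + 1872 * (e - (e + v ^ 7)) * v ^ 2 + C =
      - 8352 * v ^ 9 + B + C" for a b e v B C :: complex by algebra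
    from this[of "t 3 (Suc n)" "u n" "t 5 (Suc n)" _ "t 7 (Suc n)"] show ?thesis
      unfolding c step[of n] by (simp add: algebra_simps)
  qed
  show "(\<Sum>n. log_sum_coeff n 8) = - 5152 * z 9 + 256 * z 3 ^ 3"
    using sums_unique[OF sums_add[OF sums_add[OF sums_mult[OF zs[of 9], of "- 8352"] sums_mult[OF Q(9), of 1152]] sums_mult[OF Q(5), of 1536]]]
    unfolding r8 z by (simp add: algebra_simps)
qed

lemma log_part_coeffs:
  fixes d :: complex
  defines "z \<equiv> \<lambda>s. zeta_tail s 0"
  assumes d: "(\<lambda>n. zeta_tail 5 (Suc n) / of_nat (Suc n) ^ 3) sums d"
  shows "fps_nth log_part_fps 4 = - 6 * z 4"
    and "fps_nth log_part_fps 5 = 34 * z 5"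
    and "fps_nth log_part_fps 6 = 16 / 3 * z 3 ^ 2 - 150 * z 6"
    and "fps_nth log_part_fps 7 = 530 * z 7"
    and "fps_nth log_part_fps 8 = 64 * z 3 * z 5 - 96 * d - 1854 * z 8"
    and "fps_nth log_part_fps 9 = 51698 / 9 * z 9 + 256 / 9 * z 3 ^ 3"
proof -
  have W: "fps_nth log_part_fps (Suc m) = (\<Sum>n. log_sum_coeff n m) - fps_nth (ph_fps 3 0) (Suc m) / 3 +
      (- 1) ^ Suc m * (3 * 2 ^ m - 2 * 3 ^ m) * z (Suc m)" if "0 < m" for m
    unfolding log_part_fps_Suc log_sum_fps_nth using that by (simp add: digamma_fps_def z_def algebra_simps)
  note S = log_sum_coeff_suminf[OF d] ph_fps_nth_3
  show "fps_nth log_part_fps 4 = - 6 * z 4" using W[of 3] by (simp add: S z_def)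
  show "fps_nth log_part_fps 5 = 34 * z 5" using W[of 4] by (simp add: S z_def)
  show "fps_nth log_part_fps 6 = 16 / 3 * z 3 ^ 2 - 150 * z 6" using W[of 5] by (simp add: S z_def)
  show "fps_nth log_part_fps 7 = 530 * z 7" using W[of 6] by (simp add: S z_def)
  show "fps_nth log_part_fps 8 = 64 * z 3 * z 5 - 96 * d - 1854 * z 8" using W[of 7] by (simp add: S z_def)
  show "fps_nth log_part_fps 9 = 51698 / 9 * z 9 + 256 / 9 * z 3 ^ 3" using W[of 8]
    by (simp add: S z_def add_divide_distrib)
qed

lemma main_coeffs:
  fixes d :: complex
  defines "z \<equiv> \<lambda>s. zeta_tail s 0"
  assumes d: "(\<lambda>n. zeta_tail 5 (Suc n) / of_nat (Suc n) ^ 3) sums d"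
  shows "fps_nth main_fps 4 = - 36 * z 4"
    and "fps_nth main_fps 5 = 204 * z 5 - 24 * z 2 * z 3"
    and "fps_nth main_fps 6 = 32 * z 3 ^ 2 - 522 * z 6"
    and "fps_nth main_fps 7 = 3180 * z 7 + 24 * z 3 * z 4 - 1224 * z 2 * z 5"
    and "fps_nth main_fps 8 = 384 * z 3 * z 5 - 2376 * z 8 - 576 * d - 192 * z 2 * z 3 ^ 2"
    and "fps_nth main_fps 9 = 103396 / 3 * z 9 + 512 / 3 * z 3 ^ 3 + 40 * z 3 * z 6 + 1224 * z 4 * z 5 - 19080 * z 2 * z 7"
proof -
  define p where "p = (of_real pi :: complex)"
  define T where "T = cot_fps ^ 2 - fps_const (of_real pi ^ 2 / 3) * fps_X ^ 2"
  have zp: "z 2 = p ^ 2 / 6" "z 4 = p ^ 4 / 90" "z 6 = p ^ 6 / 945" "z 8 = p ^ 8 / 9450"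
    unfolding z_def p_def by (rule even_zeta_values)+
  have s: "(\<Sum>i=0..1. f i) = f 0 + f 1" "(\<Sum>i=0..2. f i) = f 0 + f 1 + f 2"
    "(\<Sum>i=0..3. f i) = f 0 + f 1 + f 2 + f 3"
    "(\<Sum>i=0..4. f i) = f 0 + f 1 + f 2 + f 3 + f 4"
    "(\<Sum>i=0..5. f i) = f 0 + f 1 + f 2 + f 3 + f 4 + f 5"
    "(\<Sum>i=0..6. f i) = f 0 + f 1 + f 2 + f 3 + f 4 + f 5 + f 6"
    "(\<Sum>i=0..7. f i) = f 0 + f 1 + f 2 + f 3 + f 4 + f 5 + f 6 + f 7"
    "(\<Sum>i=0..8. f i) = f 0 + f 1 + f 2 + f 3 + f 4 + f 5 + f 6 + f 7 + f 8"
    "(\<Sum>i=0..9. f i) = f 0 + f 1 + f 2 + f 3 + f 4 + f 5 + f 6 + f 7 + f 8 + f 9" for f :: "nat \<Rightarrow> complex"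
    by (simp_all add: eval_nat_numeral)
  have C: "fps_nth cot_fps 0 = 1" "fps_nth cot_fps 1 = 0" "fps_nth cot_fps 2 = - 2 * z 2" "fps_nth cot_fps 3 = 0"
    "fps_nth cot_fps 4 = - 2 * z 4" "fps_nth cot_fps 5 = 0" "fps_nth cot_fps 6 = - 2 * z 6"
    by (simp add: cot_fps_def) (simp_all add: cot_fps_nth z_def)
  have T: "fps_nth T m = (\<Sum>i=0..m. fps_nth cot_fps i * fps_nth cot_fps (m - i)) - (if m = 2 then p ^ 2 / 3 else 0)" for m
    unfolding T_def power2_eq_square[of cot_fps] by (simp add: fps_mult_nth[of cot_fps cot_fps] fps_X_power_nth p_def)
  note C' = C[unfolded One_nat_def]
  have T0: "fps_nth T 0 = 1" unfolding T by (simp add: C)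
  have T1: "fps_nth T 1 = 0" unfolding T s by (simp add: C')
  \<comment> \<open>The subtracted pi^2 / 3 is 2 zeta(2), which joins the - 4 zeta(2) of the square.
    In orders 4 and 6 the products of even zeta values reduce to single ones, all being rational
    multiples of powers of pi.\<close>
  have T2: "fps_nth T 2 = - 6 * z 2" unfolding T s by (simp add: C' zp)
  have T3: "fps_nth T 3 = 0" unfolding T s by (simp add: C')
  have T4: "fps_nth T 4 = 6 * z 4" unfolding T s by (simp add: C' zp flip: power_add power_mult_distrib)
  have T5: "fps_nth T 5 = 0" unfolding T s by (simp add: C')
  have T6: "fps_nth T 6 = 10 * z 6" unfolding T s by (simp add: C' zp flip: power_add power_mult_distrib)
  note Ts = T0 T1[unfolded One_nat_def] T2 T3 T4 T5 T6
  have M: "fps_nth main_fps m = 6 * (\<Sum>i=0..m. fps_nth T i * fps_nth log_part_fps (m - i))" for m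
    unfolding main_fps_def T_def [symmetric] mult.assoc fps_mult_left_const_nth by (simp only: fps_mult_nth)
  have z: "zeta_tail s 0 = z s" for s by (simp add: z_def)
  note W = log_part_fps_0 log_part_fps_small[unfolded One_nat_def z] log_part_coeffs[OF d, unfolded z]
  \<comment> \<open>The products of two even zeta values that arise in orders 6 and 8 of
    \<open>main_fps\<close>.\<close>
  have e: "z 2 * z 4 = 7 / 4 * z 6" "z 2 * z 6 = 5 / 3 * z 8" "z 4 * z 4 = 7 / 6 * z 8"
    unfolding zp by (simp_all flip: power_add)
  show "fps_nth main_fps 4 = - 36 * z 4"
    unfolding M s by (simp add: Ts W)
  show "fps_nth main_fps 5 = 204 * z 5 - 24 * z 2 * z 3"
    unfolding M s by (simp add: Ts W algebra_simps)
  have "fps_nth main_fps 6 = 32 * z 3 ^ 2 - 900 * z 6 + 216 * (z 2 * z 4)"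
    unfolding M s by (simp add: Ts W algebra_simps)
  then show "fps_nth main_fps 6 = 32 * z 3 ^ 2 - 522 * z 6" unfolding e by simp
  show "fps_nth main_fps 7 = 3180 * z 7 + 24 * z 3 * z 4 - 1224 * z 2 * z 5"
    unfolding M s by (simp add: Ts W algebra_simps)
  have "fps_nth main_fps 8 = 384 * z 3 * z 5 - 576 * d - 11124 * z 8 - 192 * z 2 * z 3 ^ 2 + 5400 * (z 2 * z 6) - 216 * (z 4 * z 4)"
    unfolding M s by (simp add: Ts W algebra_simps)
  then show "fps_nth main_fps 8 = 384 * z 3 * z 5 - 2376 * z 8 - 576 * d - 192 * z 2 * z 3 ^ 2" unfolding e by simp
  show "fps_nth main_fps 9 = 103396 / 3 * z 9 + 512 / 3 * z 3 ^ 3 + 40 * z 3 * z 6 + 1224 * z 4 * z 5 - 19080 * z 2 * z 7"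
    unfolding M s by (simp add: Ts W algebra_simps)
qed

lemma f10_derivative_sums:
  assumes "0 < m" "fps_nth main_fps (m + 3) = of_real e"
  shows "(\<lambda>k. (deriv ^^ m) f10 (real (Suc k))) sums (fact m * e)"
proof -
  have "(deriv ^^ m) f10c (of_nat (Suc n)) / fact m = of_real ((deriv ^^ m) f10 (real (Suc n)) / fact m)" for n
  proof -
    have "3 / 4 < real (Suc n)" by simp
    from higher_deriv_f10c_of_real[OF this, of m] show ?thesis by (simp del: of_nat_Suc)
  qed
  then have "(\<lambda>n. (deriv ^^ m) f10 (real (Suc n)) / fact m) sums e"
    using f10c_derivative_sums[OF assms(1)] unfolding assms(2) by (simp only: sums_of_real_iff)
  from sums_mult[OF this, of "fact m"] show ?thesis by simp
qed

theorem theorem1p12: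
  shows "(\<forall>m\<in>{1..6}. summable (\<lambda>k. (deriv ^^ m) f10 (real (Suc k)))) \<and>
    (\<Sum>k. deriv f10 (real (Suc k))) = - 36 * zeta 4 \<and>
    (\<Sum>k. (deriv ^^ 2) f10 (real (Suc k))) = 24 * (17 * zeta 5 - 2 * zeta 2 * zeta 3) \<and>
    (\<Sum>k. (deriv ^^ 3) f10 (real (Suc k))) = 12 * (16 * zeta 3 ^ 2 - 261 * zeta 6) \<and>
    (\<Sum>k. (deriv ^^ 4) f10 (real (Suc k))) =
           288 * (265 * zeta 7 + 2 * zeta 3 * zeta 4 - 102 * zeta 2 * zeta 5) \<and>
    1 / 2880 * (\<Sum>k. (deriv ^^ 5) f10 (real (Suc k))) =
           16 * zeta 3 * zeta 5 - 99 * zeta 8 - 24 * double_zeta 5 3 - 8 * zeta 2 * zeta 3 ^ 2 \<and>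
    1 / 960 * (\<Sum>k. (deriv ^^ 6) f10 (real (Suc k))) =
           25849 * zeta 9 + 128 * zeta 3 ^ 3 + 30 * zeta 3 * zeta 6
             + 918 * zeta 4 * zeta 5 - 14310 * zeta 2 * zeta 7"
proof -
  have z: "zeta_tail (numeral k) 0 = of_real (zeta (numeral k))" if "2 \<le> (numeral k :: nat)" for k
    using zeta_of_nat[OF that] by simp
  have z': "zeta_tail 2 0 = of_real (zeta 2)" "zeta_tail 3 0 = of_real (zeta 3)" "zeta_tail 4 0 = of_real (zeta 4)"
    "zeta_tail 5 0 = of_real (zeta 5)" "zeta_tail 6 0 = of_real (zeta 6)" "zeta_tail 7 0 = of_real (zeta 7)"
    "zeta_tail 8 0 = of_real (zeta 8)" "zeta_tail 9 0 = of_real (zeta 9)"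
    by (rule z, simp)+
  \<comment> \<open>Here \<open>d\<close> becomes the double zeta value. Each sum below is a Taylor
    coefficient times \<open>fact m\<close>.\<close>
  note c = main_coeffs[OF double_zeta_sums, unfolded z']
  have s1: "(\<lambda>k. (deriv ^^ 1) f10 (real (Suc k))) sums (fact 1 * (- 36 * zeta 4))"
    by (rule f10_derivative_sums) (use c in simp_all)
  have s2: "(\<lambda>k. (deriv ^^ 2) f10 (real (Suc k))) sums (fact 2 * (204 * zeta 5 - 24 * zeta 2 * zeta 3))"
    by (rule f10_derivative_sums) (use c in simp_all)
  have s3: "(\<lambda>k. (deriv ^^ 3) f10 (real (Suc k))) sums (fact 3 * (32 * zeta 3 ^ 2 - 522 * zeta 6))"
    by (rule f10_derivative_sums) (use c in simp_all)
  have s4: "(\<lambda>k. (deriv ^^ 4) f10 (real (Suc k))) sums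
      (fact 4 * (3180 * zeta 7 + 24 * zeta 3 * zeta 4 - 1224 * zeta 2 * zeta 5))"
    by (rule f10_derivative_sums) (use c in simp_all)
  have s5: "(\<lambda>k. (deriv ^^ 5) f10 (real (Suc k))) sums
      (fact 5 * (384 * zeta 3 * zeta 5 - 2376 * zeta 8 - 576 * double_zeta 5 3 - 192 * zeta 2 * zeta 3 ^ 2))"
    by (rule f10_derivative_sums) (use c in simp_all)
  have s6: "(\<lambda>k. (deriv ^^ 6) f10 (real (Suc k))) sums
      (fact 6 * (103396 / 3 * zeta 9 + 512 / 3 * zeta 3 ^ 3 + 40 * zeta 3 * zeta 6 + 1224 * zeta 4 * zeta 5 - 19080 * zeta 2 * zeta 7))"
    by (rule f10_derivative_sums) (use c in simp_all)
  have "m = 1 \<or> m = 2 \<or> m = 3 \<or> m = 4 \<or> m = 5 \<or> m = 6" if "m \<in> {1..6}" for m :: nat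
    using that by auto
  then have "summable (\<lambda>k. (deriv ^^ m) f10 (real (Suc k)))" if "m \<in> {1..6}" for m
    using that sums_summable[OF s1] sums_summable[OF s2] sums_summable[OF s3] sums_summable[OF s4]
      sums_summable[OF s5] sums_summable[OF s6] by blast
  moreover note sums_unique[OF s1, symmetric] sums_unique[OF s2, symmetric] sums_unique[OF s3, symmetric]
    sums_unique[OF s4, symmetric] sums_unique[OF s5, symmetric] sums_unique[OF s6, symmetric]
  ultimately show ?thesis
    by (simp add: fact_numeral algebra_simps del: of_nat_Suc)
qed

end
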